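(* Let $(X,d,\mathfrak m)$ be a doubling metric measure space. Then $(X,d,\mathfrak m)$ satisfies a $1$-Poincaré inequality if and only if there exist $C>0$ and $L\ge1$ such that $$\mathrm{width}_{x,y}(A)\le C\,\mathfrak m_{x,y}^L(A)$$ for every $x,y\in X$ and every Borel set $A\subseteq X$.
   Context: A metric measure space $(X,d,\mathfrak m)$ is a complete separable metric space $(X,d)$ with a nonnegative Borel measure $\mathfrak m$, finite on bounded sets and not identically zero. It is doubling if there is $C_D>0$ with $\mathfrak m(B_{2r}(z))\le C_D\,\mathfrak m(B_r(z))$ for all $z\in X$, $r>0$, where $B_r(z)$ is the open ball. $\Gamma_{x,y}$ is the set of Lipschitz curves $\gamma\colon[0,1]\to X$ with $\gamma(0)=x$, $\gamma(1)=y$ (for $x=y$ only the constant curve). For Borel $A\subseteq X$, $\ell(\gamma\cap A)=\int_0^1\chi_A(\gamma(t))|\dot\gamma(t)|\,dt$, with $|\dot\gamma|$ the metric speed, and $\mathrm{width}_{x,y}(A)=\inf_{\gamma\in\Gamma_{x,y}}\ell(\gamma\cap A)$ (with $\inf\emptyset=+\infty$). Riesz measure: $R_{x,y}(z)=\frac{d(x,z)}{\mathfrak m(B_{d(x,z)}(x))}+\frac{d(y,z)}{\mathfrak m(B_{d(y,z)}(y))}$ for $z\ne x,y$, and $R_{x,y}(x)=R_{x,y}(y)=0$. For $L\ge1$ let $B_{x,y}^L=B_{2Ld(x,y)}(x)\cup B_{2Ld(x,y)}(y)$, $R^L_{x,y}=\chi_{B^L_{x,y}}R_{x,y}$ and $\mathfrak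 m_{x,y}^L=R^L_{x,y}\,\mathfrak m$. $(X,d,\mathfrak m)$ satisfies a (weak) $1$-Poincaré inequality if there are $C_P\ge1$, $\lambda\ge1$ such that for every Lipschitz $u\colon X\to\mathbb R$, $z\in X$, $r>0$, $$\frac1{\mathfrak m(B_r(z))}\int_{B_r(z)}|u-u_{B_r(z)}|\,d\mathfrak m\le C_P\,r\,\frac1{\mathfrak m(B_{\lambda r}(z))}\int_{B_{\lambda r}(z)}\mathrm{lip}\,u\,d\mathfrak m,$$ where $u_{B}$ is the $\mathfrak m$-average of $u$ on $B$ and $\mathrm{lip}\,u(z)=\limsup_{w\to z}\frac{|u(w)-u(z)|}{d(w,z)}$ ($=0$ at isolated points). *)

theory Defs
  imports "HOL-Analysis.Analysis"
begin

text \<open>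
  The complete separable metric space \<open>(X, d)\<close> is a type of class \<^class>\<open>polish_space\<close>, whose
  metric is \<^const>\<open>dist\<close>: the class is complete metric spaces with a second countable topology,
  and for metric spaces second countable is the same as separable.
\<close>

definition metric_measure_space :: "'a::polish_space measure \<Rightarrow> bool" where
  "metric_measure_space M \<longleftrightarrow>
     sets M = sets borel \<and>
     (\<forall>A\<in>sets M. bounded A \<longrightarrow> emeasure M A < \<infinity>) \<and>
     emeasure M UNIV \<noteq> 0"

definition doubling :: "'a::polish_space measure \<Rightarrow> bool" where
  "doubling M \<longleftrightarrow>
     (\<exists>C::real. C > 0 \<and>
        (\<forall>z. \<forall>r::real. r > 0 \<longrightarrow>
           emeasure M (ball z (2 * r)) \<le> ennreal C * emeasure M (ball z r)))"

text \<open>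
  Curves are total functions on the reals of which only the restriction to \<open>[0,1]\<close> matters.
\<close>

definition lipschitz_curves :: "'a::metric_space \<Rightarrow> 'a \<Rightarrow> (real \<Rightarrow> 'a) set" where
  "lipschitz_curves x y =
     {\<gamma>. (\<exists>K. K-lipschitz_on {0..1} \<gamma>) \<and> \<gamma> 0 = x \<and> \<gamma> 1 = y \<and>
         (x = y \<longrightarrow> (\<forall>t\<in>{0..1}. \<gamma> t = x))}"

text \<open>
  The limit defining the metric speed of a Lipschitz curve exists at almost every \<open>t\<close>; the value
  \<open>0\<close> at the remaining points does not influence the integral below.
\<close>

definition metric_speed :: "(real \<Rightarrow> 'a::metric_space) \<Rightarrow> real \<Rightarrow> real" where
  "metric_speed \<gamma> t =
     (let q = (\<lambda>s. dist (\<gamma> s) (\<gamma> t) / \<bar>s - t\<bar>); F = at t within {0..1}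
      in if \<exists>l. (q \<longlongrightarrow> l) F then Lim F q else 0)"

definition curve_length_in :: "(real \<Rightarrow> 'a::metric_space) \<Rightarrow> 'a set \<Rightarrow> ennreal" where
  "curve_length_in \<gamma> A =
     (\<integral>\<^sup>+t\<in>{0..1}. (indicator A (\<gamma> t) * ennreal (metric_speed \<gamma> t)) \<partial>lborel)"

text \<open>In \<^typ>\<open>ennreal\<close> the infimum of the empty set is \<open>\<infinity>\<close>.\<close>

definition width :: "'a::metric_space \<Rightarrow> 'a \<Rightarrow> 'a set \<Rightarrow> ennreal" where
  "width x y A = (INF \<gamma>\<in>lipschitz_curves x y. curve_length_in \<gamma> A)"

definition riesz_kernel :: "'a::polish_space measure \<Rightarrow> 'a \<Rightarrow> 'a \<Rightarrow> 'a \<Rightarrow> ennreal" where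
  "riesz_kernel M x y z =
     (if z = x \<or> z = y then 0
      else ennreal (dist x z) / emeasure M (ball x (dist x z)) +
           ennreal (dist y z) / emeasure M (ball y (dist y z)))"

definition riesz_ball :: "real \<Rightarrow> 'a::metric_space \<Rightarrow> 'a \<Rightarrow> 'a set" where
  "riesz_ball L x y = ball x (2 * L * dist x y) \<union> ball y (2 * L * dist x y)"

definition riesz_measure :: "'a::polish_space measure \<Rightarrow> real \<Rightarrow> 'a \<Rightarrow> 'a \<Rightarrow> 'a measure" where
  "riesz_measure M L x y =
     density M (\<lambda>z. indicator (riesz_ball L x y) z * riesz_kernel M x y z)"

text \<open>
  At an isolated point \<open>z\<close> the filter \<open>at z\<close> is \<open>bot\<close>, and the upper limit along it is the least
  element of \<^typ>\<open>ennreal\<close>; hence the pointwise Lipschitz constant is \<open>0\<close> there.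
\<close>

definition lip :: "('a::metric_space \<Rightarrow> real) \<Rightarrow> 'a \<Rightarrow> ennreal" where
  "lip u z = Limsup (at z) (\<lambda>w. ennreal (\<bar>u w - u z\<bar> / dist w z))"

definition average :: "'a::metric_space measure \<Rightarrow> 'a set \<Rightarrow> ('a \<Rightarrow> real) \<Rightarrow> real" where
  "average M B u = (LINT w:B|M. u w) / measure M B"

definition poincare_1 :: "'a::polish_space measure \<Rightarrow> bool" where
  "poincare_1 M \<longleftrightarrow>
     (\<exists>C \<Lambda>::real. C \<ge> 1 \<and> \<Lambda> \<ge> 1 \<and>
        (\<forall>u. (\<exists>K. K-lipschitz_on UNIV u) \<longrightarrow>
          (\<forall>z. \<forall>r::real. r > 0 \<longrightarrow>
            (\<integral>\<^sup>+w\<in>ball z r. ennreal \<bar>u w - average M (ball z r) u\<bar> \<partial>M) / emeasure M (ball z r)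
            \<le> ennreal (C * r) *
              ((\<integral>\<^sup>+w\<in>ball z (\<Lambda> * r). lip u w \<partial>M) / emeasure M (ball z (\<Lambda> * r))))))"

end

theory Submission
  imports Defs
begin

text \<open>
  Both conditions are equivalent to a third one, the \<^emph>\<open>Riesz estimate\<close>: there are constants with
  \<open>\<bar>u x - u y\<bar> \<le> C \<integral> lip u d\<mu>\<close> for all Lipschitz \<open>u\<close> and all \<open>x\<close>, \<open>y\<close>, where \<open>\<mu>\<close> is the Riesz measure
  of \<open>x\<close> and \<open>y\<close>.

  \<^emph>\<open>Width bound to Riesz estimate\<close> (\<open>width_imp_riesz_estimate\<close>).  Let \<open>u x < u y\<close> and \<open>r > 0\<close>.  For a level \<open>t\<close>
  between these values and not too close to \<open>u x\<close>, the collar of width \<open>r\<close> around the superlevel set of \<open>t\<close> separates \<open>x\<close> from \<open>y\<close>,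
  and each curve has length at least \<open>r\<close> in it (\<open>curve_crosses_collar\<close>); so its \<open>\<mu>\<close>-measure is at least
  \<open>r / C\<close>.  A point \<open>z\<close> lies in the collars of a set of levels of length at most \<open>r\<close> times the largest slope of
  \<open>u\<close> between \<open>z\<close> and points at distance less than \<open>r\<close>.  Integrating over \<open>t\<close>, dividing by \<open>r\<close> and letting
  \<open>r\<close> tend to \<open>0\<close> gives the estimate.  The length in a collar is an integral of the metric speed, which is a
  limit by definition; that this limit exists almost everywhere and integrates to at least the distance of the
  end points is \<open>dist_le_integral_metric_speed\<close>.

  \<^emph>\<open>Riesz estimate to Poincare inequality\<close> (\<open>riesz_estimate_imp_poincare\<close>).  Average over \<open>x\<close> and \<open>y\<close> in a
  ball and apply Tonelli: the kernel is almost symmetric by doubling, and its integral over a ball of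
  radius \<open>R\<close> around its pole is at most a multiple of \<open>R\<close>.

  \<^emph>\<open>Poincare inequality to Riesz estimate\<close> (\<open>riesz_estimate\<close>).  Averages of \<open>u\<close> on neighbouring balls of
  comparable size differ by at most a multiple of radius times mean of \<open>lip u\<close>, and one telescopes along
  balls shrinking to \<open>x\<close>.  With balls centred at \<open>x\<close> the sum need not be bounded by the Riesz kernel: in dimension one the
  loss is logarithmic.  So the balls are centred on a nearly shortest chain of points from \<open>x\<close> to \<open>y\<close>, and each of
  them, even when dilated, lies in an annulus around \<open>x\<close> whose radii are comparable to its own.  Short chains exist because
  the Poincare inequality, applied to the distance along chains with small steps, shows that this distance is
  at most a multiple of the metric; for functions with \<open>lip u \<le> 1\<close> the concentric balls do suffice.

  \<^emph>\<open>Riesz estimate to width bound\<close> (\<open>width_le_of_riesz_estimate\<close>).  By outer regularity of the finite measure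
  \<open>\<mu>\<close> the set may be replaced by an open \<open>U\<close>.  For a step size \<open>\<delta>\<close>, let \<open>u\<close> be the least cost of a chain
  from \<open>x\<close> with steps below \<open>\<delta>\<close>, where a step starting at \<open>a\<close> costs \<open>\<epsilon> + 1\<close> times its length if the ball of radius
  \<open>\<delta>\<close> around \<open>a\<close> lies in \<open>U\<close>, and \<open>\<epsilon>\<close> times its length otherwise.  Then \<open>lip u \<le> indicator U + \<epsilon>\<close>, so the Riesz
  estimate bounds the cost of reaching \<open>y\<close>, uniformly in \<open>\<delta>\<close>.  Doubling makes closed balls compact, and
  the chains, parametrised by cost over the unit interval, have a limit curve.  Where the limit curve is in \<open>U\<close>, its speed is at most
  the total cost; this bounds its length in \<open>U\<close> (\<open>curve_of_chains\<close>).
\<close>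

section \<open>Differentiation of integrals and the metric speed of Lipschitz curves\<close>

text \<open>
  Intervals that contain \<open>t\<close> but need not be centred at it, given by centre and half length; with
  these, derivatives of interval functions are two-sided and the Vitali covering theorem applies.
\<close>
definition small_intervals :: "real \<Rightarrow> (real \<Rightarrow> real \<Rightarrow> bool) \<Rightarrow> bool" where
  "small_intervals t Q \<longleftrightarrow>
     (\<exists>d>0. \<forall>c \<rho>. 0 < \<rho> \<longrightarrow> \<rho> < d \<longrightarrow> t \<in> cball c \<rho> \<longrightarrow> Q c \<rho>)"

text \<open>
  Vitali argument.  Inside a bounded interval, cover \<open>A = {h < p}\<close> by an open set that is larger by a set of
  small measure, and choose in it disjoint intervals that cover almost all of the exceptional set and on each of
  which the integral of \<open>h\<close> exceeds \<open>q\<close> times the length.  On their union the mean of \<open>h\<close> is above \<open>q\<close>, but \<open>h < p\<close> except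
  on a set of small measure, where \<open>h \<le> K\<close>; so the union is small.
\<close>
lemma upper_density_negligible:
  fixes h :: "real \<Rightarrow> real"
  assumes [measurable]: "h \<in> borel_measurable borel"
    and h: "\<And>t. 0 \<le> h t" "\<And>t. h t \<le> K" and "0 < p" "p < q"
  shows "negligible {t. h t < p \<and>
    \<not> small_intervals t (\<lambda>c \<rho>. emeasure (density lborel h) (cball c \<rho>) \<le> ennreal (q * (2 * \<rho>)))}" (is "negligible ?E")
proof (subst negligible_on_intervals, intro allI)
  fix a b :: real
  define N where "N = density lborel h"
  define A where "A = {t \<in> {a..b}. h t < p}"
  have A[measurable]: "A \<in> sets borel" unfolding A_def by measurable
  have "K \<ge> 0" using h[of 0] by linarith
  show "negligible (?E \<inter> cbox a b)"
    unfolding negligible_outer_le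
  proof (intro allI impI)
    fix e :: real assume "e > 0"
    define e' where "e' = e * (q - p) / (K + 1)"
    have "e' > 0" unfolding e'_def using \<open>e > 0\<close> \<open>p < q\<close> \<open>K \<ge> 0\<close> by simp
    have "A \<in> sets lebesgue" by simp
    from sets_lebesgue_outer_open[OF this \<open>e' > 0\<close>]
    obtain U where U: "open U" "A \<subseteq> U" "emeasure lebesgue (U - A) < ennreal e'" by metis
    have [measurable]: "U \<in> sets borel" using U by simp
    have U3: "emeasure lborel (U - A) < ennreal e'" using U(3) by simp
    define S where "S = ?E \<inter> cbox a b"
    define I where "I = {i. 0 < snd i \<and> cball (fst i) (snd i) \<subseteq> U \<and>
        ennreal (q * (2 * snd i)) < emeasure N (cball (fst i) (snd i))}"
    have "\<exists>i. i \<in> I \<and> x \<in> cball (fst i) (snd i) \<and> snd i < d" if "x \<in> S" "0 < d" for x d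
    proof -
      have "x \<in> U" using that U(2) by (auto simp: S_def A_def)
      then obtain e2 where e2: "e2 > 0" "ball x e2 \<subseteq> U" using U(1) openE by blast
      then have "min d (e2/3) > 0" using \<open>0 < d\<close> by auto
      with \<open>x \<in> S\<close> obtain c \<rho> where c: "0 < \<rho>" "\<rho> < min d (e2/3)" "x \<in> cball c \<rho>"
          "ennreal (q * (2 * \<rho>)) < emeasure N (cball c \<rho>)"
        unfolding S_def N_def small_intervals_def not_le[symmetric] by blast
      have "cball c \<rho> \<subseteq> ball x e2"
      proof
        fix y assume "y \<in> cball c \<rho>"
        then show "y \<in> ball x e2" using c dist_triangle[of x y c] by (simp add: dist_commute)
      qed
      with c e2 show ?thesis by (intro exI[of _ "(c,\<rho>)"]) (auto simp: I_def)
    qed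
    note cover = this
    obtain C where C: "countable C" "C \<subseteq> I"
       "pairwise (\<lambda>i j. disjnt (cball (fst i) (snd i)) (cball (fst j) (snd j))) C"
       "negligible (S - (\<Union>i \<in> C. cball (fst i) (snd i)))"
    proof (rule Vitali_covering_theorem_cballs[of I snd S fst])
      show "0 < snd i" if "i \<in> I" for i using that by (simp add: I_def)
    qed (rule cover, assumption+)
    define B where "B = (\<Union>i \<in> C. cball (fst i) (snd i))"
    have [measurable]: "B \<in> sets borel" unfolding B_def using C(1) by (intro sets.countable_UN') auto
    have BU: "B \<subseteq> U" using C(2) by (auto simp: B_def I_def)
    have dis: "disjoint_family_on (\<lambda>i. cball (fst i) (snd i)) C"
      using C(3) unfolding pairwise_def disjoint_family_on_def disjnt_def by auto
    have "emeasure lborel U \<le> emeasure lborel A + emeasure lborel (U - A)"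
      using emeasure_subadditive[of A lborel "U - A"] U(2) by (simp add: Un_absorb1)
    also have "\<dots> < \<infinity>"
    proof -
      have "emeasure lborel A \<le> emeasure lborel {a..b}" by (intro emeasure_mono) (auto simp: A_def)
      also have "\<dots> < \<infinity>" by (rule emeasure_bounded_finite) simp
      finally show ?thesis using U3 by (auto simp: less_top[symmetric])
    qed
    finally have Ufin: "emeasure lborel U < \<infinity>" .
    have Bfin: "emeasure lborel B < \<infinity>" using emeasure_mono[OF BU, of lborel] Ufin by (simp add: less_top[symmetric] top_unique) (metis top_unique)
    have "ennreal q * emeasure lborel B
        = (\<integral>\<^sup>+i. ennreal q * emeasure lborel (cball (fst i) (snd i)) \<partial>count_space C)"
      unfolding B_def using C(1) dis by (subst emeasure_UN_countable) (auto simp: nn_integral_cmult)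
    also have "\<dots> \<le> (\<integral>\<^sup>+i. emeasure N (cball (fst i) (snd i)) \<partial>count_space C)"
    proof (intro nn_integral_mono)
      fix i assume "i \<in> space (count_space C)"
      then have i: "i \<in> I" using C(2) by auto
      then have "0 < snd i" by (auto simp: I_def)
      then have "emeasure lborel (cball (fst i) (snd i)) = ennreal (2 * snd i)"
        by (simp add: cball_eq_atLeastAtMost)
      then show "ennreal q * emeasure lborel (cball (fst i) (snd i)) \<le> emeasure N (cball (fst i) (snd i))"
        using i \<open>0 < p\<close> \<open>p < q\<close> \<open>0 < snd i\<close> by (auto simp: I_def ennreal_mult[symmetric])
    qed
    also have "\<dots> = emeasure N B"
      unfolding B_def using C(1) dis by (subst emeasure_UN_countable) (auto simp: N_def)
    also have "\<dots> = (\<integral>\<^sup>+t. ennreal (h t) * indicator B t \<partial>lborel)"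
      unfolding N_def by (subst emeasure_density) auto
    also have "\<dots> \<le> (\<integral>\<^sup>+t. ennreal p * indicator B t + ennreal K * indicator (U - A) t \<partial>lborel)"
    proof (intro nn_integral_mono)
      fix t show "ennreal (h t) * indicator B t \<le> ennreal p * indicator B t + ennreal K * indicator (U - A) t"
      proof (cases "t \<in> B")
        case True
        show ?thesis
        proof (cases "t \<in> A")
          case True
          then have "h t \<le> p" by (auto simp: A_def)
          then show ?thesis using True \<open>t \<in> B\<close> \<open>0 < p\<close> by (auto intro!: ennreal_leI)
        next
          case False
          then have "t \<in> U - A" using True BU by auto
          have "ennreal (h t) \<le> ennreal p + ennreal K"
            using h(2)[of t] \<open>0 < p\<close> \<open>K \<ge> 0\<close> by (simp add: ennreal_plus[symmetric] del: ennreal_plus)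
          then show ?thesis using True \<open>t \<in> U - A\<close> by simp
        qed
      qed auto
    qed
    also have "\<dots> = ennreal p * emeasure lborel B + ennreal K * emeasure lborel (U - A)"
      by (subst nn_integral_add) (auto simp: nn_integral_cmult)
    finally have *: "ennreal q * emeasure lborel B \<le> ennreal p * emeasure lborel B + ennreal K * emeasure lborel (U - A)" .
    define mB where "mB = measure lborel B"
    have mB: "emeasure lborel B = ennreal mB" unfolding mB_def using Bfin by (simp add: emeasure_eq_ennreal_measure less_top)
    have "ennreal (q * mB) \<le> ennreal (p * mB + K * e')"
    proof -
      have "ennreal (q * mB) = ennreal q * emeasure lborel B" using mB \<open>0<p\<close> \<open>p<q\<close> by (simp add: ennreal_mult mB_def)
      also have "\<dots> \<le> ennreal p * emeasure lborel B + ennreal K * ennreal e'"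
        using * U3 by (meson add_left_mono less_imp_le mult_left_mono order_trans zero_le)
      also have "\<dots> = ennreal (p * mB + K * e')"
        using mB \<open>0<p\<close> \<open>p<q\<close> \<open>K \<ge> 0\<close> \<open>e' > 0\<close> by (simp add: ennreal_mult mB_def)
      finally show ?thesis .
    qed
    moreover have "0 \<le> p * mB + K * e'" using \<open>0<p\<close> \<open>K \<ge> 0\<close> \<open>e' > 0\<close> by (simp add: mB_def)
    ultimately have "q * mB \<le> p * mB + K * e'" by (simp add: ennreal_le_iff)
    then have "(q - p) * mB \<le> K * e'" by (simp add: algebra_simps)
    also have "\<dots> \<le> (K + 1) * e'" using \<open>e' > 0\<close> by simp
    also have "\<dots> = (q - p) * e" unfolding e'_def using \<open>K \<ge> 0\<close> by (simp add: field_simps)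
    finally have "mB \<le> e" using \<open>p < q\<close> by simp
    have Bl: "B \<in> lmeasurable" using Bfin by (intro fmeasurableI) auto
    have neg: "negligible (S - B)" using C(4) unfolding B_def .
    then have SB: "S - B \<in> lmeasurable" by (rule negligible_imp_measurable)
    have "measure lebesgue (B \<union> (S - B)) \<le> measure lebesgue B + measure lebesgue (S - B)"
      by (rule measure_Un_le) (use Bl SB in auto)
    also have "\<dots> = mB" using neg by (simp add: negligible_imp_measure0 mB_def)
    finally have "measure lebesgue (B \<union> (S - B)) \<le> e" using \<open>mB \<le> e\<close> by simp
    then show "\<exists>T. ?E \<inter> cbox a b \<subseteq> T \<and> T \<in> lmeasurable \<and> measure lebesgue T \<le> e"
      unfolding S_def[symmetric] using fmeasurable.Un[OF Bl SB] by (intro exI[of _ "B \<union> (S - B)"]) blast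
  qed
qed

text \<open>
  The previous lemma for all pairs of rationals \<open>p < q\<close>.
\<close>
lemma upper_differentiation_nonneg:
  fixes h :: "real \<Rightarrow> real"
  assumes [measurable]: "h \<in> borel_measurable borel"
    and h: "\<And>t. 0 \<le> h t" "\<And>t. h t \<le> K"
  shows "AE t in lborel. \<forall>e>0. small_intervals t (\<lambda>c \<rho>. (LINT s:cball c \<rho>|lborel. h s) \<le> (h t + e) * (2 * \<rho>))"
proof -
  have "AE t in lborel. \<forall>p\<in>{0<..}\<inter>\<rat>. \<forall>q\<in>{p<..}\<inter>\<rat>. \<not>(h t < p \<and>
    \<not> small_intervals t (\<lambda>c \<rho>. emeasure (density lborel h) (cball c \<rho>) \<le> ennreal (q * (2 * \<rho>))))"
  proof (intro AE_ball_countable'[rule_format] countable_Int2 countable_rat)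
    fix p q :: real assume p: "p \<in> {0<..}\<inter>\<rat>" and q: "q \<in> {p<..} \<inter> \<rat>"
    from upper_density_negligible[OF assms(1) h, of p q] p q
    have "negligible {t. h t < p \<and> \<not> small_intervals t (\<lambda>c \<rho>. emeasure (density lborel h) (cball c \<rho>) \<le> ennreal (q * (2 * \<rho>)))}" by auto
    then have "AE t in lebesgue. \<not> (h t < p \<and> \<not> small_intervals t (\<lambda>c \<rho>. emeasure (density lborel h) (cball c \<rho>) \<le> ennreal (q * (2 * \<rho>))))"
      unfolding negligible_iff_null_sets by (auto dest!: AE_not_in)
    then show "AE t in lborel. \<not> (h t < p \<and> \<not> small_intervals t (\<lambda>c \<rho>. emeasure (density lborel h) (cball c \<rho>) \<le> ennreal (q * (2 * \<rho>))))"
      by (simp only: AE_completion_iff)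
  qed
  then show ?thesis
  proof (rule AE_mp, intro AE_I2 impI allI)
    fix t e :: real
    assume *: "\<forall>p\<in>{0<..}\<inter>\<rat>. \<forall>q\<in>{p<..}\<inter>\<rat>. \<not>(h t < p \<and>
    \<not> small_intervals t (\<lambda>c \<rho>. emeasure (density lborel h) (cball c \<rho>) \<le> ennreal (q * (2 * \<rho>))))" and "0 < e"
    obtain p where p: "p \<in> \<rat>" "h t < p" "p < h t + e/2" using Rats_dense_in_real[of "h t" "h t + e/2"] \<open>0 < e\<close> by auto
    obtain q where q: "q \<in> \<rat>" "p < q" "q < h t + e" using Rats_dense_in_real[of p "h t + e"] p \<open>0 < e\<close> by auto
    have "p > 0" using h(1)[of t] p by linarith
    have "small_intervals t (\<lambda>c \<rho>. emeasure (density lborel h) (cball c \<rho>) \<le> ennreal (q * (2 * \<rho>)))"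
      using bspec[OF bspec[OF *, of p], of q] p q \<open>p > 0\<close> by auto
    then obtain d where d: "d > 0" "\<And>c \<rho>. 0 < \<rho> \<Longrightarrow> \<rho> < d \<Longrightarrow> t \<in> cball c \<rho> \<Longrightarrow>
       emeasure (density lborel h) (cball c \<rho>) \<le> ennreal (q * (2 * \<rho>))"
      unfolding small_intervals_def by blast
    show "small_intervals t (\<lambda>c \<rho>. (LINT s:cball c \<rho>|lborel. h s) \<le> (h t + e) * (2 * \<rho>))"
      unfolding small_intervals_def
    proof (intro exI[of _ d] conjI allI impI d(1))
      fix c \<rho> :: real assume a: "0 < \<rho>" "\<rho> < d" "t \<in> cball c \<rho>"
      have "(LINT s:cball c \<rho>|lborel. h s) = enn2real (\<integral>\<^sup>+s. ennreal (indicator (cball c \<rho>) s *\<^sub>R h s) \<partial>lborel)"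
        unfolding set_lebesgue_integral_def by (rule integral_eq_nn_integral, measurable) (simp_all add: h(1))
      also have "(\<integral>\<^sup>+s. ennreal (indicator (cball c \<rho>) s *\<^sub>R h s) \<partial>lborel) = emeasure (density lborel h) (cball c \<rho>)"
        by (subst emeasure_density) (auto intro!: nn_integral_cong split: split_indicator)
      also have "enn2real \<dots> \<le> q * (2 * \<rho>)"
        using d(2)[OF a] \<open>p > 0\<close> q a by (intro enn2real_leI) auto
      also have "\<dots> \<le> (h t + e) * (2 * \<rho>)" using q a by (intro mult_right_mono) auto
      finally show "(LINT s:cball c \<rho>|lborel. h s) \<le> (h t + e) * (2 * \<rho>)" .
    qed
  qed
qed

lemma set_integrable_bounded_on_bounded:
  fixes g :: "real \<Rightarrow> real"
  assumes [measurable]: "g \<in> borel_measurable borel" and "\<And>t. \<bar>g t\<bar> \<le> K" and [measurable]: "S \<in> sets borel" and "bounded S"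
  shows "set_integrable lborel S g"
proof -
  have "emeasure lborel S < \<infinity>" using emeasure_bounded_finite[OF \<open>bounded S\<close>] .
  then show ?thesis
    unfolding set_integrable_def
    by (intro integrableI_bounded_set_indicator[where B=K] AE_I2 impI) (simp_all add: assms(2))
qed

text \<open>
  The one-sided estimate applied to \<open>K + g\<close> and to \<open>K - g\<close>.
\<close>
lemma lebesgue_differentiation:
  fixes g :: "real \<Rightarrow> real"
  assumes [measurable]: "g \<in> borel_measurable borel"
    and g: "\<And>t. \<bar>g t\<bar> \<le> K"
  shows "AE t in lborel. \<forall>e>0. small_intervals t (\<lambda>c \<rho>. \<bar>(LINT s:cball c \<rho>|lborel. g s) - g t * (2 * \<rho>)\<bar> \<le> e * (2 * \<rho>))"
proof -
  have g': "- K \<le> g t" "g t \<le> K" for t using g[of t] by auto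
  have I[simp]: "set_integrable lborel (cball c \<rho>) g" for c \<rho>
    by (rule set_integrable_bounded_on_bounded[OF _ g]) auto
  have J[simp]: "set_integrable lborel (cball c \<rho>) (\<lambda>s. K)" for c \<rho> :: real
    by (rule set_integrable_bounded_on_bounded[where K="\<bar>K\<bar>"]) auto
  have len: "(LINT s:cball c \<rho>|lborel. K) = K * (2 * \<rho>)" if "0 < \<rho>" for c \<rho> :: real
    using that by (simp add: set_lebesgue_integral_def cball_eq_atLeastAtMost)
  have "AE t in lborel. (\<forall>e>0. small_intervals t (\<lambda>c \<rho>. (LINT s:cball c \<rho>|lborel. g s + K) \<le> (g t + K + e) * (2 * \<rho>)))"
  proof (rule upper_differentiation_nonneg[of "\<lambda>t. g t + K" "2*K"])
    show "0 \<le> g t + K" "g t + K \<le> 2 * K" for t using g'[of t] by auto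
  qed measurable
  moreover have "AE t in lborel. (\<forall>e>0. small_intervals t (\<lambda>c \<rho>. (LINT s:cball c \<rho>|lborel. K - g s) \<le> (K - g t + e) * (2 * \<rho>)))"
  proof (rule upper_differentiation_nonneg[of "\<lambda>t. K - g t" "2*K"])
    show "0 \<le> K - g t" "K - g t \<le> 2 * K" for t using g'[of t] by auto
  qed measurable
  ultimately show ?thesis
  proof (eventually_elim, intro allI impI)
    fix t e :: real
    assume 1: "\<forall>e>0. small_intervals t (\<lambda>c \<rho>. (LINT s:cball c \<rho>|lborel. g s + K) \<le> (g t + K + e) * (2 * \<rho>))"
     and 2: "\<forall>e>0. small_intervals t (\<lambda>c \<rho>. (LINT s:cball c \<rho>|lborel. K - g s) \<le> (K - g t + e) * (2 * \<rho>))" and "0 < e"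
    from 1 \<open>0 < e\<close> obtain d1 where d1: "d1 > 0" "\<And>c \<rho>. 0 < \<rho> \<Longrightarrow> \<rho> < d1 \<Longrightarrow> t \<in> cball c \<rho> \<Longrightarrow>
      (LINT s:cball c \<rho>|lborel. g s + K) \<le> (g t + K + e) * (2 * \<rho>)" unfolding small_intervals_def by blast
    from 2 \<open>0 < e\<close> obtain d2 where d2: "d2 > 0" "\<And>c \<rho>. 0 < \<rho> \<Longrightarrow> \<rho> < d2 \<Longrightarrow> t \<in> cball c \<rho> \<Longrightarrow>
      (LINT s:cball c \<rho>|lborel. K - g s) \<le> (K - g t + e) * (2 * \<rho>)" unfolding small_intervals_def by blast
    show "small_intervals t (\<lambda>c \<rho>. \<bar>(LINT s:cball c \<rho>|lborel. g s) - g t * (2 * \<rho>)\<bar> \<le> e * (2 * \<rho>))"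
      unfolding small_intervals_def
    proof (intro exI[of _ "min d1 d2"] conjI allI impI)
      fix c \<rho> :: real assume a: "0 < \<rho>" "\<rho> < min d1 d2" "t \<in> cball c \<rho>"
      then have "(LINT s:cball c \<rho>|lborel. g s) + K * (2 * \<rho>) \<le> (g t + K + e) * (2 * \<rho>)"
        using d1(2)[of \<rho> c] len[of \<rho> c] by (simp add: set_integral_add(2)[OF I J])
      moreover have "K * (2 * \<rho>) - (LINT s:cball c \<rho>|lborel. g s) \<le> (K - g t + e) * (2 * \<rho>)"
        using a d2(2)[of \<rho> c] len[of \<rho> c] by (simp add: set_integral_diff(2)[OF J I])
      ultimately show "\<bar>(LINT s:cball c \<rho>|lborel. g s) - g t * (2 * \<rho>)\<bar> \<le> e * (2 * \<rho>)"
        by (subst abs_le_iff) (simp add: ring_distribs)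
    qed (use d1(1) d2(1) in simp)
  qed
qed

lemma emeasure_UN_countable_le:
  assumes [measurable]: "\<And>i. i \<in> I \<Longrightarrow> X i \<in> sets M" and I: "countable I"
  shows "emeasure M (\<Union>(X ` I)) \<le> (\<integral>\<^sup>+i. emeasure M (X i) \<partial>count_space I)"
proof -
  have [measurable]: "(\<Union>(X ` I)) \<in> sets M" using I by (intro sets.countable_UN') auto
  have "emeasure M (\<Union>(X ` I)) = (\<integral>\<^sup>+x. indicator (\<Union>(X ` I)) x \<partial>M)" by simp
  also have "\<dots> \<le> (\<integral>\<^sup>+x. \<integral>\<^sup>+i. indicator (X i) x \<partial>count_space I \<partial>M)"
  proof (intro nn_integral_mono)
    fix x show "indicator (\<Union>(X ` I)) x \<le> (\<integral>\<^sup>+i. indicator (X i) x \<partial>count_space I)"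
    proof (cases "x \<in> \<Union>(X ` I)")
      case True
      then obtain j where "j \<in> I" "x \<in> X j" by blast
      then show ?thesis using nn_integral_ge_point[of j I "\<lambda>i. indicator (X i) x"] True by simp
    qed simp
  qed
  also have "\<dots> = (\<integral>\<^sup>+i. \<integral>\<^sup>+x. indicator (X i) x \<partial>M \<partial>count_space I)"
    using I by (intro nn_integral_count_space_nn_integral) auto
  also have "\<dots> = (\<integral>\<^sup>+i. emeasure M (X i) \<partial>count_space I)"
    by (intro nn_integral_cong) auto
  finally show ?thesis .
qed

text \<open>
  On each interval the Stieltjes measure is at most \<open>K\<close> times the length.  To pass to a set \<open>A\<close>, cover it by
  nonoverlapping intervals inside an open set of almost the same Lebesgue measure.
\<close>
lemma interval_measure_le_Lipschitz:
  fixes f :: "real \<Rightarrow> real"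
  assumes mono: "\<And>x y. x \<le> y \<Longrightarrow> f x \<le> f y" and lip: "\<And>x y. x \<le> y \<Longrightarrow> f y - f x \<le> K * (y - x)"
    and "K \<ge> 0" and A[measurable]: "A \<in> sets borel" and "bounded A"
  shows "emeasure (interval_measure f) A \<le> ennreal K * emeasure lborel A"
proof (rule ennreal_le_epsilon)
  fix e0 :: real assume "e0 > 0"
  have lip': "\<bar>f x - f y\<bar> \<le> K * \<bar>x - y\<bar>" for x y
    using mono[of x y] mono[of y x] lip[of x y] lip[of y x] by (cases "x \<le> y") auto
  have "K-lipschitz_on UNIV f"
    using lip' \<open>K \<ge> 0\<close> by (intro lipschitz_onI) (auto simp: dist_real_def)
  then have cont: "continuous_on UNIV f" by (rule lipschitz_on_continuous_on)
  \<comment> \<open>the quotient by \<open>K + 1\<close> instead of \<open>K\<close> covers \<open>K = 0\<close>\<close>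
  define e where "e = e0 / (K + 1)"
  have "e > 0" using \<open>e0 > 0\<close> \<open>K \<ge> 0\<close> by (simp add: e_def)
  have "A \<in> sets lebesgue" by simp
  from sets_lebesgue_outer_open[OF this \<open>e > 0\<close>]
  obtain U where U: "open U" "A \<subseteq> U" "emeasure lebesgue (U - A) < ennreal e" by metis
  have [measurable]: "U \<in> sets borel" using U by simp
  have U3: "emeasure lborel (U - A) \<le> ennreal e" using U(3) by simp
  obtain b0 where b0: "\<And>x. x \<in> A \<Longrightarrow> \<bar>x\<bar> \<le> b0" using \<open>bounded A\<close> unfolding bounded_iff by auto
  define b where "b = \<bar>b0\<bar> + 1"
  have b: "A \<subseteq> cbox (-b) b" "box (-b) b \<noteq> {}" using b0 by (force simp: b_def)+
  have "\<exists>g. gauge g \<and> (\<forall>x\<in>A. g x \<subseteq> U)"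
    using U by (intro exI[of _ "\<lambda>x. if x \<in> A then U else UNIV"]) (auto simp: gauge_def)
  then obtain g where g: "gauge g" "\<And>x. x \<in> A \<Longrightarrow> g x \<subseteq> U" by blast
  obtain \<D> where D: "countable \<D>" 
    "\<And>K. K \<in> \<D> \<Longrightarrow> interior K \<noteq> {} \<and> (\<exists>c d. K = cbox c d)"
    "pairwise (\<lambda>A B. interior A \<inter> interior B = {}) \<D>"
    "\<And>K. K \<in> \<D> \<Longrightarrow> \<exists>x \<in> A \<inter> K. K \<subseteq> g x" "A \<subseteq> \<Union>\<D>"
    using covering_lemma[OF b g(1)] by metis
  have DU: "J \<subseteq> U" if "J \<in> \<D>" for J using D(4)[OF that] g(2) by blast
  have Jb: "J \<in> sets borel" "emeasure (interval_measure f) J \<le> ennreal K * emeasure lborel (interior J)" if JD: "J \<in> \<D>" for J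
  proof -
    obtain c d where J: "J = {c..d}" "interior J \<noteq> {}" using D(2)[OF JD] by auto
    then have "c < d" by (metis atLeastAtMost_singleton_iff interior_atLeastAtMost_real greaterThanLessThan_empty_iff not_le)
    show "J \<in> sets borel" using J by simp
    have "emeasure (interval_measure f) J = ennreal (f d - f c)"
      unfolding J using \<open>c < d\<close> by (intro emeasure_interval_measure_Icc mono cont) auto
    also have "\<dots> \<le> ennreal (K * (d - c))" using lip[of c d] \<open>c < d\<close> by (intro ennreal_leI) auto
    also have "\<dots> = ennreal K * emeasure lborel (interior J)"
      using J \<open>c < d\<close> \<open>K \<ge> 0\<close> by (simp add: ennreal_mult)
    finally show "emeasure (interval_measure f) J \<le> ennreal K * emeasure lborel (interior J)" .
  qed
  have dis: "disjoint_family_on interior \<D>"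
    using D(3) unfolding pairwise_def disjoint_family_on_def by auto
  have "emeasure (interval_measure f) A \<le> emeasure (interval_measure f) (\<Union>J\<in>\<D>. J)"
    using D(1,5) Jb(1) by (intro emeasure_mono) (auto intro!: sets.countable_UN')
  also have "\<dots> \<le> (\<integral>\<^sup>+J. emeasure (interval_measure f) J \<partial>count_space \<D>)"
    using D(1) Jb(1) by (intro emeasure_UN_countable_le) auto
  also have "\<dots> \<le> (\<integral>\<^sup>+J. ennreal K * emeasure lborel (interior J) \<partial>count_space \<D>)"
    using Jb by (intro nn_integral_mono) auto
  also have "\<dots> = ennreal K * emeasure lborel (\<Union>J\<in>\<D>. interior J)"
    using D(1) dis by (subst emeasure_UN_countable) (auto simp: nn_integral_cmult)
  also have "\<dots> \<le> ennreal K * emeasure lborel U"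
    using DU interior_subset by (intro mult_left_mono emeasure_mono) (auto; blast)+
  also have "\<dots> \<le> ennreal K * (emeasure lborel A + ennreal e)"
  proof (intro mult_left_mono)
    have "emeasure lborel U \<le> emeasure lborel A + emeasure lborel (U - A)"
      using emeasure_subadditive[of A lborel "U - A"] U(2) by (simp add: Un_absorb1)
    also have "\<dots> \<le> emeasure lborel A + ennreal e" using U3 by (intro add_left_mono)
    finally show "emeasure lborel U \<le> emeasure lborel A + ennreal e" .
  qed simp
  also have "\<dots> = ennreal K * emeasure lborel A + ennreal (K * e)"
    using \<open>K \<ge> 0\<close> \<open>e > 0\<close> by (simp add: ring_distribs ennreal_mult)
  also have "\<dots> \<le> ennreal K * emeasure lborel A + ennreal e0"
    using \<open>K \<ge> 0\<close> \<open>e0 > 0\<close> by (intro add_left_mono ennreal_leI) (simp add: e_def field_simps)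
  finally show "emeasure (interval_measure f) A \<le> ennreal K * emeasure lborel A + ennreal e0" .
qed

text \<open>
  Rademacher's theorem in dimension one, in integral form.  The function \<open>f t + K * t\<close> is monotone and its Stieltjes
  measure is dominated by \<open>2 * K\<close> times Lebesgue measure, so it has a Radon-Nikodym density in
  \<open>[0, 2 * K]\<close>; subtracting \<open>K\<close> gives \<open>g\<close>.
\<close>
lemma Lipschitz_eq_integral:
  fixes f :: "real \<Rightarrow> real"
  assumes "K-lipschitz_on UNIV f"
  obtains g where "g \<in> borel_measurable borel" "\<And>t. \<bar>g t\<bar> \<le> K"
    "\<And>s t. s \<le> t \<Longrightarrow> f t - f s = (LINT x:{s..t}|lborel. g x)"
proof -
  have "K \<ge> 0" using assms by (rule lipschitz_on_nonneg)
  have l: "\<bar>f x - f y\<bar> \<le> K * \<bar>x - y\<bar>" for x y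
    using lipschitz_onD[OF assms, of x y] by (simp add: dist_real_def)
  define F where "F t = f t + K * t" for t
  have mono: "F x \<le> F y" if "x \<le> y" for x y
    using l[of x y] that by (simp add: F_def algebra_simps abs_le_iff)
  have inc: "F y - F x \<le> (2 * K) * (y - x)" if "x \<le> y" for x y
    using l[of x y] that by (simp add: F_def algebra_simps abs_le_iff)
  have cont: "continuous_on UNIV F"
    unfolding F_def by (intro continuous_intros lipschitz_on_continuous_on[OF assms])
  define \<mu> where "\<mu> = interval_measure F"
  have sets: "sets \<mu> = sets borel" by (simp add: \<mu>_def)
  have le: "emeasure \<mu> A \<le> ennreal (2 * K) * emeasure lborel A" if "A \<in> sets borel" "bounded A" for A
    unfolding \<mu>_def using mono inc that \<open>K \<ge> 0\<close> by (intro interval_measure_le_Lipschitz) auto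
  have "absolutely_continuous lborel \<mu>"
    unfolding absolutely_continuous_def
  proof
    fix A :: "real set" assume A: "A \<in> null_sets lborel"
    then have [measurable]: "A \<in> sets borel" by auto
    have "emeasure \<mu> (A \<inter> {- real n..real n}) = 0" for n
    proof -
      have "emeasure lborel (A \<inter> {- real n..real n}) \<le> emeasure lborel A" by (intro emeasure_mono) auto
      then have "emeasure lborel (A \<inter> {- real n..real n}) = 0" using A by auto
      then show ?thesis using le[of "A \<inter> {- real n..real n}"] by (simp add: bounded_Int)
    qed
    then have "A \<inter> {- real n..real n} \<in> null_sets \<mu>" for n using sets by (intro null_setsI) auto
    then have "(\<Union>n. A \<inter> {- real n..real n}) \<in> null_sets \<mu>" by (rule null_sets_UN)
    also have "(\<Union>n. A \<inter> {- real n..real n}) = A"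
    proof -
      have "\<exists>n. x \<in> {- real n..real n}" for x
      proof -
        obtain n where "\<bar>x\<bar> \<le> real n" using real_arch_simple by blast
        then show ?thesis by (intro exI[of _ n]) (simp add: abs_le_iff)
      qed
      then show ?thesis by blast
    qed
    finally show "A \<in> null_sets \<mu>" .
  qed
  from sigma_finite_measure.Radon_Nikodym[OF sigma_finite_lborel this] sets
  obtain g0 where g0[measurable]: "g0 \<in> borel_measurable borel" and dens: "density lborel g0 = \<mu>" by auto
  have dA: "emeasure \<mu> A = (\<integral>\<^sup>+x. g0 x * indicator A x \<partial>lborel)" if "A \<in> sets borel" for A
    unfolding dens[symmetric] using that by (subst emeasure_density) auto
  have "AE x in lborel. \<forall>n. x \<notin> {x. g0 x > ennreal (2*K)} \<inter> {- real n..real n}"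
  proof (subst AE_all_countable, intro allI)
    fix n :: nat
    define A where "A = {x. g0 x > ennreal (2*K)} \<inter> {- real n..real n}"
    have [measurable]: "A \<in> sets borel" unfolding A_def by measurable
    have "bounded A" unfolding A_def by (intro bounded_Int) auto
    have fin: "emeasure lborel A < \<infinity>" using \<open>bounded A\<close> by (rule emeasure_bounded_finite)
    have "(\<integral>\<^sup>+x. g0 x * indicator A x - ennreal (2*K) * indicator A x \<partial>lborel)
        = (\<integral>\<^sup>+x. g0 x * indicator A x \<partial>lborel) - (\<integral>\<^sup>+x. ennreal (2*K) * indicator A x \<partial>lborel)"
      using fin by (intro nn_integral_diff) (auto simp: nn_integral_cmult ennreal_mult_eq_top_iff A_def split: split_indicator)
    also have "\<dots> = 0" using le[of A] dA[of A] \<open>bounded A\<close> fin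
      by (simp add: nn_integral_cmult diff_eq_0_iff_ennreal ennreal_mult_less_top) (simp add: le_less_trans ennreal_mult_less_top)
    finally have "AE x in lborel. g0 x * indicator A x - ennreal (2*K) * indicator A x = 0"
      by (subst (asm) nn_integral_0_iff_AE) auto
    then show "AE x in lborel. x \<notin> {x. g0 x > ennreal (2*K)} \<inter> {- real n..real n}"
      unfolding A_def[symmetric]
    proof eventually_elim
      fix x assume *: "g0 x * indicator A x - ennreal (2*K) * indicator A x = 0"
      show "x \<notin> A"
      proof
        assume "x \<in> A"
        then have "ennreal (2*K) < g0 x" by (simp add: A_def)
        then show False using * \<open>x \<in> A\<close> by (auto simp: diff_eq_0_iff_ennreal leD)
      qed
    qed
  qed
  then have g0K: "AE x in lborel. g0 x \<le> ennreal (2*K)"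
  proof eventually_elim
    fix x assume *: "\<forall>n. x \<notin> {x. g0 x > ennreal (2*K)} \<inter> {- real n..real n}"
    obtain n where "\<bar>x\<bar> \<le> real n" using real_arch_simple by blast
    then show "g0 x \<le> ennreal (2*K)" using *[rule_format, of n] by (auto simp: abs_le_iff not_less)
  qed
  define h where "h x = enn2real (min (g0 x) (ennreal (2*K)))" for x
  have hm[measurable]: "h \<in> borel_measurable borel" unfolding h_def by measurable
  have h0: "0 \<le> h x" for x by (simp add: h_def)
  have hK: "h x \<le> 2 * K" for x unfolding h_def using \<open>K \<ge> 0\<close> by (intro enn2real_leI) auto
  have heq: "AE x in lborel. ennreal (h x) = g0 x"
    using g0K
  proof eventually_elim
    fix x assume "g0 x \<le> ennreal (2*K)"
    then show "ennreal (h x) = g0 x" unfolding h_def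
      by (simp add: min_absorb1) (metis ennreal_enn2real ennreal_less_top le_less_trans)
  qed
  define g where "g x = h x - K" for x
  show thesis
  proof
    show gm: "g \<in> borel_measurable borel" unfolding g_def by measurable
    show gK: "\<bar>g t\<bar> \<le> K" for t using h0[of t] hK[of t] by (auto simp: g_def)
    fix s t :: real assume st: "s \<le> t"
    have "(LINT x:{s..t}|lborel. h x) = enn2real (\<integral>\<^sup>+x. ennreal (indicator {s..t} x *\<^sub>R h x) \<partial>lborel)"
      unfolding set_lebesgue_integral_def by (rule integral_eq_nn_integral, measurable) (simp_all add: h0)
    also have "(\<integral>\<^sup>+x. ennreal (indicator {s..t} x *\<^sub>R h x) \<partial>lborel) = emeasure \<mu> {s..t}"
      unfolding dA[of "{s..t}", simplified] using heq
      by (intro nn_integral_cong_AE) (auto elim!: eventually_mono split: split_indicator)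
    also have "\<dots> = ennreal (F t - F s)"
      unfolding \<mu>_def using st by (intro emeasure_interval_measure_Icc mono cont)
    finally have 1: "(LINT x:{s..t}|lborel. h x) = F t - F s" using mono[OF st] by simp
    have I: "set_integrable lborel {s..t} h"
      by (rule set_integrable_bounded_on_bounded[where K="2*K"]) (auto simp: h0 hK)
    have J: "set_integrable lborel {s..t} (\<lambda>x. K)"
      by (rule set_integrable_bounded_on_bounded[where K="\<bar>K\<bar>"]) auto
    have "(LINT x:{s..t}|lborel. K) = K * (t - s)"
      using st by (simp add: set_lebesgue_integral_def)
    then have "(LINT x:{s..t}|lborel. g x) = F t - F s - K * (t - s)"
      unfolding g_def using set_integral_diff(2)[OF I J] 1 by simp
    then show "f t - f s = (LINT x:{s..t}|lborel. g x)" by (simp add: F_def algebra_simps)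
  qed
qed

lemma lebesgue_differentiation_interval:
  fixes g :: "real \<Rightarrow> real"
  assumes [measurable]: "g \<in> borel_measurable borel" and g: "\<And>t. \<bar>g t\<bar> \<le> K"
  shows "AE t in lborel. \<forall>e>0. \<forall>\<^sub>F s in at t.
     \<bar>(LINT x:{min s t..max s t}|lborel. g x) - g t * \<bar>s - t\<bar>\<bar> \<le> e * \<bar>s - t\<bar>"
  using lebesgue_differentiation[OF assms]
proof (eventually_elim, intro allI impI)
  fix t e :: real
  assume "\<forall>e>0. small_intervals t (\<lambda>c \<rho>. \<bar>(LINT s:cball c \<rho>|lborel. g s) - g t * (2 * \<rho>)\<bar> \<le> e * (2 * \<rho>))" and "0 < e"
  then obtain d where d: "d > 0" "\<And>c \<rho>. 0 < \<rho> \<Longrightarrow> \<rho> < d \<Longrightarrow> t \<in> cball c \<rho> \<Longrightarrow>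
     \<bar>(LINT s:cball c \<rho>|lborel. g s) - g t * (2 * \<rho>)\<bar> \<le> e * (2 * \<rho>)" unfolding small_intervals_def by blast
  show "\<forall>\<^sub>F s in at t. \<bar>(LINT x:{min s t..max s t}|lborel. g x) - g t * \<bar>s - t\<bar>\<bar> \<le> e * \<bar>s - t\<bar>"
    unfolding eventually_at
  proof (intro exI[of _ d] conjI ballI impI d(1))
    fix s assume s: "s \<noteq> t \<and> dist s t < d"
    define c \<rho> where "c = (s + t) / 2" and "\<rho> = \<bar>s - t\<bar> / 2"
    have cb: "cball c \<rho> = {min s t..max s t}"
      unfolding cball_eq_atLeastAtMost c_def \<rho>_def by (cases "s \<le> t") (auto simp: field_simps)
    have t: "t \<in> cball c \<rho>" unfolding cb by auto
    have r: "0 < \<rho>" "\<rho> < d" "2 * \<rho> = \<bar>s - t\<bar>" using s by (auto simp: \<rho>_def dist_real_def)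
    show "\<bar>(LINT x:{min s t..max s t}|lborel. g x) - g t * \<bar>s - t\<bar>\<bar> \<le> e * \<bar>s - t\<bar>"
      using d(2)[OF r(1,2) t] unfolding cb r(3) .
  qed
qed

text \<open>
  For a dense sequence \<open>x n\<close>, the real functions \<open>t \<mapsto> dist (\<gamma> t) (x n)\<close> are Lipschitz, hence integrals of
  bounded functions \<open>g n\<close>, and they determine the metric on the curve.  Let \<open>m\<close> be the supremum of the
  \<open>\<bar>g n\<bar>\<close>.  Then distances along the curve are at most integrals of \<open>m\<close>, so by Lebesgue differentiation the
  difference quotients have upper limit at most \<open>m\<close>, almost everywhere; the lower limit is at least each
  \<open>\<bar>g n\<bar>\<close>.  So the metric speed exists and equals \<open>m\<close> almost everywhere.
\<close>
lemma dist_le_integral_metric_speed: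
  fixes \<gamma> :: "real \<Rightarrow> 'a::{metric_space, second_countable_topology}"
  assumes lip: "K-lipschitz_on {0..1} \<gamma>" and ab: "0 \<le> a" "a \<le> b" "b \<le> 1"
  shows "ennreal (dist (\<gamma> a) (\<gamma> b)) \<le> (\<integral>\<^sup>+t\<in>{a<..<b}. ennreal (metric_speed \<gamma> t) \<partial>lborel)"
proof -
  have "K \<ge> 0" using lip by (rule lipschitz_on_nonneg)
  \<comment> \<open>the curve, extended by constants to the whole line\<close>
  define \<Gamma> where "\<Gamma> t = \<gamma> (max 0 (min 1 t))" for t
  have \<Gamma>: "\<Gamma> t = \<gamma> t" if "t \<in> {0..1}" for t using that by (simp add: \<Gamma>_def)
  have lip\<Gamma>: "dist (\<Gamma> s) (\<Gamma> t) \<le> K * \<bar>s - t\<bar>" for s t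
  proof -
    have "dist (\<Gamma> s) (\<Gamma> t) \<le> K * dist (max 0 (min 1 s)) (max 0 (min 1 t))"
      unfolding \<Gamma>_def by (intro lipschitz_onD[OF lip]) auto
    also have "\<dots> \<le> K * \<bar>s - t\<bar>"
      using \<open>K \<ge> 0\<close> by (intro mult_left_mono) (auto simp: dist_real_def)
    finally show ?thesis .
  qed
  obtain D :: "'a set" where D: "countable D" "\<And>X. open X \<Longrightarrow> X \<noteq> {} \<Longrightarrow> \<exists>d\<in>D. d \<in> X"
    using countable_dense_setE by blast
  have "D \<noteq> {}" using D(2)[of UNIV] by auto
  define x where "x = from_nat_into D"
  have dense: "\<exists>n. dist z (x n) < e" if "e > 0" for z e
  proof -
    have "open (ball z e)" "ball z e \<noteq> {}" using that by auto
    from D(2)[OF this] obtain d where "d \<in> D" "dist z d < e" by auto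
    then show ?thesis unfolding x_def using from_nat_into_surj[OF D(1)] by metis
  qed
  have "K-lipschitz_on UNIV (\<lambda>t. dist (\<Gamma> t) (x n))" for n
  proof (rule lipschitz_onI)
    fix s t
    have "\<bar>dist (\<Gamma> s) (x n) - dist (\<Gamma> t) (x n)\<bar> \<le> dist (\<Gamma> s) (\<Gamma> t)" by (metis abs_dist_diff_le dist_commute)
    then show "dist (dist (\<Gamma> s) (x n)) (dist (\<Gamma> t) (x n)) \<le> K * dist s t"
      using lip\<Gamma>[of s t] by (simp add: dist_real_def)
  qed (rule \<open>K \<ge> 0\<close>)
  note phi_lip = this
  have "\<forall>n. \<exists>g. g \<in> borel_measurable borel \<and> (\<forall>t. \<bar>g t\<bar> \<le> K) \<and>
     (\<forall>s t. s \<le> t \<longrightarrow> dist (\<Gamma> t) (x n) - dist (\<Gamma> s) (x n) = (LINT x:{s..t}|lborel. g x))"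
  proof
    fix n
    from Lipschitz_eq_integral[OF phi_lip[of n]] obtain g where "g \<in> borel_measurable borel" "\<And>t. \<bar>g t\<bar> \<le> K"
      "\<And>s t. s \<le> t \<Longrightarrow> dist (\<Gamma> t) (x n) - dist (\<Gamma> s) (x n) = (LINT x:{s..t}|lborel. g x)" by blast
    then show "\<exists>g. g \<in> borel_measurable borel \<and> (\<forall>t. \<bar>g t\<bar> \<le> K) \<and>
     (\<forall>s t. s \<le> t \<longrightarrow> dist (\<Gamma> t) (x n) - dist (\<Gamma> s) (x n) = (LINT x:{s..t}|lborel. g x))"
      by blast
  qed
  then obtain g where gm[measurable]: "\<And>n. g n \<in> borel_measurable borel" and gK: "\<And>n t. \<bar>g n t\<bar> \<le> K"
    and gI: "\<And>n s t. s \<le> t \<Longrightarrow> dist (\<Gamma> t) (x n) - dist (\<Gamma> s) (x n) = (LINT x:{s..t}|lborel. g n x)"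
    by metis
  define m where "m t = (SUP n. \<bar>g n t\<bar>)" for t
  have bdd: "bdd_above (range (\<lambda>n. \<bar>g n t\<bar>))" for t using gK by (auto intro!: bdd_aboveI)
  have mm[measurable]: "m \<in> borel_measurable borel"
    unfolding m_def by (intro borel_measurable_cSUP bdd) auto
  have gm_le: "\<bar>g n t\<bar> \<le> m t" for n t unfolding m_def by (intro cSUP_upper bdd) auto
  have m0: "0 \<le> m t" for t using gm_le[of 0 t] by linarith
  have mK: "\<bar>m t\<bar> \<le> K" for t
  proof -
    have "m t \<le> K" unfolding m_def using gK by (intro cSUP_least) auto
    then show ?thesis using m0[of t] by simp
  qed
  have Ig: "set_integrable lborel {s..t} (g n)" for s t n
    by (rule set_integrable_bounded_on_bounded[OF gm gK]) auto
  have Im: "set_integrable lborel {s..t} m" for s t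
    by (rule set_integrable_bounded_on_bounded[OF mm mK]) auto
  have up: "dist (\<Gamma> s) (\<Gamma> t) \<le> (LINT x:{s..t}|lborel. m x)" if st: "s \<le> t" for s t
  proof (rule field_le_epsilon)
    fix e :: real assume "e > 0"
    then obtain n where n: "dist (\<Gamma> s) (x n) < e / 2" using dense[of "e/2"] by auto
    have "dist (\<Gamma> s) (\<Gamma> t) \<le> dist (\<Gamma> s) (x n) + dist (\<Gamma> t) (x n)" by (metis dist_commute dist_triangle)
    also have "\<dots> \<le> (dist (\<Gamma> t) (x n) - dist (\<Gamma> s) (x n)) + e" using n by simp
    also have "\<dots> = (LINT x:{s..t}|lborel. g n x) + e" using gI[OF st] by simp
    also have "(LINT x:{s..t}|lborel. g n x) \<le> (LINT x:{s..t}|lborel. m x)"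
      by (intro set_integral_mono Ig Im order_trans[OF abs_ge_self gm_le])
    finally show "dist (\<Gamma> s) (\<Gamma> t) \<le> (LINT x:{s..t}|lborel. m x) + e" by simp
  qed
  have up': "dist (\<Gamma> s) (\<Gamma> t) \<le> (LINT x:{min s t..max s t}|lborel. m x)" for s t
    using up[of s t] up[of t s] by (cases "s \<le> t") (auto simp: min_def max_def dist_commute)
  have gI': "\<bar>LINT x:{min s t..max s t}|lborel. g n x\<bar> \<le> dist (\<Gamma> s) (\<Gamma> t)" for s t n
  proof -
    have 1: "\<bar>dist (\<Gamma> s) (x n) - dist (\<Gamma> t) (x n)\<bar> \<le> dist (\<Gamma> s) (\<Gamma> t)" by (metis abs_dist_diff_le dist_commute)
    show ?thesis
    proof (cases "s \<le> t")
      case True then show ?thesis using gI[of s t n] 1 by (simp add: min_def max_def)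
    next
      case False then show ?thesis using gI[of t s n] 1 by (simp add: min_def max_def)
    qed
  qed
  have speed: "AE t in lborel. t \<in> {0<..<1} \<longrightarrow> metric_speed \<gamma> t = m t"
  proof -
    have "AE t in lborel. \<forall>n. \<forall>e>0. \<forall>\<^sub>F s in at t.
       \<bar>(LINT x:{min s t..max s t}|lborel. g n x) - g n t * \<bar>s - t\<bar>\<bar> \<le> e * \<bar>s - t\<bar>"
      by (subst AE_all_countable, intro allI lebesgue_differentiation_interval[OF gm gK])
    with lebesgue_differentiation_interval[OF mm mK] show ?thesis
    proof (eventually_elim, intro impI)
      fix t :: real
      assume M: "\<forall>e>0. \<forall>\<^sub>F s in at t. \<bar>(LINT x:{min s t..max s t}|lborel. m x) - m t * \<bar>s - t\<bar>\<bar> \<le> e * \<bar>s - t\<bar>"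
        and G: "\<forall>n. \<forall>e>0. \<forall>\<^sub>F s in at t. \<bar>(LINT x:{min s t..max s t}|lborel. g n x) - g n t * \<bar>s - t\<bar>\<bar> \<le> e * \<bar>s - t\<bar>"
        and t: "t \<in> {0<..<1}"
      have "((\<lambda>s. dist (\<Gamma> s) (\<Gamma> t) / \<bar>s - t\<bar>) \<longlongrightarrow> m t) (at t)"
      proof (rule tendstoI)
        fix e :: real assume "e > 0"
        have "\<exists>n. m t - e/4 < \<bar>g n t\<bar>"
        proof (rule ccontr)
          assume "\<not> ?thesis"
          then have "\<bar>g n t\<bar> \<le> m t - e/4" for n by (auto simp: not_less)
          then have "m t \<le> m t - e/4" unfolding m_def by (intro cSUP_least) auto
          then show False using \<open>e > 0\<close> by simp
        qed
        then obtain n where n: "m t - e/4 < \<bar>g n t\<bar>" by blast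
        have "\<forall>\<^sub>F s in at t. \<bar>(LINT x:{min s t..max s t}|lborel. m x) - m t * \<bar>s - t\<bar>\<bar> \<le> e/2 * \<bar>s - t\<bar>"
          using M[rule_format, of "e/2"] \<open>e > 0\<close> by simp
        moreover have "\<forall>\<^sub>F s in at t. \<bar>(LINT x:{min s t..max s t}|lborel. g n x) - g n t * \<bar>s - t\<bar>\<bar> \<le> e/2 * \<bar>s - t\<bar>"
          using G[rule_format, of "e/2" n] \<open>e > 0\<close> by simp
        moreover have "\<forall>\<^sub>F s in at t. s \<noteq> t" by (simp add: eventually_at_filter)
        ultimately show "\<forall>\<^sub>F s in at t. dist (dist (\<Gamma> s) (\<Gamma> t) / \<bar>s - t\<bar>) (m t) < e"
        proof eventually_elim
          fix s assume 1: "\<bar>(LINT x:{min s t..max s t}|lborel. m x) - m t * \<bar>s - t\<bar>\<bar> \<le> e/2 * \<bar>s - t\<bar>"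
            and 2: "\<bar>(LINT x:{min s t..max s t}|lborel. g n x) - g n t * \<bar>s - t\<bar>\<bar> \<le> e/2 * \<bar>s - t\<bar>"
            and "s \<noteq> t"
          then have p: "\<bar>s - t\<bar> > 0" by simp
          have "dist (\<Gamma> s) (\<Gamma> t) \<le> m t * \<bar>s - t\<bar> + e/2 * \<bar>s - t\<bar>" using up'[of s t] 1 by (simp only: abs_le_iff) linarith
          also have "\<dots> = (m t + e/2) * \<bar>s - t\<bar>" by (simp add: ring_distribs)
          finally have u: "dist (\<Gamma> s) (\<Gamma> t) / \<bar>s - t\<bar> \<le> m t + e/2" using p by (simp add: pos_divide_le_eq)
          have "\<bar>g n t * \<bar>s - t\<bar>\<bar> - e/2 * \<bar>s - t\<bar> \<le> \<bar>LINT x:{min s t..max s t}|lborel. g n x\<bar>" using 2 by linarith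
          also have "\<dots> \<le> dist (\<Gamma> s) (\<Gamma> t)" by (rule gI')
          finally have "(\<bar>g n t\<bar> - e/2) * \<bar>s - t\<bar> \<le> dist (\<Gamma> s) (\<Gamma> t)" by (simp add: abs_mult ring_distribs)
          then have "\<bar>g n t\<bar> - e/2 \<le> dist (\<Gamma> s) (\<Gamma> t) / \<bar>s - t\<bar>" using p by (simp add: pos_le_divide_eq)
          then show "dist (dist (\<Gamma> s) (\<Gamma> t) / \<bar>s - t\<bar>) (m t) < e"
            using u n \<open>e > 0\<close> by (simp add: dist_real_def abs_less_iff)
        qed
      qed
      then have "((\<lambda>s. dist (\<Gamma> s) (\<Gamma> t) / \<bar>s - t\<bar>) \<longlongrightarrow> m t) (at t within {0..1})"
        by (rule tendsto_within_subset) auto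
      moreover have "\<forall>\<^sub>F s in at t within {0..1}. dist (\<Gamma> s) (\<Gamma> t) / \<bar>s - t\<bar> = dist (\<gamma> s) (\<gamma> t) / \<bar>s - t\<bar>"
        using t by (auto simp: eventually_at_filter \<Gamma>)
      ultimately have lim: "((\<lambda>s. dist (\<gamma> s) (\<gamma> t) / \<bar>s - t\<bar>) \<longlongrightarrow> m t) (at t within {0..1})"
        by (rule Lim_transform_eventually)
      have "at t within {0..1} \<noteq> bot" using t by (simp add: at_within_Icc_at)
      then show "metric_speed \<gamma> t = m t"
        unfolding metric_speed_def Let_def using lim tendsto_Lim by auto
    qed
  qed
  have "ennreal (dist (\<gamma> a) (\<gamma> b)) \<le> ennreal (LINT x:{a..b}|lborel. m x)"
    using up[of a b] ab by (simp add: \<Gamma> ennreal_leI)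
  also have "\<dots> = (\<integral>\<^sup>+x. ennreal (indicator {a..b} x *\<^sub>R m x) \<partial>lborel)"
    unfolding set_lebesgue_integral_def using Im[of a b] m0
    by (intro nn_integral_eq_integral[symmetric]) (auto simp: set_integrable_def)
  also have "\<dots> = (\<integral>\<^sup>+t\<in>{a<..<b}. ennreal (metric_speed \<gamma> t) \<partial>lborel)"
  proof (intro nn_integral_cong_AE)
    have "AE x in lborel. x \<noteq> a" "AE x in lborel. x \<noteq> b" by (auto intro: AE_lborel_singleton)
    with speed show "AE x in lborel. ennreal (indicator {a..b} x *\<^sub>R m x) = ennreal (metric_speed \<gamma> x) * indicator {a<..<b} x"
      by eventually_elim (use ab in \<open>auto split: split_indicator\<close>)
  qed
  finally show ?thesis .
qed

section \<open>Chains of small steps and their limit curves\<close>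

text \<open>
  A step is charged with the weight of the point where it starts.
\<close>
inductive chain_cost :: "real \<Rightarrow> ('a::metric_space \<Rightarrow> real) \<Rightarrow> 'a \<Rightarrow> 'a \<Rightarrow> real \<Rightarrow> bool"
  for \<delta> w x where
  start: "chain_cost \<delta> w x x 0"
| step: "chain_cost \<delta> w x a c \<Longrightarrow> dist a b < \<delta> \<Longrightarrow> chain_cost \<delta> w x b (c + w a * dist a b)"

lemma chain_cost_nonneg: "chain_cost \<delta> w x z c \<Longrightarrow> (\<And>a. 0 \<le> w a) \<Longrightarrow> 0 \<le> c"
  by (induction rule: chain_cost.induct) auto

text \<open>
  The piecewise constant path that reaches each point of the chain as soon as the cost up to it has been paid.  On a stretch
  where the weight is at least \<open>\<kappa>\<close>, distances are at most \<open>1 / \<kappa>\<close> times the elapsed cost, up to one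
  step; towards the end point there is no such error, and this sharper form carries the induction.  The last conjunct says that
  a chain reaching a point of the path can be continued along the rest of the chain.
\<close>
lemma chain_parametrisation:
  assumes "chain_cost \<delta> w x z c" and w: "\<And>a. 0 < w a" and "\<delta> > 0"
  shows "\<exists>\<sigma>. \<sigma> 0 = x \<and> (\<forall>t\<ge>c. \<sigma> t = z) \<and>
    (\<forall>s t \<kappa>. 0 \<le> s \<longrightarrow> s \<le> t \<longrightarrow> 0 < \<kappa> \<longrightarrow> (\<forall>r\<in>{s..t}. \<kappa> \<le> w (\<sigma> r)) \<longrightarrow>
        dist (\<sigma> s) (\<sigma> t) \<le> (t - s) / \<kappa> + \<delta>) \<and>
    (\<forall>s \<kappa>. 0 \<le> s \<longrightarrow> s \<le> c \<longrightarrow> 0 < \<kappa> \<longrightarrow> (\<forall>r\<in>{s..c}. \<kappa> \<le> w (\<sigma> r)) \<longrightarrow>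
        dist (\<sigma> s) z \<le> (c - s) / \<kappa>) \<and>
    (\<forall>s p. 0 \<le> s \<longrightarrow> s \<le> c \<longrightarrow> chain_cost \<delta> w x (\<sigma> s) p \<longrightarrow> (\<exists>p'\<le>p + (c - s). chain_cost \<delta> w x z p'))"
  using assms(1)
proof (induction rule: chain_cost.induct)
  case start
  show ?case
    using \<open>\<delta> > 0\<close> by (intro exI[of _ "\<lambda>_. x"]) auto
next
  case (step a c b)
  have "0 \<le> c" using chain_cost_nonneg[OF step.hyps(1)] w less_imp_le by blast
  from step.IH obtain \<sigma> where s0: "\<sigma> 0 = x" and sc: "\<And>t. t \<ge> c \<Longrightarrow> \<sigma> t = a"
    and P1: "\<And>s t \<kappa>. 0 \<le> s \<Longrightarrow> s \<le> t \<Longrightarrow> 0 < \<kappa> \<Longrightarrow> (\<forall>r\<in>{s..t}. \<kappa> \<le> w (\<sigma> r)) \<Longrightarrow>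
        dist (\<sigma> s) (\<sigma> t) \<le> (t - s) / \<kappa> + \<delta>"
    and P2: "\<And>s \<kappa>. 0 \<le> s \<Longrightarrow> s \<le> c \<Longrightarrow> 0 < \<kappa> \<Longrightarrow> (\<forall>r\<in>{s..c}. \<kappa> \<le> w (\<sigma> r)) \<Longrightarrow>
        dist (\<sigma> s) a \<le> (c - s) / \<kappa>"
    and P3: "\<And>s p. 0 \<le> s \<Longrightarrow> s \<le> c \<Longrightarrow> chain_cost \<delta> w x (\<sigma> s) p \<Longrightarrow> \<exists>p'\<le>p + (c - s). chain_cost \<delta> w x a p'"
    by blast
  define c' where "c' = c + w a * dist a b"
  have cc': "c \<le> c'" using w[of a] by (simp add: c'_def)
  have eq: "a = b" if "c' = c" using that w[of a] by (simp add: c'_def)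
  define \<tau> where "\<tau> t = (if t \<le> c then \<sigma> t else b)" for t
  have t1: "\<tau> t = \<sigma> t" if "t \<le> c" for t using that by (simp add: \<tau>_def)
  have t2: "\<tau> t = b" if "c < t" for t using that by (simp add: \<tau>_def)
  have tc: "\<tau> c = a" using t1[of c] sc[of c] by simp
  have end_: "\<tau> t = b" if "t \<ge> c'" for t
    using that eq cc' t2[of t] tc by (cases "t = c") auto
  show ?case unfolding c'_def[symmetric]
  proof (intro exI[of _ \<tau>] conjI allI impI)
    show "\<tau> 0 = x" using t1[of 0] \<open>0 \<le> c\<close> s0 by simp
    show "\<tau> t = b" if "c' \<le> t" for t using end_ that .
  next
    fix s t \<kappa> :: real assume st: "0 \<le> s" "s \<le> t" "0 < \<kappa>" and *: "\<forall>r\<in>{s..t}. \<kappa> \<le> w (\<tau> r)"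
    consider "t \<le> c" | "s \<le> c" "c < t" | "c < s" using st by linarith
    then show "dist (\<tau> s) (\<tau> t) \<le> (t - s) / \<kappa> + \<delta>"
    proof cases
      case 1
      then show ?thesis using P1[OF st] * st by (auto simp: t1)
    next
      case 2
      have "\<forall>r\<in>{s..c}. \<kappa> \<le> w (\<sigma> r)"
      proof
        fix r assume "r \<in> {s..c}"
        then show "\<kappa> \<le> w (\<sigma> r)" using bspec[OF *, of r] t1[of r] 2 by simp
      qed
      then have "dist (\<sigma> s) a \<le> (c - s) / \<kappa>" using 2 st by (intro P2) auto
      then have "dist (\<tau> s) (\<tau> t) \<le> (c - s) / \<kappa> + dist a b"
        using 2 dist_triangle[of "\<sigma> s" b a] by (simp add: t1 t2)
      also have "\<dots> \<le> (t - s) / \<kappa> + \<delta>" using 2 st step.hyps(2) by (intro add_mono divide_right_mono) auto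
      finally show ?thesis .
    next
      case 3
      then show ?thesis using st \<open>\<delta> > 0\<close> by (simp add: t2)
    qed
  next
    fix s \<kappa> :: real assume st: "0 \<le> s" "s \<le> c'" "0 < \<kappa>" and *: "\<forall>r\<in>{s..c'}. \<kappa> \<le> w (\<tau> r)"
    show "dist (\<tau> s) b \<le> (c' - s) / \<kappa>"
    proof (cases "s \<le> c")
      case True
      have "\<forall>r\<in>{s..c}. \<kappa> \<le> w (\<sigma> r)"
      proof
        fix r assume "r \<in> {s..c}"
        then show "\<kappa> \<le> w (\<sigma> r)" using bspec[OF *, of r] t1[of r] cc' by simp
      qed
      then have "dist (\<sigma> s) a \<le> (c - s) / \<kappa>" using True st by (intro P2) auto
      moreover have "\<kappa> \<le> w a" using bspec[OF *, of c] True cc' tc by simp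
      then have "dist a b \<le> (c' - c) / \<kappa>" using st by (simp add: c'_def field_simps mult_right_mono)
      ultimately have "dist (\<sigma> s) b \<le> (c - s) / \<kappa> + (c' - c) / \<kappa>"
        using dist_triangle[of "\<sigma> s" b a] by linarith
      also have "\<dots> = (c' - s) / \<kappa>" by (simp add: diff_divide_distrib)
      finally show ?thesis using True by (simp add: t1)
    next
      case False
      then show ?thesis using st by (simp add: t2)
    qed
  next
    fix s p :: real assume st: "0 \<le> s" "s \<le> c'" and p: "chain_cost \<delta> w x (\<tau> s) p"
    show "\<exists>p'\<le>p + (c' - s). chain_cost \<delta> w x b p'"
    proof (cases "s \<le> c")
      case True
      then obtain p' where p': "p' \<le> p + (c - s)" "chain_cost \<delta> w x a p'" using P3[of s p] st p by (auto simp: t1)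
      show ?thesis
        using chain_cost.step[OF p'(2) step.hyps(2)] p'(1)
        by (intro exI[of _ "p' + w a * dist a b"]) (auto simp: c'_def)
    next
      case False
      then show ?thesis using p st by (intro exI[of _ p]) (auto simp: t2)
    qed
  qed
qed

text \<open>
  Tychonoff's theorem replaces Arzela-Ascoli: the paths need not be continuous, and a cluster point in the
  topology of pointwise convergence is enough, because all properties of the limit curve that matter
  compare two points of time.
\<close>
lemma pointwise_cluster_path:
  fixes f :: "nat \<Rightarrow> 'b \<Rightarrow> 'a::metric_space"
  assumes "compact C" and f: "\<And>n t. f n t \<in> C"
  obtains \<gamma> where "\<And>e s t N. 0 < e \<Longrightarrow> \<exists>n\<ge>N. dist (f n s) (\<gamma> s) < e \<and> dist (f n t) (\<gamma> t) < e"
proof -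
  let ?P = "PiE UNIV (\<lambda>_. C) :: ('b \<Rightarrow> 'a) set"
  have "compactin (product_topology (\<lambda>_. euclidean) UNIV) ?P"
    unfolding compactin_PiE using assms(1) by simp
  then have "compact ?P" by (simp add: euclidean_product_topology)
  moreover have "eventually (\<lambda>g. g \<in> ?P) (filtermap f sequentially)"
    by (simp add: eventually_filtermap PiE_iff f)
  moreover have "filtermap f sequentially \<noteq> bot" by (simp add: filtermap_bot_iff)
  ultimately obtain \<gamma> where \<gamma>: "inf (nhds \<gamma>) (filtermap f sequentially) \<noteq> bot"
    unfolding compact_filter by blast
  show thesis
  proof
    fix e :: real and s t :: 'b and N :: nat assume "0 < e"
    show "\<exists>n\<ge>N. dist (f n s) (\<gamma> s) < e \<and> dist (f n t) (\<gamma> t) < e"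
    proof (rule ccontr)
      assume neg: "\<not> ?thesis"
      let ?V = "{g. dist (g s) (\<gamma> s) < e} \<inter> {g. dist (g t) (\<gamma> t) < e}"
      have "open {g::'b \<Rightarrow> 'a. dist (g r) (\<gamma> r) < e}" for r
        by (intro open_Collect_less continuous_intros continuous_on_product_coordinates)
      then have "open ?V" by (intro open_Int)
      then have 1: "eventually (\<lambda>g. g \<in> ?V) (nhds \<gamma>)"
        using \<open>0 < e\<close> by (intro eventually_nhds_in_open) auto
      have 2: "eventually (\<lambda>g. g \<notin> ?V) (filtermap f sequentially)"
        unfolding eventually_filtermap eventually_sequentially using neg by (intro exI[of _ N]) auto
      have "eventually (\<lambda>g. False) (inf (nhds \<gamma>) (filtermap f sequentially))"
        unfolding eventually_inf using 1 2 by blast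
      then show False using \<gamma> by (simp add: trivial_limit_def)
    qed
  qed
qed

lemma metric_speed_le:
  assumes "t \<in> {0..1}" "0 \<le> T" "\<eta> > 0" and le: "\<And>s. s \<in> {0..1} \<Longrightarrow> \<bar>s - t\<bar> < \<eta> \<Longrightarrow> dist (\<gamma> s) (\<gamma> t) \<le> T * \<bar>s - t\<bar>"
  shows "metric_speed \<gamma> t \<le> T"
proof -
  define q where "q s = dist (\<gamma> s) (\<gamma> t) / \<bar>s - t\<bar>" for s
  define F where "F = at t within {0..1::real}"
  have nb: "F \<noteq> bot" using assms(1) unfolding F_def
    by (metis at_within_Icc_at_left at_within_Icc_at_right at_within_Icc_at atLeastAtMost_iff less_eq_real_def trivial_limit_at trivial_limit_at_left_real trivial_limit_at_right_real zero_less_one)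
  have ev: "eventually (\<lambda>s. q s \<le> T) F"
    unfolding F_def eventually_at
  proof (intro exI[of _ \<eta>] conjI ballI impI)
    fix s :: real assume "s \<in> {0..1}" "s \<noteq> t \<and> dist s t < \<eta>"
    then show "q s \<le> T" using le[of s] by (simp add: q_def dist_real_def pos_divide_le_eq)
  qed fact
  have "Lim F q \<le> T" if "(q \<longlongrightarrow> l) F" for l
    using tendsto_upperbound[OF that ev nb] tendsto_Lim[OF nb that] by simp
  then show ?thesis using \<open>0 \<le> T\<close>
    unfolding metric_speed_def Let_def q_def[symmetric] F_def[symmetric] by auto
qed

text \<open>
  Parametrising by cost makes the speed of the limit visible without lower semicontinuity of length:
  the paths are \<open>1 / \<epsilon>\<close>-Lipschitz in the cost up to the step size, and while they stay in a ball well
  inside \<open>U\<close> the weight is at least \<open>1\<close>, so they are even \<open>1\<close>-Lipschitz there.  Both bounds pass to the limit,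
  rescaled to the unit interval.
\<close>
lemma curve_of_chains:
  fixes x y :: "'a::metric_space"
  assumes proper: "\<And>r. compact (cball x r)" and "open U" and "x \<noteq> y" and "\<epsilon> > 0"
    and chains: "\<And>n. \<exists>c\<le>T. chain_cost (1 / Suc n) (\<lambda>a. \<epsilon> + (if ball a (1 / Suc n) \<subseteq> U then 1 else 0)) x y c"
  shows "\<exists>\<gamma>\<in>lipschitz_curves x y. curve_length_in \<gamma> U \<le> ennreal T"
proof -
  define \<delta> where "\<delta> n = 1 / real (Suc n)" for n
  have \<delta>0: "\<delta> n > 0" for n by (simp add: \<delta>_def)
  have \<delta>1: "\<delta> n \<le> 1" for n by (simp add: \<delta>_def)
  have \<delta>lim: "\<exists>N. \<forall>n\<ge>N. \<delta> n < e" if e: "e > 0" for e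
  proof -
    obtain N where N: "1 / real (Suc N) < e" using nat_approx_posE[OF e] by blast
    have "\<delta> n < e" if "n \<ge> N" for n
    proof -
      have "\<delta> n \<le> 1 / real (Suc N)" using that by (simp add: \<delta>_def frac_le)
      then show ?thesis using N by simp
    qed
    then show ?thesis by blast
  qed
  define w where "w n a = \<epsilon> + (if ball a (\<delta> n) \<subseteq> U then 1 else 0)" for n a
  have w: "0 < w n a" "\<epsilon> \<le> w n a" for n a using \<open>\<epsilon> > 0\<close> by (auto simp: w_def)
  have "\<forall>n. \<exists>\<sigma>. \<sigma> 0 = x \<and> \<sigma> T = y \<and> 0 \<le> T \<and>
     (\<forall>s t \<kappa>. 0 \<le> s \<longrightarrow> s \<le> t \<longrightarrow> 0 < \<kappa> \<longrightarrow> (\<forall>r\<in>{s..t}. \<kappa> \<le> w n (\<sigma> r)) \<longrightarrow>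
        dist (\<sigma> s) (\<sigma> t) \<le> (t - s) / \<kappa> + \<delta> n)"
  proof
    fix n
    obtain c where c: "c \<le> T" "chain_cost (\<delta> n) (w n) x y c"
      using chains[of n] unfolding w_def \<delta>_def by blast
    have "0 \<le> c" using chain_cost_nonneg[OF c(2)] w(1) less_imp_le by blast
    then show "\<exists>\<sigma>. \<sigma> 0 = x \<and> \<sigma> T = y \<and> 0 \<le> T \<and>
     (\<forall>s t \<kappa>. 0 \<le> s \<longrightarrow> s \<le> t \<longrightarrow> 0 < \<kappa> \<longrightarrow> (\<forall>r\<in>{s..t}. \<kappa> \<le> w n (\<sigma> r)) \<longrightarrow>
        dist (\<sigma> s) (\<sigma> t) \<le> (t - s) / \<kappa> + \<delta> n)"
      using chain_parametrisation[OF c(2) w(1) \<delta>0] c(1) order_trans[OF \<open>0 \<le> c\<close> c(1)] by blast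
  qed
  then obtain \<sigma> where s0: "\<And>n. \<sigma> n 0 = x" and sT: "\<And>n. \<sigma> n T = y" and "0 \<le> T"
    and P: "\<And>n s t \<kappa>. 0 \<le> s \<Longrightarrow> s \<le> t \<Longrightarrow> 0 < \<kappa> \<Longrightarrow> (\<forall>r\<in>{s..t}. \<kappa> \<le> w n (\<sigma> n r)) \<Longrightarrow>
        dist (\<sigma> n s) (\<sigma> n t) \<le> (t - s) / \<kappa> + \<delta> n"
    by metis
  \<comment> \<open>the extension by constants lets all paths take values in one compact ball\<close>
  define f where "f n t = \<sigma> n (T * max 0 (min 1 t))" for n and t :: real
  have feq: "f n t = \<sigma> n (T * t)" if "t \<in> {0..1}" for n t using that by (simp add: f_def)
  have P': "dist (f n s) (f n t) \<le> T * \<bar>s - t\<bar> / \<kappa> + \<delta> n"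
    if st: "s \<in> {0..1}" "t \<in> {0..1}" and \<kappa>: "0 < \<kappa>" "\<And>r. r \<in> {0..1} \<Longrightarrow> min s t \<le> r \<Longrightarrow> r \<le> max s t \<Longrightarrow> \<kappa> \<le> w n (f n r)"
    for n s t \<kappa>
  proof -
    have *: "dist (f n s) (f n t) \<le> T * (t - s) / \<kappa> + \<delta> n"
      if "s \<le> t" "s \<in> {0..1}" "t \<in> {0..1}" and r: "\<And>r. r \<in> {0..1} \<Longrightarrow> s \<le> r \<Longrightarrow> r \<le> t \<Longrightarrow> \<kappa> \<le> w n (f n r)" for s t
    proof -
      have "dist (\<sigma> n (T * s)) (\<sigma> n (T * t)) \<le> (T * t - T * s) / \<kappa> + \<delta> n"
      proof (rule P)
        show "0 \<le> T * s" "T * s \<le> T * t" using that \<open>0 \<le> T\<close> by (auto intro: mult_left_mono)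
        show "\<forall>r\<in>{T * s..T * t}. \<kappa> \<le> w n (\<sigma> n r)"
        proof
          fix r assume r': "r \<in> {T * s..T * t}"
          show "\<kappa> \<le> w n (\<sigma> n r)"
          proof (cases "T = 0")
            case True
            then show ?thesis using r' r[of s] that by (simp add: feq)
          next
            case False
            then have "T > 0" using \<open>0 \<le> T\<close> by simp
            then have "s \<le> r / T" "r / T \<le> t" using r' by (auto simp: field_simps)
            moreover have "r / T \<in> {0..1}" using calculation that(2,3) by simp
            ultimately show ?thesis using r[of "r / T"] \<open>T > 0\<close> feq[of "r / T" n] by simp
          qed
        qed
      qed fact
      then show ?thesis using that by (simp add: feq right_diff_distrib)
    qed
    show ?thesis
    proof (cases "s \<le> t")
      case True
      then show ?thesis using *[of s t] st \<kappa> by (simp add: min_def max_def)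
    next
      case False
      then show ?thesis using *[of t s] st \<kappa> by (simp add: min_def max_def dist_commute)
    qed
  qed
  have PE: "dist (f n s) (f n t) \<le> T / \<epsilon> * \<bar>s - t\<bar> + \<delta> n" if "s \<in> {0..1}" "t \<in> {0..1}" for n s t
    using P'[OF that \<open>\<epsilon> > 0\<close>, of n] w(2) by (simp add: field_simps)
  define C where "C = cball x (T / \<epsilon> + 1)"
  have fC: "f n t \<in> C" for n t
  proof -
    have "dist (f n 0) (f n (max 0 (min 1 t))) \<le> T / \<epsilon> * \<bar>0 - max 0 (min 1 t)\<bar> + \<delta> n"
      by (rule PE) auto
    also have "\<dots> \<le> T / \<epsilon> * 1 + 1"
      using \<open>0 \<le> T\<close> \<open>\<epsilon> > 0\<close> \<delta>1 by (intro add_mono mult_left_mono) auto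
    finally have "dist (f n 0) (f n (max 0 (min 1 t))) \<le> T / \<epsilon> + 1" by simp
    then show ?thesis using s0[of n] by (simp add: C_def f_def)
  qed
  obtain \<gamma> where cl: "\<And>e s t N. 0 < e \<Longrightarrow> \<exists>n\<ge>N. dist (f n s) (\<gamma> s) < e \<and> dist (f n t) (\<gamma> t) < e"
    by (rule pointwise_cluster_path[OF proper[of "T / \<epsilon> + 1", folded C_def] fC]) (rule that)
  have limit_bound: "dist (\<gamma> s) (\<gamma> t) \<le> B"
    if \<theta>: "\<theta> > 0" and B: "\<And>n. \<delta> n < \<theta> \<Longrightarrow> dist (f n s) (\<gamma> s) < \<theta> \<Longrightarrow> dist (f n t) (\<gamma> t) < \<theta> \<Longrightarrow>
            dist (f n s) (f n t) \<le> B + \<delta> n" for s t B \<theta>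
  proof (rule field_le_epsilon)
    fix e :: real assume "e > 0"
    define e' where "e' = min (e / 4) \<theta>"
    have e': "e' > 0" "e' \<le> e / 4" "e' \<le> \<theta>" using \<open>e > 0\<close> \<theta> by (auto simp: e'_def)
    obtain N where N: "\<And>n. n \<ge> N \<Longrightarrow> \<delta> n < e'" using \<delta>lim[OF e'(1)] by blast
    obtain n where n: "n \<ge> N" "dist (f n s) (\<gamma> s) < e'" "dist (f n t) (\<gamma> t) < e'" using cl[OF e'(1)] by blast
    have "dist (\<gamma> s) (\<gamma> t) \<le> dist (f n s) (\<gamma> s) + dist (f n s) (f n t) + dist (f n t) (\<gamma> t)"
      using dist_triangle[of "\<gamma> s" "\<gamma> t" "f n s"] dist_triangle[of "f n s" "\<gamma> t" "f n t"]
      by (simp add: dist_commute)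
    also have "\<dots> \<le> B + e" using n N[OF n(1)] e' B[of n] by linarith
    finally show "dist (\<gamma> s) (\<gamma> t) \<le> B + e" .
  qed
  have lips: "dist (\<gamma> s) (\<gamma> t) \<le> T / \<epsilon> * \<bar>s - t\<bar>" if "s \<in> {0..1}" "t \<in> {0..1}" for s t
    by (rule limit_bound[OF zero_less_one]) (rule PE[OF that])
  have ends: "\<gamma> 0 = x" "\<gamma> 1 = y"
  proof -
    have ax: "dist x (\<gamma> 0) \<le> e" if "e > 0" for e using cl[OF that, of 0 0 0] s0 feq[of 0] by fastforce
    have "dist x (\<gamma> 0) \<le> 0" by (rule field_le_epsilon) (simp only: add_0_left ax)
    then show "\<gamma> 0 = x" by simp
    have ay: "dist y (\<gamma> 1) \<le> e" if "e > 0" for e using cl[OF that, of 0 1 1] sT feq[of 1] by fastforce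
    have "dist y (\<gamma> 1) \<le> 0" by (rule field_le_epsilon) (simp only: add_0_left ay)
    then show "\<gamma> 1 = y" by simp
  qed
  have "(T / \<epsilon>)-lipschitz_on {0..1} \<gamma>"
    using lips \<open>0 \<le> T\<close> \<open>\<epsilon> > 0\<close> by (intro lipschitz_onI) (auto simp: dist_real_def)
  then have mem: "\<gamma> \<in> lipschitz_curves x y" using ends \<open>x \<noteq> y\<close> by (auto simp: lipschitz_curves_def)
  have speed: "metric_speed \<gamma> t \<le> T" if t: "t \<in> {0..1}" and U: "\<gamma> t \<in> U" for t
  proof -
    obtain r0 where "r0 > 0" "ball (\<gamma> t) r0 \<subseteq> U" using \<open>open U\<close> U openE by blast
    then obtain r where r: "r > 0" "ball (\<gamma> t) (4 * r) \<subseteq> U"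
      by (intro that[of "r0/4"]) auto
    \<comment> \<open>in time \<open>\<eta>\<close> the paths move by at most \<open>r\<close> up to one step, so they stay in the ball of radius \<open>4 * r\<close>\<close>
    define \<eta> where "\<eta> = r * \<epsilon> / (T + 1)"
    have "\<eta> > 0" using r \<open>\<epsilon> > 0\<close> \<open>0 \<le> T\<close> by (simp add: \<eta>_def)
    have T\<eta>: "T / \<epsilon> * d \<le> r" if "d \<le> \<eta>" "0 \<le> d" for d
    proof -
      have "T / \<epsilon> * d \<le> (T + 1) / \<epsilon> * \<eta>" using that \<open>\<epsilon> > 0\<close> \<open>0 \<le> T\<close> by (intro mult_mono divide_right_mono) auto
      also have "\<dots> = r" using \<open>\<epsilon> > 0\<close> \<open>0 \<le> T\<close> by (simp add: \<eta>_def)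
      finally show ?thesis .
    qed
    show ?thesis
    proof (rule metric_speed_le[OF t \<open>0 \<le> T\<close> \<open>\<eta> > 0\<close>])
      fix s :: real assume s: "s \<in> {0..1}" "\<bar>s - t\<bar> < \<eta>"
      show "dist (\<gamma> s) (\<gamma> t) \<le> T * \<bar>s - t\<bar>"
      proof (rule limit_bound[OF r(1)])
        fix n assume n: "\<delta> n < r" "dist (f n s) (\<gamma> s) < r" "dist (f n t) (\<gamma> t) < r"
        have "dist (f n s) (f n t) \<le> T * \<bar>s - t\<bar> / 1 + \<delta> n"
        proof (rule P'[OF s(1) t])
          fix \<tau> :: real assume \<tau>: "\<tau> \<in> {0..1}" "min s t \<le> \<tau>" "\<tau> \<le> max s t"
          have "\<bar>\<tau> - t\<bar> \<le> \<bar>s - t\<bar>" using \<tau> by (auto simp: min_def max_def split: if_splits)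
          then have "T / \<epsilon> * \<bar>\<tau> - t\<bar> \<le> r" using s by (intro T\<eta>) auto
          then have "dist (f n \<tau>) (f n t) < 2 * r" using PE[OF \<tau>(1) t, of n] n by linarith
          have "ball (f n \<tau>) (\<delta> n) \<subseteq> ball (\<gamma> t) (4 * r)"
          proof
            fix v assume "v \<in> ball (f n \<tau>) (\<delta> n)"
            then have "dist (f n \<tau>) v < r" using n by simp
            then show "v \<in> ball (\<gamma> t) (4 * r)"
              using \<open>dist (f n \<tau>) (f n t) < 2 * r\<close> n(3)
                dist_triangle[of "\<gamma> t" v "f n t"] dist_triangle[of "f n t" v "f n \<tau>"]
              by (simp add: dist_commute)
          qed
          then show "1 \<le> w n (f n \<tau>)" using r(2) \<open>\<epsilon> > 0\<close> by (auto simp: w_def)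
        qed simp
        then show "dist (f n s) (f n t) \<le> T * \<bar>s - t\<bar> + \<delta> n" by simp
      qed
    qed
  qed
  have "curve_length_in \<gamma> U \<le> (\<integral>\<^sup>+t\<in>{0..1::real}. ennreal T \<partial>lborel)"
    unfolding curve_length_in_def
  proof (intro nn_integral_mono)
    fix t :: real
    show "indicator U (\<gamma> t) * ennreal (metric_speed \<gamma> t) * indicator {0..1} t \<le> ennreal T * indicator {0..1} t"
      using speed[of t] by (auto split: split_indicator intro!: ennreal_leI)
  qed
  also have "\<dots> = ennreal T" by (simp add: nn_integral_cmult)
  finally show ?thesis using mem by blast
qed

text \<open>
  The truncation at \<open>N\<close> makes the function finite and globally Lipschitz, also when there are no chains
  between some points.
\<close>
definition truncated_cost :: "real \<Rightarrow> ('a::metric_space \<Rightarrow> real) \<Rightarrow> real \<Rightarrow> 'a \<Rightarrow> 'a \<Rightarrow> real" where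
  "truncated_cost \<delta> w N x z = Inf (insert N {c. chain_cost \<delta> w x z c})"

context
  fixes \<delta> N :: real and w :: "'a::metric_space \<Rightarrow> real" and x :: 'a
  assumes w: "\<And>a. 0 \<le> w a" and N: "0 \<le> N"
begin

lemma truncated_cost_bdd: "bdd_below (insert N {c. chain_cost \<delta> w x z c})"
  using N chain_cost_nonneg[OF _ w] by (intro bdd_belowI[of _ 0]) auto

lemma truncated_cost_le: "truncated_cost \<delta> w N x z \<le> N"
  unfolding truncated_cost_def using truncated_cost_bdd by (intro cInf_lower) auto

lemma truncated_cost_le_chain: "chain_cost \<delta> w x z c \<Longrightarrow> truncated_cost \<delta> w N x z \<le> c"
  unfolding truncated_cost_def using truncated_cost_bdd by (intro cInf_lower) auto

lemma truncated_cost_nonneg: "0 \<le> truncated_cost \<delta> w N x z"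
  unfolding truncated_cost_def using N chain_cost_nonneg[OF _ w] by (intro cInf_greatest) auto

lemma truncated_cost_self: "truncated_cost \<delta> w N x x = 0"
  using truncated_cost_le_chain[OF chain_cost.start] truncated_cost_nonneg[of x] by simp

lemma truncated_cost_chain:
  assumes "truncated_cost \<delta> w N x z < B" "B \<le> N"
  obtains c where "c < B" "chain_cost \<delta> w x z c"
  using cInf_lessD[OF _ assms(1)[unfolded truncated_cost_def]] assms(2) by auto

lemma truncated_cost_step:
  assumes "dist a b < \<delta>"
  shows "truncated_cost \<delta> w N x b \<le> truncated_cost \<delta> w N x a + w a * dist a b"
proof (rule field_le_epsilon)
  fix e :: real assume "e > 0"
  show "truncated_cost \<delta> w N x b \<le> truncated_cost \<delta> w N x a + w a * dist a b + e"
  proof (cases "truncated_cost \<delta> w N x a + e \<le> N")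
    case True
    then obtain c where "c < truncated_cost \<delta> w N x a + e" "chain_cost \<delta> w x a c"
      using truncated_cost_chain[of a "truncated_cost \<delta> w N x a + e"] \<open>e > 0\<close> by auto
    then show ?thesis using truncated_cost_le_chain[OF chain_cost.step[OF _ assms]] by fastforce
  next
    case False
    have "0 \<le> w a * dist a b" using w by simp
    then show ?thesis using False truncated_cost_le[of b] by linarith
  qed
qed

lemma truncated_cost_local_Lipschitz:
  assumes "dist a b < \<delta>"
  shows "\<bar>truncated_cost \<delta> w N x a - truncated_cost \<delta> w N x b\<bar> \<le> max (w a) (w b) * dist a b"
proof -
  have "w a * dist a b \<le> max (w a) (w b) * dist a b" "w b * dist a b \<le> max (w a) (w b) * dist a b"
    by (auto intro: mult_right_mono)
  then show ?thesis
    using truncated_cost_step[OF assms] truncated_cost_step[of b a] assms by (simp add: dist_commute abs_le_iff)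
qed

lemma truncated_cost_Lipschitz:
  assumes "\<delta> > 0" "\<And>a. w a \<le> W"
  shows "(max W (N / \<delta>))-lipschitz_on UNIV (truncated_cost \<delta> w N x)"
proof (rule lipschitz_onI)
  show "0 \<le> max W (N / \<delta>)" using N \<open>\<delta> > 0\<close> by (simp add: le_max_iff_disj)
  fix a b
  show "dist (truncated_cost \<delta> w N x a) (truncated_cost \<delta> w N x b) \<le> max W (N / \<delta>) * dist a b"
  proof (cases "dist a b < \<delta>")
    case True
    have "max (w a) (w b) * dist a b \<le> max W (N / \<delta>) * dist a b"
      using assms(2)[of a] assms(2)[of b] by (intro mult_right_mono) auto
    then show ?thesis using truncated_cost_local_Lipschitz[OF True] by (simp add: dist_real_def)
  next
    case False
    have "\<bar>truncated_cost \<delta> w N x a - truncated_cost \<delta> w N x b\<bar> \<le> N"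
      using truncated_cost_le[of a] truncated_cost_le[of b] truncated_cost_nonneg[of a] truncated_cost_nonneg[of b]
      by (simp add: abs_le_iff)
    also have "N = N / \<delta> * \<delta>" using \<open>\<delta> > 0\<close> by simp
    also have "\<dots> \<le> max W (N / \<delta>) * dist a b"
      using False N \<open>\<delta> > 0\<close> by (intro mult_mono) (auto simp: le_max_iff_disj)
    finally show ?thesis by (simp add: dist_real_def)
  qed
qed

end

section \<open>The pointwise Lipschitz constant\<close>

lemma pred_ball[measurable]: "Measurable.pred borel (\<lambda>v. v \<in> ball x r)"
  using borel_open[OF open_ball, of x r] by (simp add: pred_def ball_def)

lemma member_le_suminf: "f k \<le> (\<Sum>k. f k)" for f :: "nat \<Rightarrow> ennreal"
  using sum_le_suminf[of f "{k}"] by simp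

text \<open>
  Difference quotients at a fixed scale.  They decrease to \<open>lip\<close> as the scale tends to \<open>0\<close>.
\<close>
definition slope :: "('a::metric_space \<Rightarrow> real) \<Rightarrow> real \<Rightarrow> 'a \<Rightarrow> ennreal" where
  "slope u r z = (SUP v\<in>{v. v \<noteq> z \<and> dist v z < r}. ennreal (\<bar>u v - u z\<bar> / dist v z))"

lemma slope_mono: "r \<le> s \<Longrightarrow> slope u r z \<le> slope u s z"
  unfolding slope_def by (intro SUP_subset_mono) auto

lemma lip_eq_INF_slope: "lip u z = (INF n. slope u (1 / real (Suc n)) z)"
proof -
  have "lip u z = (INF e\<in>{0<..}. SUP v\<in>ball z e - {z}. ennreal (\<bar>u v - u z\<bar> / dist v z))"
    unfolding lip_def by (rule Limsup_at)
  also have "\<dots> = (INF e\<in>{0<..}. slope u e z)"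
    unfolding slope_def by (intro INF_cong refl SUP_cong) (auto simp: dist_commute)
  also have "\<dots> = (INF n. slope u (1 / real (Suc n)) z)"
  proof (intro antisym INF_greatest)
    fix n :: nat show "(INF e\<in>{0<..}. slope u e z) \<le> slope u (1 / real (Suc n)) z"
      by (intro INF_lower) auto
  next
    fix e :: real assume "e \<in> {0<..}"
    then obtain n where "1 / real (Suc n) < e" using nat_approx_posE[of e] by auto
    then have "slope u (1 / real (Suc n)) z \<le> slope u e z" by (intro slope_mono) simp
    then show "(INF n. slope u (1 / real (Suc n)) z) \<le> slope u e z"
      by (rule INF_lower2[rotated]) simp
  qed
  finally show ?thesis .
qed

lemma slope_le:
  assumes "\<And>v. dist v z < r \<Longrightarrow> \<bar>u v - u z\<bar> \<le> c * dist v z" 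
  shows "slope u r z \<le> ennreal c"
  unfolding slope_def
proof (intro SUP_least)
  fix v assume "v \<in> {v. v \<noteq> z \<and> dist v z < r}"
  then have "\<bar>u v - u z\<bar> / dist v z \<le> c" using assms[of v] by (simp add: pos_divide_le_eq)
  then show "ennreal (\<bar>u v - u z\<bar> / dist v z) \<le> ennreal c" by (rule ennreal_leI)
qed

lemma lip_le_local:
  assumes "r > 0" "\<And>v. dist v z < r \<Longrightarrow> \<bar>u v - u z\<bar> \<le> c * dist v z"
  shows "lip u z \<le> ennreal c"
proof -
  obtain n where n: "1 / real (Suc n) < r" using nat_approx_posE[OF \<open>r > 0\<close>] by blast
  have "slope u (1 / real (Suc n)) z \<le> ennreal c" using n assms(2) by (intro slope_le) auto
  then show ?thesis unfolding lip_eq_INF_slope by (rule INF_lower2[rotated]) simp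
qed

text \<open>
  The set where the slope exceeds a given value is open, as a union over the second point \<open>v\<close>.
\<close>
lemma borel_measurable_slope:
  assumes "continuous_on UNIV u"
  shows "slope u r \<in> borel_measurable borel"
proof (rule borel_measurableI_greater)
  fix y :: ennreal
  show "{z \<in> space borel. y < slope u r z} \<in> sets borel"
  proof (cases y)
    case top
    then show ?thesis by simp
  next
    case (real a)
    have "{z \<in> space borel. y < slope u r z} = (\<Union>v. {z. 0 < dist v z \<and> dist v z < r \<and> a * dist v z < \<bar>u v - u z\<bar>})"
      using real by (auto simp: slope_def less_SUP_iff ennreal_less_iff pos_less_divide_eq dist_commute)
    also have "\<dots> \<in> sets borel"
      using assms by (intro borel_open open_UN ballI open_Collect_conj open_Collect_less continuous_intros) auto
    finally show ?thesis .
  qed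
qed

lemma borel_measurable_lip:
  assumes "K-lipschitz_on UNIV u"
  shows "lip u \<in> borel_measurable borel"
proof -
  have "slope u r \<in> borel_measurable borel" for r
    by (rule borel_measurable_slope) (rule lipschitz_on_continuous_on[OF assms])
  then have [measurable]: "(\<lambda>z. slope u r z) \<in> borel_measurable borel" for r by simp
  show ?thesis unfolding lip_eq_INF_slope[abs_def] by measurable
qed

section \<open>Doubling measures and the Riesz kernel\<close>

locale doubling_space =
  fixes M :: "'a::polish_space measure" and D :: real
  assumes sets_M[measurable_cong, simp]: "sets M = sets borel"
    and finite_bounded: "\<And>A. A \<in> sets borel \<Longrightarrow> bounded A \<Longrightarrow> emeasure M A < \<infinity>"
    and nonzero: "emeasure M UNIV \<noteq> 0"
    and D1: "1 \<le> D"
    and doubling: "\<And>z r. 0 < r \<Longrightarrow> emeasure M (ball z (2 * r)) \<le> ennreal D * emeasure M (ball z r)"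
begin

lemma space_M[simp]: "space M = UNIV"
  using sets_eq_imp_space_eq[OF sets_M] by simp

definition vol :: "'a \<Rightarrow> real \<Rightarrow> real" where "vol z r = measure M (ball z r)"

lemma emeasure_ball: "emeasure M (ball z r) = ennreal (vol z r)"
  unfolding vol_def using finite_bounded[of "ball z r"] by (simp add: emeasure_eq_ennreal_measure less_top)

lemma vol_nonneg[simp]: "0 \<le> vol z r" by (simp add: vol_def)

lemma vol_doubling: "0 < r \<Longrightarrow> vol z (2 * r) \<le> D * vol z r"
  using doubling[of r z] D1 by (simp add: emeasure_ball ennreal_mult[symmetric])

lemma vol_doubling_power: "0 < r \<Longrightarrow> vol z (2 ^ k * r) \<le> D ^ k * vol z r"
proof (induction k)
  case (Suc k)
  have "vol z (2 ^ Suc k * r) \<le> D * vol z (2 ^ k * r)"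
    using vol_doubling[of "2 ^ k * r" z] Suc.prems by (simp add: mult.assoc)
  also have "\<dots> \<le> D * (D ^ k * vol z r)" using Suc D1 by (intro mult_left_mono) auto
  finally show ?case by (simp add: mult.assoc)
qed simp

lemma vol_mono: "dist a b + r \<le> R \<Longrightarrow> vol a r \<le> vol b R"
proof -
  assume *: "dist a b + r \<le> R"
  have "ball a r \<subseteq> ball b R"
  proof
    fix v assume "v \<in> ball a r"
    then show "v \<in> ball b R" using * dist_triangle[of b v a] by (simp add: dist_commute)
  qed
  then have "emeasure M (ball a r) \<le> emeasure M (ball b R)" by (intro emeasure_mono) auto
  then show ?thesis by (simp add: emeasure_ball)
qed

text \<open>
  If one ball were null, doubling would make all concentric balls null, and they exhaust the space.
\<close>
lemma vol_pos:
  assumes "0 < r" shows "0 < vol z r"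
proof (rule ccontr)
  assume "\<not> 0 < vol z r"
  then have 0: "vol z r = 0" using vol_nonneg[of z r] by linarith
  have "emeasure M (ball z (2 ^ k * r)) = 0" for k
    using vol_doubling_power[OF assms, of z k] 0 vol_nonneg[of z "2 ^ k * r"] by (simp add: emeasure_ball)
  then have "(\<Union>k. ball z (2 ^ k * r)) \<in> null_sets M" by (intro null_sets_UN null_setsI) auto
  moreover have "(\<Union>k. ball z (2 ^ k * r)) = UNIV"
  proof -
    have "\<exists>k. v \<in> ball z (2 ^ k * r)" for v
    proof -
      obtain k where "dist z v / r < 2 ^ k" using real_arch_pow[of 2 "dist z v / r"] by auto
      then show ?thesis using assms by (auto simp: pos_divide_less_eq intro!: exI[of _ k])
    qed
    then show ?thesis by blast
  qed
  ultimately show False using nonzero by (simp add: null_sets_def)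
qed

text \<open>
  The form in which doubling is used below to compare balls with different centres.
\<close>
lemma vol_comparable:
  obtains Q where "1 \<le> Q" "\<And>a b R r. 0 < r \<Longrightarrow> dist a b + R \<le> F * r \<Longrightarrow> vol a R \<le> Q * vol b r"
proof -
  obtain k where k: "F < 2 ^ k" using real_arch_pow[of 2 F] by auto
  show thesis
  proof
    show "1 \<le> D ^ k" using D1 by simp
    fix a b :: 'a and R r :: real assume "0 < r" "dist a b + R \<le> F * r"
    then have "dist a b + R \<le> 2 ^ k * r" using k by (meson less_imp_le mult_right_mono order_trans)
    then have "vol a R \<le> vol b (2 ^ k * r)" by (rule vol_mono)
    also have "\<dots> \<le> D ^ k * vol b r" using \<open>0 < r\<close> by (rule vol_doubling_power)
    finally show "vol a R \<le> D ^ k * vol b r" .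
  qed
qed

text \<open>
  Points in a ball with mutual distance at least \<open>\<epsilon>\<close> are centres of disjoint balls of radius \<open>\<epsilon> / 2\<close>, each with a
  fixed share of the measure of one large ball; so there are boundedly many, and a
  largest such set is an \<open>\<epsilon>\<close>-net.
\<close>
lemma compact_cball: "compact (cball x r :: 'a set)"
  unfolding compact_eq_totally_bounded
proof (intro conjI allI impI)
  show "complete (cball x r)" by (simp add: complete_eq_closed)
  fix \<epsilon> :: real assume "\<epsilon> > 0"
  define sep where "sep T \<longleftrightarrow> finite T \<and> T \<subseteq> cball x r \<and> (\<forall>a\<in>T. \<forall>b\<in>T. a \<noteq> b \<longrightarrow> \<epsilon> \<le> dist a b)" for T
  show "\<exists>k. finite k \<and> cball x r \<subseteq> (\<Union>x\<in>k. ball x \<epsilon>)"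
  proof (cases "r \<ge> 0")
    case False
    then show ?thesis by (intro exI[of _ "{}"]) auto
  next
    case True
    define R where "R = r + \<epsilon>"
    obtain Q where Q: "1 \<le> Q" "\<And>a b R' r'. 0 < r' \<Longrightarrow> dist a b + R' \<le> ((2 * r + \<epsilon>) * 2 / \<epsilon>) * r' \<Longrightarrow> vol a R' \<le> Q * vol b r'"
      using vol_comparable by blast
    have card: "real (card T) \<le> Q" if T: "sep T" for T
    proof -
      have fin: "finite T" using T by (simp add: sep_def)
      have lower: "vol x R \<le> Q * vol a (\<epsilon> / 2)" if "a \<in> T" for a
      proof (rule Q(2))
        have "dist x a \<le> r" using T that by (auto simp: sep_def)
        then show "dist x a + R \<le> (2 * r + \<epsilon>) * 2 / \<epsilon> * (\<epsilon> / 2)" using \<open>\<epsilon> > 0\<close> by (simp add: R_def)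
      qed (use \<open>\<epsilon> > 0\<close> in simp)
      have dis: "disjoint_family_on (\<lambda>a. ball a (\<epsilon> / 2)) T"
        unfolding disjoint_family_on_def
      proof (intro ballI impI)
        fix a b assume ab: "a \<in> T" "b \<in> T" "a \<noteq> b"
        then have "\<epsilon> \<le> dist a b" using T by (auto simp: sep_def)
        show "ball a (\<epsilon> / 2) \<inter> ball b (\<epsilon> / 2) = {}"
        proof (rule ccontr)
          assume "ball a (\<epsilon> / 2) \<inter> ball b (\<epsilon> / 2) \<noteq> {}"
          then obtain v where "dist a v < \<epsilon> / 2" "dist b v < \<epsilon> / 2" by auto
          then show False using \<open>\<epsilon> \<le> dist a b\<close> dist_triangle[of a b v] by (simp add: dist_commute)
        qed
      qed
      have "(\<Sum>a\<in>T. emeasure M (ball a (\<epsilon> / 2))) = emeasure M (\<Union>a\<in>T. ball a (\<epsilon> / 2))"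
        using fin dis by (intro sum_emeasure) auto
      also have "\<dots> \<le> emeasure M (ball x R)"
      proof (intro emeasure_mono)
        show "(\<Union>a\<in>T. ball a (\<epsilon> / 2)) \<subseteq> ball x R"
        proof
          fix v assume "v \<in> (\<Union>a\<in>T. ball a (\<epsilon> / 2))"
          then obtain a where "a \<in> T" "dist a v < \<epsilon> / 2" by auto
          moreover then have "dist x a \<le> r" using T by (auto simp: sep_def)
          ultimately show "v \<in> ball x R" using dist_triangle[of x v a] \<open>\<epsilon> > 0\<close> by (simp add: R_def)
        qed
      qed simp
      finally have le: "(\<Sum>a\<in>T. vol a (\<epsilon> / 2)) \<le> vol x R"
        using ennreal_le_iff[OF vol_nonneg] by (simp only: emeasure_ball) (simp only: sum_ennreal vol_nonneg)
      have "real (card T) * vol x R = (\<Sum>a\<in>T. vol x R)" by simp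
      also have "\<dots> \<le> (\<Sum>a\<in>T. Q * vol a (\<epsilon> / 2))" using lower by (intro sum_mono)
      also have "\<dots> \<le> Q * vol x R" using le Q(1) by (simp add: sum_distrib_left[symmetric])
      finally show ?thesis using vol_pos[of R x] True \<open>\<epsilon> > 0\<close> by (simp add: R_def)
    qed
    have "sep {}" by (simp add: sep_def)
    moreover have "\<forall>T. sep T \<longrightarrow> card T < nat \<lceil>Q\<rceil> + 1"
      using card by (metis less_add_one of_nat_le_iff order_trans real_nat_ceiling_ge le_imp_less_Suc Suc_eq_plus1)
    ultimately obtain T where T: "sep T" "\<And>T'. sep T' \<Longrightarrow> card T' \<le> card T"
      using ex_has_greatest_nat[of sep "{}" card "nat \<lceil>Q\<rceil> + 1"] by metis
    have "cball x r \<subseteq> (\<Union>a\<in>T. ball a \<epsilon>)"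
    proof
      fix v assume v: "v \<in> cball x r"
      show "v \<in> (\<Union>a\<in>T. ball a \<epsilon>)"
      proof (rule ccontr)
        assume "v \<notin> (\<Union>a\<in>T. ball a \<epsilon>)"
        then have far: "\<epsilon> \<le> dist a v" if "a \<in> T" for a using that by auto
        then have "sep (insert v T)" using T(1) v by (auto simp: sep_def dist_commute)
        moreover have "v \<notin> T" using far[of v] \<open>\<epsilon> > 0\<close> by auto
        ultimately show False using T(2)[of "insert v T"] T(1) by (simp add: sep_def)
      qed
    qed
    then show ?thesis using T(1) by (auto simp: sep_def)
  qed
qed

lemma sigma_finite_M: "sigma_finite_measure M"
proof
  show "\<exists>A. countable A \<and> A \<subseteq> sets M \<and> \<Union> A = space M \<and> (\<forall>a\<in>A. emeasure M a \<noteq> \<infinity>)"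
  proof (intro exI[of _ "range (\<lambda>n. ball undefined (real n))"] conjI ballI)
    have "\<exists>n. v \<in> ball undefined (real n)" for v :: 'a
      using reals_Archimedean2[of "dist undefined v"] by auto
    then show "\<Union> (range (\<lambda>n. ball undefined (real n))) = space M" by auto
  qed (auto simp: emeasure_ball)
qed

abbreviation avg :: "('a \<Rightarrow> real) \<Rightarrow> 'a \<Rightarrow> real \<Rightarrow> real" where
  "avg u z r \<equiv> average M (ball z r) u"

text \<open>
  The part of the Riesz kernel with pole \<open>x\<close>.  It vanishes at \<open>x\<close> because \<open>0 / 0 = 0\<close>.
\<close>
definition riesz :: "'a \<Rightarrow> 'a \<Rightarrow> ennreal" where
  "riesz x z = ennreal (dist x z) / emeasure M (ball x (dist x z))"

text \<open>
  The volume of the ball is the integral over \<open>v\<close> of the indicator of an open condition on the three points.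
\<close>
lemma borel_measurable_riesz_pair: "(\<lambda>p. riesz (fst p) (snd p)) \<in> borel_measurable (borel \<Otimes>\<^sub>M borel)"
proof -
  interpret sigma_finite_measure M by (rule sigma_finite_M)
  have "(\<lambda>p. \<integral>\<^sup>+v. indicator {q. dist (fst (fst q)) (snd q) < dist (fst (fst q)) (snd (fst q))} (p, v) \<partial>M)
      \<in> borel_measurable (borel \<Otimes>\<^sub>M borel :: ('a \<times> 'a) measure)"
    by (intro borel_measurable_nn_integral) (simp add: split_beta', measurable)
  also have "(\<lambda>p. \<integral>\<^sup>+v. indicator {q. dist (fst (fst q)) (snd q) < dist (fst (fst q)) (snd (fst q))} (p, v) \<partial>M)
      = (\<lambda>p::'a\<times>'a. emeasure M (ball (fst p) (dist (fst p) (snd p))))"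
  proof
    fix p :: "'a \<times> 'a"
    have "(\<integral>\<^sup>+v. indicator {q. dist (fst (fst q)) (snd q) < dist (fst (fst q)) (snd (fst q))} (p, v) \<partial>M)
       = (\<integral>\<^sup>+v. indicator (ball (fst p) (dist (fst p) (snd p))) v \<partial>M)"
      by (intro nn_integral_cong) (auto split: split_indicator)
    then show "(\<integral>\<^sup>+v. indicator {q. dist (fst (fst q)) (snd q) < dist (fst (fst q)) (snd (fst q))} (p, v) \<partial>M)
       = emeasure M (ball (fst p) (dist (fst p) (snd p)))" by simp
  qed
  finally have [measurable]: "(\<lambda>p::'a\<times>'a. emeasure M (ball (fst p) (dist (fst p) (snd p)))) \<in> borel_measurable (borel \<Otimes>\<^sub>M borel)" .
  show ?thesis unfolding riesz_def by measurable
qed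

lemma borel_measurable_riesz[measurable]: "riesz x \<in> borel_measurable borel"
  using measurable_compose[OF measurable_Pair1' borel_measurable_riesz_pair, of x] by simp

abbreviation potential :: "('a \<Rightarrow> real) \<Rightarrow> 'a \<Rightarrow> 'a \<Rightarrow> 'a set \<Rightarrow> ennreal" where
  "potential u x y S \<equiv> \<integral>\<^sup>+w\<in>S. lip u w * (riesz x w + riesz y w) \<partial>M"

lemma riesz_eq: "x \<noteq> z \<Longrightarrow> riesz x z = ennreal (dist x z / vol x (dist x z))"
  unfolding riesz_def emeasure_ball using vol_pos[of "dist x z" x] by (simp add: divide_ennreal)

lemma riesz_self[simp]: "riesz x x = 0"
  unfolding riesz_def by simp

text \<open>
  On the dyadic annulus of outer radius \<open>R / 2 ^ k\<close> the kernel is at most \<open>D * R / 2 ^ k\<close> divided by the volume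
  of the ball with that radius, so the annuli contribute a geometric series.
\<close>
lemma riesz_integral_ball_le:
  assumes "0 < R"
  shows "(\<integral>\<^sup>+z\<in>ball x R. riesz x z \<partial>M) \<le> ennreal (2 * D * R)"
proof -
  define r where "r k = R / 2 ^ k" for k :: nat
  have r: "0 < r k" "2 * r (Suc k) = r k" for k using assms by (auto simp: r_def)
  have "(\<integral>\<^sup>+z\<in>ball x R. riesz x z \<partial>M)
     \<le> (\<integral>\<^sup>+z. (\<Sum>k. ennreal (r k / vol x (r (Suc k))) * indicator (ball x (r k)) z) \<partial>M)"
  proof (intro nn_integral_mono)
    fix z
    show "riesz x z * indicator (ball x R) z \<le> (\<Sum>k. ennreal (r k / vol x (r (Suc k))) * indicator (ball x (r k)) z)"
    proof (cases "z \<in> ball x R \<and> z \<noteq> x")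
      case True
      then have d: "0 < dist x z" "dist x z < R" by auto
      have ex: "\<exists>k. r (Suc k) \<le> dist x z"
      proof -
        obtain k where k: "R / dist x z < 2 ^ k" using real_arch_pow[of 2 "R / dist x z"] by auto
        then have "R / 2 ^ k < dist x z" using d by (simp add: field_simps)
        moreover have "r (Suc k) \<le> r k" using r[of k] r(1)[of "Suc k"] by linarith
        ultimately show ?thesis by (intro exI[of _ k]) (simp add: r_def)
      qed
      define k where "k = (LEAST k. r (Suc k) \<le> dist x z)"
      have k1: "r (Suc k) \<le> dist x z" unfolding k_def using ex by (rule LeastI_ex)
      have k2: "dist x z < r k"
      proof (cases k)
        case 0 then show ?thesis using d by (simp add: r_def)
      next
        case (Suc j)
        then have "\<not> r (Suc j) \<le> dist x z" unfolding k_def using not_less_Least[of j] by (metis lessI k_def)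
        then show ?thesis using Suc by simp
      qed
      have "dist x z / vol x (dist x z) \<le> r k / vol x (r (Suc k))"
        using k1 k2 d r vol_pos[OF r(1)] by (intro frac_le vol_mono) (auto simp: less_imp_le)
      then have "riesz x z * indicator (ball x R) z \<le> ennreal (r k / vol x (r (Suc k))) * indicator (ball x (r k)) z"
        using True k2 by (auto simp: riesz_eq intro: ennreal_leI)
      also have "\<dots> \<le> (\<Sum>k. ennreal (r k / vol x (r (Suc k))) * indicator (ball x (r k)) z)"
        by (rule member_le_suminf)
      finally show ?thesis .
    qed auto
  qed
  also have "\<dots> = (\<Sum>k. ennreal (r k / vol x (r (Suc k))) * ennreal (vol x (r k)))"
    by (subst nn_integral_suminf, measurable) (simp add: nn_integral_cmult_indicator emeasure_ball)
  also have "\<dots> \<le> (\<Sum>k. ennreal (D * R * (1/2) ^ k))"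
  proof (intro suminf_le)
    fix k
    have "vol x (r k) \<le> D * vol x (r (Suc k))" using vol_doubling[OF r(1), of x "Suc k"] r(2) by simp
    then have "r k / vol x (r (Suc k)) * vol x (r k) \<le> r k / vol x (r (Suc k)) * (D * vol x (r (Suc k)))"
      using r(1)[of k] by (intro mult_left_mono) (auto simp: less_imp_le)
    also have "\<dots> = D * r k" using vol_pos[OF r(1), of x "Suc k"] by simp
    also have "\<dots> = D * R * (1/2) ^ k" by (simp add: r_def power_one_over)
    finally show "ennreal (r k / vol x (r (Suc k))) * ennreal (vol x (r k)) \<le> ennreal (D * R * (1/2) ^ k)"
      using r(1)[of k] by (simp add: ennreal_mult[symmetric] ennreal_leI less_imp_le)
  qed auto
  also have "\<dots> = ennreal (\<Sum>k. D * R * (1/2) ^ k)"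
    using D1 assms by (intro suminf_ennreal2 summable_mult summable_geometric) auto
  also have "(\<Sum>k. D * R * (1/2) ^ k) = 2 * D * R"
    by (subst suminf_mult) (auto simp: suminf_geometric)
  finally show ?thesis .
qed

text \<open>
  An atom is isolated: otherwise there are points \<open>y\<close> arbitrarily close to \<open>x\<close>, and by doubling the balls
  around them with radius \<open>dist x y\<close>, which miss \<open>x\<close>, have measure bounded below, whereas punctured balls around
  \<open>x\<close> have measure tending to \<open>0\<close>.
\<close>
lemma lip_eq_0_if_atom:
  assumes "emeasure M {x} \<noteq> 0"
  shows "lip u x = 0"
proof -
  have fin: "emeasure M {x} < \<infinity>" by (intro finite_bounded) auto
  define m where "m = measure M {x}"
  have m: "emeasure M {x} = ennreal m" unfolding m_def using fin by (simp add: emeasure_eq_ennreal_measure less_top)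
  have "m > 0" using assms m by (auto simp: m_def zero_less_measure_iff)
  have "\<exists>r>0. ball x r = {x}"
  proof (rule ccontr)
    assume "\<not> ?thesis"
    then have ni: "\<exists>y. y \<noteq> x \<and> dist x y < r" if "r > 0" for r using that centre_in_ball[of x r] by (auto simp: set_eq_iff)
    obtain Q where Q: "1 \<le> Q" "\<And>a b R r. 0 < r \<Longrightarrow> dist a b + R \<le> 3 * r \<Longrightarrow> vol a R \<le> Q * vol b r"
      using vol_comparable by blast
    have "(\<Inter>n. ball x (1 / Suc n) - {x}) = {}"
    proof -
      have "\<exists>n. v \<notin> ball x (1 / Suc n) - {x}" for v
      proof (cases "v = x")
        case False
        then obtain n where "1 / real (Suc n) < dist x v" using nat_approx_posE[of "dist x v"] by auto
        then show ?thesis by (intro exI[of _ n]) auto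
      qed auto
      then show ?thesis by blast
    qed
    moreover have "(\<lambda>n. emeasure M (ball x (1 / Suc n) - {x})) \<longlonglongrightarrow> emeasure M (\<Inter>n. ball x (1 / Suc n) - {x})"
    proof (rule Lim_emeasure_decseq)
      show "decseq (\<lambda>n. ball x (1 / Suc n) - {x})"
        by (intro decseq_SucI Diff_mono subset_ball) (auto simp: frac_le)
      fix n show "emeasure M (ball x (1 / real (Suc n)) - {x}) \<noteq> \<infinity>"
        using finite_bounded[of "ball x (1 / real (Suc n)) - {x}"] by (simp add: bounded_diff)
    qed auto
    ultimately have "(\<lambda>n. emeasure M (ball x (1 / Suc n) - {x})) \<longlonglongrightarrow> 0" by (simp only: emeasure_empty)
    moreover have "0 < ennreal (m / Q)" using \<open>m > 0\<close> Q(1) by simp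
    ultimately have "\<forall>\<^sub>F n in sequentially. emeasure M (ball x (1 / Suc n) - {x}) < ennreal (m / Q)"
      by (rule order_tendstoD)
    then obtain n where n: "emeasure M (ball x (1 / Suc n) - {x}) < ennreal (m / Q)"
      by (auto simp: eventually_sequentially)
    obtain y where y: "y \<noteq> x" "dist x y < 1 / Suc n / 2" using ni[of "1 / Suc n / 2"] by auto
    have "m \<le> vol x (dist x y)"
    proof -
      have "emeasure M {x} \<le> emeasure M (ball x (dist x y))" using y by (intro emeasure_mono) auto
      then show ?thesis using m by (simp add: emeasure_ball m_def)
    qed
    also have "\<dots> \<le> Q * vol y (dist x y)" using y by (intro Q(2)) auto
    finally have "m / Q \<le> vol y (dist x y)" using Q(1) by (simp add: field_simps)
    moreover have "ball y (dist x y) \<subseteq> ball x (1 / Suc n) - {x}"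
    proof
      fix v assume "v \<in> ball y (dist x y)"
      then have "dist y v < dist x y" by simp
      moreover have "2 * dist x y < 1 / Suc n" using y(2) by (simp add: field_simps)
      ultimately show "v \<in> ball x (1 / Suc n) - {x}"
        using dist_triangle[of x v y] by (simp only: Diff_iff mem_ball singleton_iff) (auto simp: dist_commute)
    qed
    then have "emeasure M (ball y (dist x y)) \<le> emeasure M (ball x (1 / Suc n) - {x})" by (intro emeasure_mono) auto
    then have "ennreal (vol y (dist x y)) < ennreal (m / Q)" using n by (simp add: emeasure_ball)
    ultimately show False by (simp add: ennreal_less_iff)
  qed
  then obtain r where "r > 0" "ball x r = {x}" by blast
  then have "lip u x \<le> ennreal 0"
    by (intro lip_le_local[of r]) (auto simp: set_eq_iff dist_commute)
  then show ?thesis by simp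
qed

lemma borel_measurable_riesz_kernel[measurable]: "riesz_kernel M x y \<in> borel_measurable borel"
proof -
  have "riesz_kernel M x y = (\<lambda>z. if z \<in> {x, y} then 0 else riesz x z + riesz y z)"
    by (auto simp: riesz_kernel_def riesz_def fun_eq_iff)
  also have "\<dots> \<in> borel_measurable borel" by measurable
  finally show ?thesis .
qed

lemma riesz_kernel_le: "riesz_kernel M x y z \<le> riesz x z + riesz y z"
  by (auto simp: riesz_kernel_def riesz_def)

lemma sets_riesz_measure[simp, measurable_cong]: "sets (riesz_measure M L x y) = sets borel"
  by (simp add: riesz_measure_def)

lemma riesz_ball_sets[measurable]: "riesz_ball L x y \<in> sets borel"
  by (simp add: riesz_ball_def)

lemma nn_integral_riesz_measure:
  assumes [measurable]: "f \<in> borel_measurable borel"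
  shows "(\<integral>\<^sup>+z. f z \<partial>riesz_measure M L x y) = (\<integral>\<^sup>+z\<in>riesz_ball L x y. f z * riesz_kernel M x y z \<partial>M)"
  unfolding riesz_measure_def
  by (subst nn_integral_density) (auto intro!: nn_integral_cong simp: mult_ac)

lemma riesz_measure_le:
  assumes "f \<in> borel_measurable borel"
  shows "(\<integral>\<^sup>+z. f z \<partial>riesz_measure M L x y) \<le> (\<integral>\<^sup>+z\<in>riesz_ball L x y. f z * (riesz x z + riesz y z) \<partial>M)"
  unfolding nn_integral_riesz_measure[OF assms]
  by (intro nn_integral_mono mult_right_mono mult_left_mono riesz_kernel_le) auto

text \<open>
  The convention that the Riesz kernel vanishes at both poles does not change the integral of \<open>lip u\<close>: a pole is
  a null set, or it is isolated and \<open>lip u\<close> vanishes there.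
\<close>
lemma nn_integral_lip_riesz_measure:
  assumes "K-lipschitz_on UNIV u"
  shows "(\<integral>\<^sup>+z. lip u z \<partial>riesz_measure M L x y) = potential u x y (riesz_ball L x y)"
proof -
  have [measurable]: "lip u \<in> borel_measurable borel" by (rule borel_measurable_lip[OF assms])
  have ae: "AE z in M. z = v \<longrightarrow> lip u z = 0" for v
  proof (cases "emeasure M {v} = 0")
    case True
    then have "AE z in M. z \<notin> {v}" by (intro AE_not_in null_setsI) auto
    then show ?thesis by eventually_elim auto
  qed (simp add: lip_eq_0_if_atom)
  show ?thesis
    unfolding nn_integral_riesz_measure[OF borel_measurable_lip[OF assms]]
  proof (intro nn_integral_cong_AE)
    show "AE z in M. lip u z * riesz_kernel M x y z * indicator (riesz_ball L x y) z =
      lip u z * (riesz x z + riesz y z) * indicator (riesz_ball L x y) z"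
      using ae[of x] ae[of y] by eventually_elim (auto simp: riesz_kernel_def riesz_def)
  qed
qed

lemma finite_riesz_measure: "emeasure (riesz_measure M L x y) UNIV < \<infinity>"
proof -
  define R where "R = 2 * \<bar>L\<bar> * dist x y + dist x y + 1"
  have "R > 0" by (simp add: R_def add_nonneg_pos)
  have s: "riesz_ball L x y \<subseteq> ball x R" "riesz_ball L x y \<subseteq> ball y R"
  proof -
    have L: "2 * L * dist x y \<le> 2 * \<bar>L\<bar> * dist x y" by (intro mult_right_mono) auto
    show "riesz_ball L x y \<subseteq> ball x R"
    proof
      fix v assume "v \<in> riesz_ball L x y"
      then show "v \<in> ball x R" using L dist_triangle[of x v y]
        zero_le_dist[of x y] unfolding R_def riesz_ball_def Un_iff mem_ball by linarith
    qed
    show "riesz_ball L x y \<subseteq> ball y R"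
    proof
      fix v assume "v \<in> riesz_ball L x y"
      then show "v \<in> ball y R" using L dist_triangle[of y v x]
        zero_le_dist[of x y] dist_commute[of y x] unfolding R_def riesz_ball_def Un_iff mem_ball by linarith
    qed
  qed
  have "emeasure (riesz_measure M L x y) UNIV = (\<integral>\<^sup>+z. 1 \<partial>riesz_measure M L x y)"
    by (simp add: riesz_measure_def)
  also have "\<dots> \<le> (\<integral>\<^sup>+z\<in>riesz_ball L x y. 1 * (riesz x z + riesz y z) \<partial>M)" by (rule riesz_measure_le) simp
  also have "\<dots> \<le> (\<integral>\<^sup>+z. riesz x z * indicator (ball x R) z + riesz y z * indicator (ball y R) z \<partial>M)"
    using s by (intro nn_integral_mono) (auto split: split_indicator)
  also have "\<dots> = (\<integral>\<^sup>+z\<in>ball x R. riesz x z \<partial>M) + (\<integral>\<^sup>+z\<in>ball y R. riesz y z \<partial>M)"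
    by (intro nn_integral_add) measurable
  also have "\<dots> \<le> ennreal (2 * D * R) + ennreal (2 * D * R)"
    using \<open>R > 0\<close> by (intro add_mono riesz_integral_ball_le)
  also have "\<dots> < \<infinity>" by simp
  finally show ?thesis .
qed

end

section \<open>From the width bound to the Riesz estimate\<close>

lemma compact_preimage_Icc:
  fixes f :: "real \<Rightarrow> 'b::topological_space"
  assumes "continuous_on {a..b} f" "closed C"
  shows "compact {s \<in> {a..b}. f s \<in> C}"
proof -
  have "closed ({a..b} \<inter> f -` C)" using assms by (intro continuous_closed_preimage) auto
  then have "compact ({a..b} \<inter> ({a..b} \<inter> f -` C))" by (intro compact_Int_closed) auto
  also have "{a..b} \<inter> ({a..b} \<inter> f -` C) = {s \<in> {a..b}. f s \<in> C}" by auto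
  finally show ?thesis .
qed

text \<open>
  Take the first time at which the distance to \<open>E\<close> is \<open>0\<close> and the last earlier time at which it is at least \<open>r\<close>.
  In between, the curve runs in the collar and covers a distance of at least \<open>r\<close>.
\<close>
lemma curve_crosses_collar:
  fixes x y :: "'a::{metric_space, second_countable_topology}"
  assumes \<gamma>: "\<gamma> \<in> lipschitz_curves x y" and "y \<in> E" and "0 < r" and far: "\<And>v. v \<in> E \<Longrightarrow> r \<le> dist x v"
  shows "ennreal r \<le> curve_length_in \<gamma> {z. z \<notin> E \<and> (\<exists>v\<in>E. dist z v < r)}"
proof -
  let ?A = "{z. z \<notin> E \<and> (\<exists>v\<in>E. dist z v < r)}"
  obtain K where K: "K-lipschitz_on {0..1} \<gamma>" and ends: "\<gamma> 0 = x" "\<gamma> 1 = y"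
    using \<gamma> by (auto simp: lipschitz_curves_def)
  have "E \<noteq> {}" using \<open>y \<in> E\<close> by auto
  define f where "f s = infdist (\<gamma> s) E" for s
  have cont: "continuous_on {0..1} f"
    unfolding f_def by (intro continuous_intros lipschitz_on_continuous_on[OF K])
  have f0: "r \<le> f 0" unfolding f_def ends infdist_notempty[OF \<open>E \<noteq> {}\<close>] using \<open>E \<noteq> {}\<close> far by (intro cINF_greatest)
  have f1: "f 1 = 0" using \<open>y \<in> E\<close> by (simp add: f_def ends)
  have "compact {s \<in> {0..1}. f s \<le> 0}"
    using compact_preimage_Icc[OF cont, of "{..0}"] by simp
  moreover have "1 \<in> {s \<in> {0..1}. f s \<le> 0}" using f1 by simp
  ultimately obtain s1 where s1: "s1 \<in> {0..1}" "f s1 \<le> 0" "\<And>s. s \<in> {0..1} \<Longrightarrow> f s \<le> 0 \<Longrightarrow> s1 \<le> s"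
    using compact_attains_inf[of "{s \<in> {0..1}. f s \<le> 0}"] by blast
  have cont': "continuous_on {0..s1} f" using s1(1) by (intro continuous_on_subset[OF cont]) auto
  have "compact {s \<in> {0..s1}. r \<le> f s}"
    using compact_preimage_Icc[OF cont', of "{r..}"] by simp
  moreover have "0 \<in> {s \<in> {0..s1}. r \<le> f s}" using f0 s1 by simp
  ultimately obtain s0 where s0: "s0 \<in> {0..s1}" "r \<le> f s0" "\<And>s. s \<in> {0..s1} \<Longrightarrow> r \<le> f s \<Longrightarrow> s \<le> s0"
    using compact_attains_sup[of "{s \<in> {0..s1}. r \<le> f s}"] by blast
  have inA: "\<gamma> s \<in> ?A" if "s \<in> {s0<..<s1}" for s
  proof -
    have "0 < f s" using s1(3)[of s] that s0(1) s1(1) by force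
    have "f s < r" using s0(3)[of s] that s0(1) by force
    then have "\<exists>v\<in>E. dist (\<gamma> s) v < r"
      unfolding f_def infdist_notempty[OF \<open>E \<noteq> {}\<close>]
      by (subst (asm) cINF_less_iff) (use \<open>E \<noteq> {}\<close> in \<open>auto intro: bdd_belowI[of _ 0]\<close>)
    moreover have "\<gamma> s \<notin> E" using \<open>0 < f s\<close> by (auto simp: f_def)
    ultimately show ?thesis by simp
  qed
  have "r \<le> \<bar>f s0 - f s1\<bar>" using s0(2) s1(2) by simp
  also have "\<dots> \<le> dist (\<gamma> s0) (\<gamma> s1)" unfolding f_def by (rule infdist_triangle_abs)
  finally have "ennreal r \<le> ennreal (dist (\<gamma> s0) (\<gamma> s1))" by (rule ennreal_leI)
  also have "\<dots> \<le> (\<integral>\<^sup>+t\<in>{s0<..<s1}. ennreal (metric_speed \<gamma> t) \<partial>lborel)"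
    using s0(1) s1(1) by (intro dist_le_integral_metric_speed[OF K]) auto
  also have "\<dots> \<le> curve_length_in \<gamma> ?A"
    unfolding curve_length_in_def
  proof (intro nn_integral_mono)
    fix t show "ennreal (metric_speed \<gamma> t) * indicator {s0<..<s1} t
        \<le> indicator ?A (\<gamma> t) * ennreal (metric_speed \<gamma> t) * indicator {0..1} t"
      using inA[of t] s0(1) s1(1) by (auto split: split_indicator)
  qed
  finally show ?thesis .
qed

lemma lip_uminus: "lip (\<lambda>z. - u z) = lip u"
  unfolding lip_def fun_eq_iff by (simp add: abs_minus_commute)

lemma superlevel_collar_measurable:
  fixes u :: "'a::polish_space \<Rightarrow> real"
  assumes "continuous_on UNIV u"
  shows "{p::real \<times> 'a. u (snd p) \<le> fst p \<and> (\<exists>v. dist (snd p) v < r \<and> fst p < u v)} \<in> sets (borel \<Otimes>\<^sub>M borel)"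
proof -
  have "closed {p::real \<times> 'a. u (snd p) \<le> fst p}"
    using assms by (intro closed_Collect_le continuous_intros continuous_on_compose2[OF assms]) auto
  moreover have "open (\<Union>v. {p::real \<times> 'a. dist (snd p) v < r \<and> fst p < u v})"
    by (intro open_UN ballI open_Collect_conj open_Collect_less continuous_intros)
  ultimately have "{p::real \<times> 'a. u (snd p) \<le> fst p} \<inter> (\<Union>v. {p. dist (snd p) v < r \<and> fst p < u v}) \<in> sets borel"
    by (intro sets.Int borel_closed borel_open)
  also have "{p::real \<times> 'a. u (snd p) \<le> fst p} \<inter> (\<Union>v. {p. dist (snd p) v < r \<and> fst p < u v})
     = {p::real \<times> 'a. u (snd p) \<le> fst p \<and> (\<exists>v. dist (snd p) v < r \<and> fst p < u v)}" by auto
  finally show ?thesis unfolding borel_prod .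
qed

text \<open>
  Integration over the levels \<open>t\<close> of the lower bound \<open>r \<le> C * N (A t)\<close> for the collar \<open>A t\<close>; by Tonelli
  it remains to see for how many levels \<open>z\<close> is in the collar.  Levels within \<open>K * r\<close> of \<open>u x\<close> are omitted
  because for them \<open>x\<close> may be too close to the superlevel set.
\<close>
lemma collar_coarea_estimate:
  fixes u :: "'a::polish_space \<Rightarrow> real"
  assumes N: "sets N = sets borel" "emeasure N UNIV < \<infinity>"
    and width: "\<And>A. A \<in> sets borel \<Longrightarrow> width x y A \<le> ennreal C * emeasure N A"
    and u: "K-lipschitz_on UNIV u" and "0 < r" "0 \<le> C"
  shows "ennreal (u y - u x - K * r) \<le> ennreal C * (\<integral>\<^sup>+z. slope u r z \<partial>N)"
proof -
  note [measurable_cong] = N(1)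
  interpret N: finite_measure N using N sets_eq_imp_space_eq[OF N(1)] by (intro finite_measureI) auto
  interpret P: pair_sigma_finite lborel N by unfold_locales
  have K0: "0 \<le> K" using u by (rule lipschitz_on_nonneg)
  have cont: "continuous_on UNIV u" using u by (rule lipschitz_on_continuous_on)
  have uK: "\<bar>u a - u b\<bar> \<le> K * dist a b" for a b using lipschitz_onD[OF u, of a b] by (simp add: dist_real_def)
  have slope_m[measurable]: "slope u r \<in> borel_measurable borel" by (rule borel_measurable_slope[OF cont])
  define S where "S = {p::real \<times> 'a. u (snd p) \<le> fst p \<and> (\<exists>v. dist (snd p) v < r \<and> fst p < u v)}"
  have S[measurable]: "S \<in> sets (borel \<Otimes>\<^sub>M borel)"
    unfolding S_def by (rule superlevel_collar_measurable[OF cont])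
  define A where "A t = {z. (t, z) \<in> S}" for t
  have A[measurable]: "A t \<in> sets borel" for t
  proof -
    have "Pair t -` S \<in> sets borel" by (rule sets_Pair1[OF S])
    then show ?thesis by (simp add: A_def vimage_def)
  qed
  define T where "T = {u x + K * r..<u y}"
  have key: "ennreal r \<le> ennreal C * emeasure N (A t)" if t: "t \<in> T" for t
  proof -
    have "A t = {z. z \<notin> {v. t < u v} \<and> (\<exists>v\<in>{v. t < u v}. dist z v < r)}" by (auto simp: A_def S_def not_less)
    moreover have "r \<le> dist x v" if "v \<in> {v. t < u v}" for v
    proof -
      have "K * r < \<bar>u v - u x\<bar>" using t that by (auto simp: T_def)
      also have "\<dots> \<le> K * dist x v" using uK[of v x] by (simp add: dist_commute)
      finally show ?thesis using K0 by (meson less_imp_le mult_left_mono not_le)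
    qed
    ultimately have "ennreal r \<le> curve_length_in \<gamma> (A t)" if "\<gamma> \<in> lipschitz_curves x y" for \<gamma>
      using curve_crosses_collar[OF that, of "{v. t < u v}" r] t \<open>0 < r\<close> by (auto simp: T_def)
    then have "ennreal r \<le> width x y (A t)" unfolding width_def by (intro INF_greatest)
    also have "\<dots> \<le> ennreal C * emeasure N (A t)" by (intro width A)
    finally show ?thesis .
  qed
  have "ennreal r * ennreal (u y - u x - K * r) = (\<integral>\<^sup>+t. ennreal r * indicator T t \<partial>lborel)"
    unfolding T_def
    by (subst nn_integral_cmult_indicator)
       (cases "u x + K * r \<le> u y"; simp add: ennreal_neg diff_diff_eq)+
  also have "\<dots> \<le> (\<integral>\<^sup>+t. ennreal C * emeasure N (A t) \<partial>lborel)"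
    using key by (intro nn_integral_mono) (auto split: split_indicator)
  also have "\<dots> = (\<integral>\<^sup>+t. (\<integral>\<^sup>+z. ennreal C * indicator S (t, z) \<partial>N) \<partial>lborel)"
  proof (intro nn_integral_cong)
    fix t :: real
    have "(\<integral>\<^sup>+z. ennreal C * indicator S (t, z) \<partial>N) = (\<integral>\<^sup>+z. ennreal C * indicator (A t) z \<partial>N)"
      by (intro nn_integral_cong) (auto simp: A_def split: split_indicator)
    then show "ennreal C * emeasure N (A t) = (\<integral>\<^sup>+z. ennreal C * indicator S (t, z) \<partial>N)"
      by (simp add: nn_integral_cmult_indicator)
  qed
  also have "\<dots> = (\<integral>\<^sup>+z. (\<integral>\<^sup>+t. ennreal C * indicator S (t, z) \<partial>lborel) \<partial>N)"
    by (intro P.Fubini[symmetric, of "\<lambda>p. ennreal C * indicator S p"]) measurable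
  also have "\<dots> \<le> (\<integral>\<^sup>+z. ennreal r * (ennreal C * slope u r z) \<partial>N)"
  proof (intro nn_integral_mono)
    fix z
    have "slope u r z \<le> ennreal K" using uK by (intro slope_le) auto
    then obtain \<sigma> where \<sigma>: "slope u r z = ennreal \<sigma>" "0 \<le> \<sigma>"
      by (metis ennreal_cases ennreal_less_top leD)
    have "indicator S (t, z) \<le> (indicator {u z..u z + \<sigma> * r} t :: ennreal)" for t
    proof (cases "(t, z) \<in> S")
      case True
      then obtain v where v: "u z \<le> t" "dist z v < r" "t < u v" by (auto simp: S_def)
      then have "v \<noteq> z" by auto
      then have "ennreal (\<bar>u v - u z\<bar> / dist v z) \<le> slope u r z"
        unfolding slope_def using v by (intro SUP_upper) (auto simp: dist_commute)
      then have "\<bar>u v - u z\<bar> / dist v z \<le> \<sigma>" using \<sigma> by (simp add: ennreal_le_iff)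
      then have "\<bar>u v - u z\<bar> \<le> \<sigma> * dist v z" using \<open>v \<noteq> z\<close> by (simp add: pos_divide_le_eq)
      also have "\<dots> \<le> \<sigma> * r" using v \<sigma> by (intro mult_left_mono) (auto simp: dist_commute)
      finally show ?thesis using v by (auto split: split_indicator)
    qed simp
    then have "(\<integral>\<^sup>+t. ennreal C * indicator S (t, z) \<partial>lborel) \<le> (\<integral>\<^sup>+t. ennreal C * indicator {u z..u z + \<sigma> * r} t \<partial>lborel)"
      by (intro nn_integral_mono mult_left_mono) auto
    also have "\<dots> = ennreal r * (ennreal C * slope u r z)"
      using \<sigma> \<open>0 < r\<close> by (simp add: nn_integral_cmult_indicator ennreal_mult mult_ac)
    finally show "(\<integral>\<^sup>+t. ennreal C * indicator S (t, z) \<partial>lborel) \<le> ennreal r * (ennreal C * slope u r z)" .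
  qed
  also have "\<dots> = ennreal r * (ennreal C * (\<integral>\<^sup>+z. slope u r z \<partial>N))"
    by (simp add: nn_integral_cmult)
  finally show ?thesis using \<open>0 < r\<close> by (simp add: ennreal_mult_le_mult_iff)
qed

lemma width_imp_pointwise_le:
  fixes u :: "'a::polish_space \<Rightarrow> real"
  assumes N: "sets N = sets borel" "emeasure N UNIV < \<infinity>"
    and width: "\<And>A. A \<in> sets borel \<Longrightarrow> width x y A \<le> ennreal C * emeasure N A"
    and u: "K-lipschitz_on UNIV u" and "0 \<le> C"
  shows "ennreal (u y - u x) \<le> ennreal C * (\<integral>\<^sup>+z. lip u z \<partial>N)"
proof -
  note [measurable_cong] = N(1)
  have cont: "continuous_on UNIV u" using u by (rule lipschitz_on_continuous_on)
  have [measurable]: "slope u r \<in> borel_measurable borel" for r by (rule borel_measurable_slope[OF cont])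
  define f where "f n = slope u (1 / real (Suc n))" for n
  have step: "f (Suc n) z \<le> f n z" for n z unfolding f_def by (intro slope_mono) (simp add: frac_le)
  then have dec: "decseq f" by (intro decseq_SucI le_funI)
  have fin: "(\<integral>\<^sup>+z. f i z \<partial>N) < \<infinity>" for i
  proof -
    have "f i z \<le> ennreal K" for z
      using lipschitz_onD[OF u, of _ z] unfolding f_def by (intro slope_le) (auto simp: dist_real_def)
    then have "(\<integral>\<^sup>+z. f i z \<partial>N) \<le> (\<integral>\<^sup>+z. ennreal K \<partial>N)" by (intro nn_integral_mono)
    also have "\<dots> < \<infinity>" using N(2) sets_eq_imp_space_eq[OF N(1)] by (simp add: ennreal_mult_less_top)
    finally show ?thesis .
  qed
  have "(\<integral>\<^sup>+z. lip u z \<partial>N) = (INF n. \<integral>\<^sup>+z. f n z \<partial>N)"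
    unfolding lip_eq_INF_slope f_def[symmetric] 
    by (rule nn_integral_monotone_convergence_INF_decseq[OF dec _ fin]) (simp add: f_def)
  moreover have "(\<lambda>n. \<integral>\<^sup>+z. f n z \<partial>N) \<longlonglongrightarrow> (INF n. \<integral>\<^sup>+z. f n z \<partial>N)"
    by (intro LIMSEQ_INF decseq_SucI nn_integral_mono step)
  ultimately have "(\<lambda>n. ennreal C * (\<integral>\<^sup>+z. f n z \<partial>N)) \<longlonglongrightarrow> ennreal C * (\<integral>\<^sup>+z. lip u z \<partial>N)"
    by (intro ennreal_tendsto_cmult) auto
  moreover have "(\<lambda>n. ennreal (u y - u x - K * (1 / real (Suc n)))) \<longlonglongrightarrow> ennreal (u y - u x - K * 0)"
    by (intro tendsto_intros LIMSEQ_inverse_real_of_nat[unfolded inverse_eq_divide])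
  moreover have "ennreal (u y - u x - K * (1 / real (Suc n))) \<le> ennreal C * (\<integral>\<^sup>+z. f n z \<partial>N)" for n
    unfolding f_def by (rule collar_coarea_estimate[OF N width u _ \<open>0 \<le> C\<close>]) auto
  ultimately show ?thesis
    using LIMSEQ_le[of "\<lambda>n. ennreal (u y - u x - K * (1 / real (Suc n)))" "ennreal (u y - u x - K * 0)"] by simp
qed

context doubling_space
begin

lemma width_imp_riesz_estimate:
  assumes width: "\<And>x y A. A \<in> sets borel \<Longrightarrow> width x y A \<le> ennreal C * emeasure (riesz_measure M L x y) A"
    and u: "K-lipschitz_on UNIV u" and "0 \<le> C"
  shows "ennreal \<bar>u x - u y\<bar> \<le> ennreal C * potential u x y (riesz_ball L x y)"
proof -
  have u': "K-lipschitz_on UNIV (\<lambda>z. - u z)" using u by (simp add: lipschitz_on_def dist_real_def abs_minus_commute)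
  have "ennreal (v y - v x) \<le> ennreal C * (\<integral>\<^sup>+z. lip v z \<partial>riesz_measure M L x y)" if "K-lipschitz_on UNIV v" for v
    by (rule width_imp_pointwise_le[OF sets_riesz_measure finite_riesz_measure width that \<open>0 \<le> C\<close>])
  from this[OF u] this[OF u'] show ?thesis
    unfolding lip_uminus nn_integral_lip_riesz_measure[OF u] by (cases "u x \<le> u y") auto
qed

lemma Lipschitz_bounded_on_ball:
  fixes u :: "'a \<Rightarrow> real"
  assumes u: "K-lipschitz_on UNIV u"
  shows "w \<in> ball z r \<Longrightarrow> \<bar>u w\<bar> \<le> \<bar>u z\<bar> + K * \<bar>r\<bar>"
proof -
  assume "w \<in> ball z r"
  have "\<bar>u w - u z\<bar> \<le> K * dist w z" using lipschitz_onD[OF u, of w z] by (simp add: dist_real_def)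
  also have "\<dots> \<le> K * \<bar>r\<bar>" using \<open>w \<in> ball z r\<close> lipschitz_on_nonneg[OF u]
    by (intro mult_left_mono) (auto simp: dist_commute)
  finally show ?thesis by linarith
qed

lemma Lipschitz_set_integrable_ball:
  fixes u :: "'a \<Rightarrow> real"
  assumes u: "K-lipschitz_on UNIV u"
  shows "set_integrable M (ball z r) u"
  unfolding set_integrable_def
proof (rule integrableI_bounded_set_indicator[where B="\<bar>u z\<bar> + K * \<bar>r\<bar>"])
  have "u \<in> borel_measurable borel" using lipschitz_on_continuous_on[OF u] by (rule borel_measurable_continuous_onI)
  then show "u \<in> borel_measurable M" by simp
  show "AE x in M. x \<in> ball z r \<longrightarrow> norm (u x) \<le> \<bar>u z\<bar> + K * \<bar>r\<bar>"
    using Lipschitz_bounded_on_ball[OF u] by (intro AE_I2) (simp del: mem_ball)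
qed (auto simp: emeasure_ball)

text \<open>
  Jensen's inequality, with the volume multiplied out to avoid division in \<^typ>\<open>ennreal\<close>.
\<close>
lemma average_diff_le:
  assumes u: "K-lipschitz_on UNIV u" and "0 < r"
  shows "ennreal \<bar>c - avg u z r\<bar> * ennreal (vol z r) \<le> (\<integral>\<^sup>+v\<in>ball z r. ennreal \<bar>c - u v\<bar> \<partial>M)"
proof -
  have 1: "set_integrable M (ball z r) (\<lambda>v. c)"
    unfolding set_integrable_def by (simp add: emeasure_ball)
  have 2: "set_integrable M (ball z r) u" by (rule Lipschitz_set_integrable_ball[OF u])
  have "(c - avg u z r) * vol z r = c * vol z r - (LINT v:ball z r|M. u v)"
    using vol_pos[OF \<open>0 < r\<close>, of z] by (simp add: average_def vol_def left_diff_distrib)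
  also have "c * vol z r = (LINT v:ball z r|M. c)" by (simp add: set_lebesgue_integral_def vol_def)
  also have "(LINT v:ball z r|M. c) - (LINT v:ball z r|M. u v) = (LINT v:ball z r|M. c - u v)"
    by (rule set_integral_diff(2)[OF 1 2, symmetric])
  finally have "\<bar>c - avg u z r\<bar> * vol z r = norm (LINT v:ball z r|M. c - u v)"
    by (metis abs_mult abs_of_nonneg real_norm_def vol_nonneg)
  then have "ennreal \<bar>c - avg u z r\<bar> * ennreal (vol z r) = ennreal (norm (LINT v:ball z r|M. c - u v))"
    by (simp add: ennreal_mult[symmetric])
  also have "\<dots> \<le> (\<integral>\<^sup>+v. ennreal (norm (indicator (ball z r) v *\<^sub>R (c - u v))) \<partial>M)"
    unfolding set_lebesgue_integral_def
    using set_integral_diff(1)[OF 1 2] by (intro integral_norm_bound_ennreal) (simp add: set_integrable_def)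
  also have "\<dots> = (\<integral>\<^sup>+v\<in>ball z r. ennreal \<bar>c - u v\<bar> \<partial>M)"
    by (intro nn_integral_cong) (auto split: split_indicator)
  finally show ?thesis .
qed

lemma riesz_swap: "riesz a w \<le> ennreal D * riesz w a"
proof (cases "a = w")
  case False
  then have d: "0 < dist a w" by simp
  have "vol w (dist a w) \<le> vol a (2 * dist a w)" by (intro vol_mono) (simp add: dist_commute)
  also have "\<dots> \<le> D * vol a (dist a w)" using d by (rule vol_doubling)
  finally have "dist a w / vol a (dist a w) \<le> D * (dist a w / vol w (dist a w))"
    using vol_pos[OF d, of a] vol_pos[OF d, of w] d by (simp add: field_simps)
  then show ?thesis using False D1 by (simp add: riesz_eq dist_commute ennreal_mult[symmetric] ennreal_leI)
qed simp

text \<open>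
  For \<open>a\<close> and \<open>b\<close> in a ball \<open>B\<close> of radius \<open>r\<close>, the set over which the Riesz estimate integrates lies in
  the ball \<open>B'\<close> of radius \<open>(1 + 4 * L) * r\<close>.  Averaging over \<open>a\<close> and \<open>b\<close> leaves the integral over \<open>a \<in> B\<close>
  of the potential with pole \<open>a\<close>.  After Tonelli, the inner integral over poles becomes an integral of the
  kernel with fixed pole \<open>w\<close>, which is of order \<open>r\<close>.
\<close>
lemma riesz_estimate_imp_poincare:
  assumes "0 \<le> C" "1 \<le> L"
    and est: "\<And>u K x y. K-lipschitz_on UNIV u \<Longrightarrow>
      ennreal \<bar>u x - u y\<bar> \<le> ennreal C * potential u x y (riesz_ball L x y)"
  shows "poincare_1 M"
proof -
  interpret sigma_finite_measure M by (rule sigma_finite_M)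
  interpret P: pair_sigma_finite M M by unfold_locales
  \<comment> \<open>\<open>dist a b \<le> 2 * r\<close>, so the balls of radius \<open>2 * L * dist a b\<close> reach at most \<open>4 * L * r\<close> beyond \<open>a\<close> and \<open>b\<close>\<close>
  define \<Lambda> where "\<Lambda> = 1 + 4 * L"
  have "\<Lambda> \<ge> 1" using \<open>1 \<le> L\<close> by (simp add: \<Lambda>_def)
  obtain Q where Q: "1 \<le> Q" "\<And>a b R r. 0 < r \<Longrightarrow> dist a b + R \<le> \<Lambda> * r \<Longrightarrow> vol a R \<le> Q * vol b r"
    using vol_comparable by blast
  define C' where "C' = max 1 (2 * C * (D * (2 * D * (\<Lambda> + 1))) * Q)"
  have main: "(\<integral>\<^sup>+w\<in>ball z r. ennreal \<bar>u w - avg u z r\<bar> \<partial>M) / emeasure M (ball z r)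
      \<le> ennreal (C' * r) * ((\<integral>\<^sup>+w\<in>ball z (\<Lambda> * r). lip u w \<partial>M) / emeasure M (ball z (\<Lambda> * r)))"
    if u: "K-lipschitz_on UNIV u" and "0 < r" for u K z r
  proof -
    have [measurable]: "lip u \<in> borel_measurable borel" by (rule borel_measurable_lip[OF u])
    have [measurable]: "u \<in> borel_measurable borel"
      using lipschitz_on_continuous_on[OF u] by (rule borel_measurable_continuous_onI)
    define B B' where "B = ball z r" and "B' = ball z (\<Lambda> * r)"
    have [measurable]: "Measurable.pred borel (\<lambda>w. w \<in> B)" "Measurable.pred borel (\<lambda>w. w \<in> B')" by (simp_all add: B_def B'_def)
    have [measurable]: "B \<in> sets borel" "B' \<in> sets borel" by (simp_all add: B_def B'_def)
    define m where "m = vol z r"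
    have "0 < m" unfolding m_def using \<open>0 < r\<close> by (rule vol_pos)
    have mB: "emeasure M B = ennreal m" by (simp add: m_def B_def emeasure_ball)
    define F where "F p = lip u (snd p) * riesz (fst p) (snd p) * indicator B' (snd p)" for p
    have F[measurable]: "F \<in> borel_measurable (borel \<Otimes>\<^sub>M borel)"
      unfolding F_def using borel_measurable_riesz_pair by measurable
    have F'[measurable]: "F \<in> borel_measurable (M \<Otimes>\<^sub>M M)"
      using F by (simp cong: measurable_cong_sets sets_pair_measure_cong)
    define G where "G a = (\<integral>\<^sup>+w. F (a, w) \<partial>M)" for a
    have G[measurable]: "G \<in> borel_measurable borel"
      using borel_measurable_nn_integral_fst[OF F'] unfolding G_def by simp
    have two: "ennreal \<bar>u a - u b\<bar> \<le> ennreal C * (G a + G b)" if ab: "a \<in> B" "b \<in> B" for a b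
    proof -
      have "dist a b \<le> 2 * r" using ab dist_triangle[of a b z] by (simp add: B_def dist_commute)
      then have Ld: "2 * L * dist a b \<le> 4 * L * r" using \<open>1 \<le> L\<close> mult_left_mono[of "dist a b" "2 * r" "2 * L"] by simp
      have "riesz_ball L a b \<subseteq> B'"
      proof
        fix w assume "w \<in> riesz_ball L a b"
        then have "dist a w < 4 * L * r \<or> dist b w < 4 * L * r" using Ld by (auto simp: riesz_ball_def)
        moreover have "dist z w \<le> dist z a + dist a w" "dist z w \<le> dist z b + dist b w" by (rule dist_triangle)+
        ultimately show "w \<in> B'" using ab by (auto simp: B_def B'_def \<Lambda>_def algebra_simps)
      qed
      then have "potential u a b (riesz_ball L a b) \<le> (\<integral>\<^sup>+w. F (a, w) + F (b, w) \<partial>M)"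
        by (intro nn_integral_mono) (auto simp: F_def ring_distribs split: split_indicator)
      also have "\<dots> = G a + G b" unfolding G_def F_def
        by (subst nn_integral_add) (simp_all, measurable)
      finally show ?thesis using est[OF u, of a b] by (meson mult_left_mono order_trans zero_le)
    qed
    define I where "I = (\<integral>\<^sup>+a\<in>B. G a \<partial>M)"
    have one: "ennreal \<bar>u a - average M B u\<bar> * ennreal m \<le> ennreal C * (G a * ennreal m + I)" if a: "a \<in> B" for a
    proof -
      have "ennreal \<bar>u a - average M B u\<bar> * ennreal m \<le> (\<integral>\<^sup>+b\<in>B. ennreal \<bar>u a - u b\<bar> \<partial>M)"
        unfolding B_def m_def by (rule average_diff_le[OF u \<open>0 < r\<close>])
      also have "\<dots> \<le> (\<integral>\<^sup>+b. ennreal C * (G a * indicator B b + G b * indicator B b) \<partial>M)"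
        using two[OF a] by (intro nn_integral_mono) (auto split: split_indicator)
      also have "\<dots> = ennreal C * (G a * ennreal m + I)"
        unfolding I_def mB[symmetric] by (subst nn_integral_cmult, measurable) (subst nn_integral_add, measurable, simp add: nn_integral_cmult_indicator)
      finally show ?thesis .
    qed
    define J where "J = (\<integral>\<^sup>+w\<in>B'. lip u w \<partial>M)"
    define Y where "Y = (\<integral>\<^sup>+w\<in>B. ennreal \<bar>u w - average M B u\<bar> \<partial>M)"
    have "Y * ennreal m = (\<integral>\<^sup>+a. ennreal \<bar>u a - average M B u\<bar> * indicator B a * ennreal m \<partial>M)"
      unfolding Y_def by (rule nn_integral_multc[symmetric]) measurable
    also have "\<dots> \<le> (\<integral>\<^sup>+a. ennreal C * (G a * indicator B a * ennreal m + I * indicator B a) \<partial>M)"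
      using one by (intro nn_integral_mono) (auto split: split_indicator)
    also have "\<dots> = ennreal C * (I * ennreal m + I * ennreal m)"
      unfolding mB[symmetric]
      by (subst nn_integral_cmult, measurable)
         (subst nn_integral_add, measurable, simp add: nn_integral_cmult_indicator nn_integral_multc I_def)
    also have "\<dots> = ennreal (2 * C) * I * ennreal m"
      using \<open>0 \<le> C\<close> by (simp add: ennreal_mult mult_ac) (simp add: mult_2[symmetric] mult_ac)
    finally have "Y * ennreal m \<le> ennreal (2 * C) * I * ennreal m" .
    then have Y: "Y \<le> ennreal (2 * C) * I"
      using \<open>0 < m\<close> by (simp add: ennreal_mult_le_mult_iff mult.commute[of _ "ennreal m"])
    have "I = (\<integral>\<^sup>+a. (\<integral>\<^sup>+w. F (a, w) * indicator B a \<partial>M) \<partial>M)"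
      unfolding I_def G_def by (intro nn_integral_cong) (subst nn_integral_multc, auto simp: F_def, measurable)
    also have "\<dots> = (\<integral>\<^sup>+w. (\<integral>\<^sup>+a. F (a, w) * indicator B a \<partial>M) \<partial>M)"
      by (intro P.Fubini[symmetric, of "\<lambda>p. F p * indicator B (fst p)", simplified]) measurable
    also have "\<dots> \<le> (\<integral>\<^sup>+w. ennreal (D * (2 * D * ((\<Lambda> + 1) * r))) * (lip u w * indicator B' w) \<partial>M)"
    proof (intro nn_integral_mono)
      fix w
      show "(\<integral>\<^sup>+a. F (a, w) * indicator B a \<partial>M) \<le> ennreal (D * (2 * D * ((\<Lambda> + 1) * r))) * (lip u w * indicator B' w)"
      proof (cases "w \<in> B'")
        case True
        have "B \<subseteq> ball w ((\<Lambda> + 1) * r)"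
        proof
          fix a assume "a \<in> B"
          then show "a \<in> ball w ((\<Lambda> + 1) * r)" using True dist_triangle[of w a z]
            by (simp add: B_def B'_def dist_commute algebra_simps)
        qed
        then have "(\<integral>\<^sup>+a. F (a, w) * indicator B a \<partial>M)
           \<le> (\<integral>\<^sup>+a. (lip u w * ennreal D) * (riesz w a * indicator (ball w ((\<Lambda> + 1) * r)) a) \<partial>M)"
          using riesz_swap by (intro nn_integral_mono) (auto simp: F_def mult.assoc split: split_indicator intro!: mult_left_mono)
        also have "\<dots> = (lip u w * ennreal D) * (\<integral>\<^sup>+a\<in>ball w ((\<Lambda> + 1) * r). riesz w a \<partial>M)"
          by (rule nn_integral_cmult) measurable
        also have "\<dots> \<le> (lip u w * ennreal D) * ennreal (2 * D * ((\<Lambda> + 1) * r))"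
          using \<open>0 < r\<close> \<open>\<Lambda> \<ge> 1\<close> by (intro mult_left_mono riesz_integral_ball_le) auto
        also have "\<dots> = ennreal (D * (2 * D * ((\<Lambda> + 1) * r))) * (lip u w * indicator B' w)"
          using True D1 \<open>0 < r\<close> \<open>\<Lambda> \<ge> 1\<close> by (simp add: ennreal_mult mult_ac)
        finally show ?thesis .
      qed (simp add: F_def)
    qed
    also have "\<dots> = ennreal (D * (2 * D * ((\<Lambda> + 1) * r))) * J"
      unfolding J_def by (rule nn_integral_cmult) measurable
    finally have I: "I \<le> ennreal (D * (2 * D * ((\<Lambda> + 1) * r))) * J" .
    define m' where "m' = vol z (\<Lambda> * r)"
    have "0 < m'" unfolding m'_def using \<open>0 < r\<close> \<open>\<Lambda> \<ge> 1\<close> by (intro vol_pos) simp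
    have "m' \<le> Q * m" unfolding m_def m'_def using \<open>0 < r\<close> by (intro Q(2)) auto
    then have "1 / m \<le> Q / m'" using \<open>0 < m\<close> \<open>0 < m'\<close> by (simp add: field_simps)
    have "Y / ennreal m \<le> (ennreal (2 * C) * (ennreal (D * (2 * D * ((\<Lambda> + 1) * r))) * J)) / ennreal m"
      using Y I by (intro divide_right_mono_ennreal) (meson mult_left_mono order_trans zero_le)
    also have "\<dots> = ennreal (2 * C * (D * (2 * D * ((\<Lambda> + 1) * r)))) * J * ennreal (1 / m)"
      using \<open>0 \<le> C\<close> D1 \<open>0 < r\<close> \<open>\<Lambda> \<ge> 1\<close> \<open>0 < m\<close>
      by (simp add: ennreal_mult divide_ennreal_def inverse_ennreal inverse_eq_divide mult_ac)
    also have "\<dots> \<le> ennreal (2 * C * (D * (2 * D * ((\<Lambda> + 1) * r)))) * J * ennreal (Q / m')"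
      using \<open>1 / m \<le> Q / m'\<close> by (intro mult_left_mono ennreal_leI) auto
    also have "\<dots> = ennreal ((2 * C * (D * (2 * D * (\<Lambda> + 1))) * Q) * r) * (J / ennreal m')"
      using \<open>0 \<le> C\<close> D1 \<open>0 < r\<close> \<open>\<Lambda> \<ge> 1\<close> \<open>0 < m'\<close> Q(1)
      by (simp add: ennreal_mult divide_ennreal_def inverse_ennreal divide_inverse mult_ac)
    also have "\<dots> \<le> ennreal (C' * r) * (J / ennreal m')"
      using \<open>0 < r\<close> by (intro mult_right_mono ennreal_leI) (auto simp: C'_def)
    finally show ?thesis
      unfolding Y_def B_def J_def B'_def m_def m'_def emeasure_ball .
  qed
  show ?thesis
    unfolding poincare_1_def
    using main \<open>\<Lambda> \<ge> 1\<close> by (intro exI[of _ C'] exI[of _ \<Lambda>]) (auto simp: C'_def)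
qed

end

section \<open>Averages in spaces with a Poincare inequality\<close>

lemma curve_length_in_mono: "A \<subseteq> B \<Longrightarrow> curve_length_in \<gamma> A \<le> curve_length_in \<gamma> B"
  unfolding curve_length_in_def by (intro nn_integral_mono) (auto split: split_indicator)

lemma width_mono: "A \<subseteq> B \<Longrightarrow> width x y A \<le> width x y B"
  unfolding width_def by (intro INF_superset_mono curve_length_in_mono order_refl)

lemma width_self[simp]: "width x x A = 0"
proof -
  have c: "(\<lambda>_. x) \<in> lipschitz_curves x x"
    by (auto simp: lipschitz_curves_def intro!: exI[of _ 0] lipschitz_onI)
  have "metric_speed (\<lambda>_. x) t \<le> 0" if "t \<in> {0..1}" for t
    by (rule metric_speed_le[OF that, of 0 1]) auto
  then have "curve_length_in (\<lambda>_. x) A = 0"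
    unfolding curve_length_in_def by (intro nn_integral_0_iff_AE[THEN iffD2] nn_integral_cong[of _ _ "\<lambda>_. 0", simplified])
      (auto split: split_indicator simp: ennreal_neg)
  then show ?thesis unfolding width_def using INF_lower[OF c, of "\<lambda>\<gamma>. curve_length_in \<gamma> A"] by simp
qed

text \<open>
  If \<open>j\<close> is the first index that occurs, then \<open>j + m\<close> and all later ones belong to annuli with outer radius below \<open>v\<close>.
\<close>
lemma geometric_annuli_overlap:
  fixes q S \<alpha> \<beta> v :: real
  assumes q: "0 < q" "q < 1" and "0 < S" "0 < \<beta>" and m: "\<beta> * q ^ m < \<alpha>"
  shows "card {i\<in>{..<N}. \<alpha> * (S * q ^ i) \<le> v \<and> v \<le> \<beta> * (S * q ^ i)} \<le> m"
proof (cases "{i\<in>{..<N}. \<alpha> * (S * q ^ i) \<le> v \<and> v \<le> \<beta> * (S * q ^ i)} = {}")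
  case False
  define X where "X = {i\<in>{..<N}. \<alpha> * (S * q ^ i) \<le> v \<and> v \<le> \<beta> * (S * q ^ i)}"
  have fin: "finite X" and ne: "X \<noteq> {}" using False by (auto simp: X_def)
  define j where "j = Min X"
  have j: "j \<in> X" unfolding j_def using fin ne by (rule Min_in)
  have "X \<subseteq> {j..<j + m}"
  proof
    fix i assume i: "i \<in> X"
    have "j \<le> i" unfolding j_def using fin i by (rule Min_le)
    moreover have "i < j + m"
    proof (rule ccontr)
      assume "\<not> i < j + m"
      then have "q ^ i \<le> q ^ (j + m)" using q by (intro power_decreasing) auto
      have "v \<le> \<beta> * (S * q ^ i)" using i by (simp add: X_def)
      also have "\<dots> \<le> \<beta> * (S * q ^ (j + m))"
        using \<open>q ^ i \<le> q ^ (j + m)\<close> \<open>0 < S\<close> \<open>0 < \<beta>\<close> by (intro mult_left_mono) auto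
      also have "\<dots> = (\<beta> * q ^ m) * (S * q ^ j)" by (simp add: power_add mult_ac)
      also have "\<dots> < \<alpha> * (S * q ^ j)" using m \<open>0 < S\<close> q by (intro mult_strict_right_mono) auto
      also have "\<dots> \<le> v" using j by (simp add: X_def)
      finally show False by simp
    qed
    ultimately show "i \<in> {j..<j + m}" by simp
  qed
  then have "card X \<le> card {j..<j + m}" by (intro card_mono) auto
  then show ?thesis by (simp add: X_def)
qed (simp only: card.empty)

lemma ennreal_abs_diff_triangle: "ennreal \<bar>a - c\<bar> \<le> ennreal \<bar>a - b\<bar> + ennreal \<bar>b - c\<bar>"
  by (simp add: ennreal_plus[symmetric] ennreal_leI del: ennreal_plus)

lemma ennreal_telescope:
  fixes a :: "nat \<Rightarrow> real"
  shows "ennreal \<bar>a N - a 0\<bar> \<le> (\<Sum>i<N. ennreal \<bar>a (Suc i) - a i\<bar>)"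
proof (induction N)
  case (Suc N)
  have "ennreal \<bar>a (Suc N) - a 0\<bar> \<le> ennreal \<bar>a (Suc N) - a N\<bar> + ennreal \<bar>a N - a 0\<bar>"
    by (rule ennreal_abs_diff_triangle)
  also have "\<dots> \<le> ennreal \<bar>a (Suc N) - a N\<bar> + (\<Sum>i<N. ennreal \<bar>a (Suc i) - a i\<bar>)"
    using Suc by (intro add_left_mono)
  finally show ?case by (simp add: add.commute)
qed simp

locale poincare_space = doubling_space +
  fixes P \<Lambda> :: real
  assumes P1: "1 \<le> P" and \<Lambda>1: "1 \<le> \<Lambda>"
    and poincare: "\<And>u K z r. K-lipschitz_on UNIV u \<Longrightarrow> 0 < r \<Longrightarrow>
      (\<integral>\<^sup>+w\<in>ball z r. ennreal \<bar>u w - avg u z r\<bar> \<partial>M) / emeasure M (ball z r)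
      \<le> ennreal (P * r) * ((\<integral>\<^sup>+w\<in>ball z (\<Lambda> * r). lip u w \<partial>M) / emeasure M (ball z (\<Lambda> * r)))"
begin

text \<open>
  The Poincare inequality on the larger ball; by doubling, the smaller one has a fixed share of its measure.
\<close>
lemma average_compare:
  obtains Q where "1 \<le> Q" "\<And>u K a r z R. K-lipschitz_on UNIV u \<Longrightarrow> 0 < r \<Longrightarrow> dist a z + r \<le> R \<Longrightarrow> R \<le> F * r \<Longrightarrow>
    ennreal \<bar>avg u a r - avg u z R\<bar>
      \<le> ennreal (Q * (R / vol z (\<Lambda> * R))) * (\<integral>\<^sup>+w\<in>ball z (\<Lambda> * R). lip u w \<partial>M)"
proof -
  obtain Q where Q: "1 \<le> Q" "\<And>a b R r. 0 < r \<Longrightarrow> dist a b + R \<le> (2 * F) * r \<Longrightarrow> vol a R \<le> Q * vol b r"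
    using vol_comparable by blast
  show thesis
  proof (rule that[of "Q * P"])
    show "1 \<le> Q * P" using Q(1) P1 mult_mono[of 1 Q 1 P] by simp
    fix u :: "'a \<Rightarrow> real" and K r R :: real and a z :: 'a
    assume u: "K-lipschitz_on UNIV u" and "0 < r" and in_ball: "dist a z + r \<le> R" and RF: "R \<le> F * r"
    have "0 < R" using \<open>0 < r\<close> in_ball zero_le_dist[of a z] by linarith
    define c where "c = avg u z R"
    define X where "X = (\<integral>\<^sup>+v\<in>ball z R. ennreal \<bar>u v - c\<bar> \<partial>M)"
    define J where "J = (\<integral>\<^sup>+w\<in>ball z (\<Lambda> * R). lip u w \<partial>M)"
    have sub: "ball a r \<subseteq> ball z R"
    proof
      fix v assume "v \<in> ball a r"
      then show "v \<in> ball z R" using in_ball dist_triangle[of z v a] by (simp add: dist_commute)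
    qed
    have va: "0 < vol a r" and vz: "0 < vol z R" and vl: "0 < vol z (\<Lambda> * R)"
      using \<open>0 < r\<close> \<open>0 < R\<close> \<Lambda>1 by (auto intro!: vol_pos)
    have vol: "vol z R \<le> Q * vol a r"
      using \<open>0 < r\<close> in_ball RF by (intro Q(2)) (auto simp: dist_commute)
    have "X / ennreal (vol z R) \<le> ennreal (P * R) * (J / ennreal (vol z (\<Lambda> * R)))"
      using poincare[OF u \<open>0 < R\<close>, of z] by (simp add: X_def J_def c_def emeasure_ball)
    then have "ennreal (vol z R) * (X / ennreal (vol z R)) \<le> ennreal (vol z R) * (ennreal (P * R) * (J / ennreal (vol z (\<Lambda> * R))))"
      by (intro mult_left_mono) auto
    moreover have "ennreal (vol z R) * (X / ennreal (vol z R)) = X"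
      using vz by (simp add: ennreal_times_divide mult_divide_eq_ennreal mult.commute[of _ X])
    ultimately have X: "X \<le> ennreal (vol z R) * (ennreal (P * R) * (J / ennreal (vol z (\<Lambda> * R))))" by simp
    have "ennreal (vol a r) * ennreal \<bar>avg u a r - c\<bar> \<le> (\<integral>\<^sup>+v\<in>ball a r. ennreal \<bar>c - u v\<bar> \<partial>M)"
      using average_diff_le[OF u \<open>0 < r\<close>, of c a] by (simp add: mult.commute abs_minus_commute)
    also have "\<dots> \<le> X" unfolding X_def using sub
      by (intro nn_integral_mono) (auto simp: abs_minus_commute split: split_indicator)
    also have "\<dots> \<le> ennreal (Q * vol a r) * (ennreal (P * R) * (J / ennreal (vol z (\<Lambda> * R))))"
      using X vol by (meson ennreal_leI mult_right_mono order_trans zero_le)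
    also have "\<dots> = ennreal (vol a r) * (ennreal (Q * P * (R / vol z (\<Lambda> * R))) * J)"
      using Q(1) P1 \<open>0 < R\<close> vl va
      by (simp add: ennreal_mult divide_ennreal_def inverse_ennreal divide_inverse mult_ac)
    finally show "ennreal \<bar>avg u a r - avg u z R\<bar> \<le> ennreal (Q * P * (R / vol z (\<Lambda> * R))) * J"
      using va by (simp add: c_def ennreal_mult_le_mult_iff)
  qed
qed

text \<open>
  At distance comparable to \<open>R\<close> from the pole, the kernel is comparable to \<open>R\<close> over the measure of a ball of radius \<open>R\<close>.
\<close>
lemma riesz_lower:
  assumes "0 < F"
  obtains Q where "1 \<le> Q" "\<And>x z w R. 0 < R \<Longrightarrow> dist x z + dist x w \<le> F * R \<Longrightarrow> R \<le> F * dist x w \<Longrightarrow>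
    ennreal (R / vol z R) \<le> ennreal Q * riesz x w"
proof -
  obtain Q where Q: "1 \<le> Q" "\<And>a b R r. 0 < r \<Longrightarrow> dist a b + R \<le> F * r \<Longrightarrow> vol a R \<le> Q * vol b r"
    using vol_comparable by blast
  show thesis
  proof (rule that[of "max 1 (F * Q)"])
    fix x z w :: 'a and R :: real
    assume "0 < R" and 1: "dist x z + dist x w \<le> F * R" and 2: "R \<le> F * dist x w"
    have d: "0 < dist x w" using \<open>0 < R\<close> 2 by (cases "dist x w = 0") auto
    define d where "d = dist x w"
    have "vol x d \<le> Q * vol z R" unfolding d_def using \<open>0 < R\<close> 1 by (intro Q(2))
    have v: "0 < vol x d" "0 < vol z R" using \<open>0 < R\<close> d by (auto simp: d_def intro!: vol_pos)
    have "R * vol x d \<le> (F * d) * (Q * vol z R)"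
      using 2 \<open>vol x d \<le> Q * vol z R\<close> \<open>0 < R\<close> v assms d by (intro mult_mono) (auto simp: d_def)
    then have "R / vol z R \<le> (F * Q) * (d / vol x d)" using v by (simp add: field_simps)
    also have "\<dots> \<le> max 1 (F * Q) * (d / vol x d)" using v d by (intro mult_right_mono) (auto simp: d_def)
    finally have "ennreal (R / vol z R) \<le> ennreal (max 1 (F * Q) * (d / vol x d))" by (rule ennreal_leI)
    also have "\<dots> = ennreal (max 1 (F * Q)) * ennreal (d / vol x d)"
      using v d by (intro ennreal_mult) (auto simp: d_def)
    also have "ennreal (d / vol x d) = riesz x w" using d unfolding d_def by (subst riesz_eq) auto
    finally show "ennreal (R / vol z R) \<le> ennreal (max 1 (F * Q)) * riesz x w" .
  qed simp
qed

text \<open>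
  Combination of the two previous lemmas.  Every point of the ball has to be far from one of the two poles,
  relative to the radius, but which pole this is may depend on the point.
\<close>
lemma average_compare_riesz:
  assumes "1 \<le> F"
  obtains Q where "1 \<le> Q" "\<And>u K x y a r z R. K-lipschitz_on UNIV u \<Longrightarrow> 0 < r \<Longrightarrow> dist a z + r \<le> R \<Longrightarrow> R \<le> F * r \<Longrightarrow>
    (\<And>w. w \<in> ball z (\<Lambda> * R) \<Longrightarrow>
       (R \<le> F * dist x w \<and> dist x z \<le> F * R) \<or> (R \<le> F * dist y w \<and> dist y z \<le> F * R)) \<Longrightarrow>
    ennreal \<bar>avg u a r - avg u z R\<bar>
      \<le> ennreal Q * potential u x y (ball z (\<Lambda> * R))"
proof -
  obtain Q1 where Q1: "1 \<le> Q1" "\<And>u K a r z R. K-lipschitz_on UNIV u \<Longrightarrow> 0 < r \<Longrightarrow> dist a z + r \<le> R \<Longrightarrow> R \<le> F * r \<Longrightarrow>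
    ennreal \<bar>avg u a r - avg u z R\<bar>
      \<le> ennreal (Q1 * (R / vol z (\<Lambda> * R))) * (\<integral>\<^sup>+w\<in>ball z (\<Lambda> * R). lip u w \<partial>M)"
    using average_compare[of F] by blast
  \<comment> \<open>the kernel bound is needed at radius \<open>\<Lambda> * R\<close>, where distances to the pole are at most \<open>(F + \<Lambda>) * R\<close>\<close>
  define F' where "F' = (2 * F + 1) * \<Lambda>"
  have "0 < F'" using assms \<Lambda>1 by (simp add: F'_def)
  obtain Q2 where Q2: "1 \<le> Q2" "\<And>x z w R. 0 < R \<Longrightarrow> dist x z + dist x w \<le> F' * R \<Longrightarrow> R \<le> F' * dist x w \<Longrightarrow>
    ennreal (R / vol z R) \<le> ennreal Q2 * riesz x w"
    using riesz_lower[OF \<open>0 < F'\<close>] by blast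
  show thesis
  proof (rule that[of "Q1 * Q2"])
    show "1 \<le> Q1 * Q2" using Q1(1) Q2(1) mult_mono[of 1 Q1 1 Q2] by simp
    fix u :: "'a \<Rightarrow> real" and K r R :: real and x y a z :: 'a
    assume u: "K-lipschitz_on UNIV u" and r: "0 < r" "dist a z + r \<le> R" "R \<le> F * r"
      and away: "\<And>w. w \<in> ball z (\<Lambda> * R) \<Longrightarrow>
       (R \<le> F * dist x w \<and> dist x z \<le> F * R) \<or> (R \<le> F * dist y w \<and> dist y z \<le> F * R)"
    have "0 < R" using r zero_le_dist[of a z] by linarith
    then have L: "R \<le> \<Lambda> * R" "0 < \<Lambda> * R" using \<Lambda>1 by auto
    have vl: "0 < vol z (\<Lambda> * R)" using L by (intro vol_pos)
    have [measurable]: "lip u \<in> borel_measurable borel" by (rule borel_measurable_lip[OF u])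
    have low: "ennreal (\<Lambda> * R / vol z (\<Lambda> * R)) \<le> ennreal Q2 * riesz x w"
      if w: "w \<in> ball z (\<Lambda> * R)" and 1: "R \<le> F * dist x w" and 2: "dist x z \<le> F * R" for x w
    proof (rule Q2(2)[OF L(2)])
      have FR: "F * R \<le> F * (\<Lambda> * R)" using L assms by (intro mult_left_mono) auto
      have "dist x w \<le> dist x z + \<Lambda> * R" using w dist_triangle[of x w z] by simp
      then have "dist x z + dist x w \<le> 2 * (F * (\<Lambda> * R)) + \<Lambda> * R" using 2 FR by linarith
      also have "\<dots> \<le> F' * (\<Lambda> * R)"
      proof -
        have "2 * (F * (\<Lambda> * R)) + \<Lambda> * R = (2 * F + 1) * (\<Lambda> * R)" by (simp add: ring_distribs)
        also have "\<dots> \<le> F' * (\<Lambda> * R)" unfolding F'_def using assms \<Lambda>1 L by (intro mult_right_mono) auto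
        finally show ?thesis .
      qed
      finally show "dist x z + dist x w \<le> F' * (\<Lambda> * R)" .
      have "\<Lambda> * R \<le> \<Lambda> * (F * dist x w)" using 1 \<Lambda>1 by (intro mult_left_mono) auto
      also have "\<dots> = (F * \<Lambda>) * dist x w" by simp
      also have "\<dots> \<le> F' * dist x w" unfolding F'_def using assms \<Lambda>1 by (intro mult_right_mono) auto
      finally show "\<Lambda> * R \<le> F' * dist x w" .
    qed
    have ker: "ennreal (R / vol z (\<Lambda> * R)) \<le> ennreal Q2 * (riesz x w + riesz y w)" if w: "w \<in> ball z (\<Lambda> * R)" for w
    proof -
      have "ennreal (R / vol z (\<Lambda> * R)) \<le> ennreal (\<Lambda> * R / vol z (\<Lambda> * R))"
        using L vl by (intro ennreal_leI divide_right_mono) auto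
      also have "\<dots> \<le> ennreal Q2 * riesz x w + ennreal Q2 * riesz y w"
        using away[OF w] low[OF w, of x] low[OF w, of y] by (auto intro: add_increasing add_increasing2)
      finally show ?thesis by (simp add: ring_distribs)
    qed
    have "ennreal \<bar>avg u a r - avg u z R\<bar>
      \<le> ennreal (Q1 * (R / vol z (\<Lambda> * R))) * (\<integral>\<^sup>+w\<in>ball z (\<Lambda> * R). lip u w \<partial>M)"
      by (rule Q1(2)[OF u r])
    also have "\<dots> = ennreal Q1 * (\<integral>\<^sup>+w\<in>ball z (\<Lambda> * R). lip u w * ennreal (R / vol z (\<Lambda> * R)) \<partial>M)"
    proof -
      have "(\<integral>\<^sup>+w\<in>ball z (\<Lambda> * R). lip u w * ennreal (R / vol z (\<Lambda> * R)) \<partial>M)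
          = (\<integral>\<^sup>+w. ennreal (R / vol z (\<Lambda> * R)) * (lip u w * indicator (ball z (\<Lambda> * R)) w) \<partial>M)"
        by (simp add: mult_ac)
      also have "\<dots> = ennreal (R / vol z (\<Lambda> * R)) * (\<integral>\<^sup>+w\<in>ball z (\<Lambda> * R). lip u w \<partial>M)"
        by (rule nn_integral_cmult) measurable
      moreover have "ennreal (Q1 * (R / vol z (\<Lambda> * R))) = ennreal Q1 * ennreal (R / vol z (\<Lambda> * R))"
        using Q1(1) \<open>0 < R\<close> vl by (intro ennreal_mult) auto
      ultimately show ?thesis by (simp add: mult.assoc)
    qed
    also have "\<dots> \<le> ennreal Q1 * (\<integral>\<^sup>+w. ennreal Q2 * (lip u w * (riesz x w + riesz y w) * indicator (ball z (\<Lambda> * R)) w) \<partial>M)"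
    proof (intro mult_left_mono nn_integral_mono)
      fix w
      show "lip u w * ennreal (R / vol z (\<Lambda> * R)) * indicator (ball z (\<Lambda> * R)) w
        \<le> ennreal Q2 * (lip u w * (riesz x w + riesz y w) * indicator (ball z (\<Lambda> * R)) w)"
      proof (cases "w \<in> ball z (\<Lambda> * R)")
        case True
        have "lip u w * ennreal (R / vol z (\<Lambda> * R)) \<le> lip u w * (ennreal Q2 * (riesz x w + riesz y w))"
          by (intro mult_left_mono ker[OF True]) simp
        then show ?thesis using True by (simp add: mult_ac)
      qed simp
    qed simp
    also have "\<dots> = ennreal (Q1 * Q2) * potential u x y (ball z (\<Lambda> * R))"
      using Q1(1) Q2(1) by (subst nn_integral_cmult, measurable) (simp add: ennreal_mult mult.assoc)
    finally show "ennreal \<bar>avg u a r - avg u z R\<bar>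
      \<le> ennreal (Q1 * Q2) * potential u x y (ball z (\<Lambda> * R))" .
  qed
qed

lemma average_near:
  assumes u: "K-lipschitz_on UNIV u" and "0 < r"
  shows "\<bar>u x - avg u z r\<bar> \<le> K * (dist x z + r)"
proof -
  have K0: "0 \<le> K" by (rule lipschitz_on_nonneg[OF u])
  define B where "B = K * (dist x z + r)"
  have "0 \<le> B" using K0 \<open>0 < r\<close> by (simp add: B_def)
  have "ennreal \<bar>u x - avg u z r\<bar> * ennreal (vol z r) \<le> (\<integral>\<^sup>+v\<in>ball z r. ennreal \<bar>u x - u v\<bar> \<partial>M)"
    by (rule average_diff_le[OF u \<open>0 < r\<close>])
  also have "\<dots> \<le> (\<integral>\<^sup>+v. ennreal B * indicator (ball z r) v \<partial>M)"
  proof (intro nn_integral_mono)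
    fix v show "ennreal \<bar>u x - u v\<bar> * indicator (ball z r) v \<le> ennreal B * indicator (ball z r) v"
    proof (cases "v \<in> ball z r")
      case True
      have "\<bar>u x - u v\<bar> \<le> K * dist x v" using lipschitz_onD[OF u, of x v] by (simp add: dist_real_def)
      also have "\<dots> \<le> B" unfolding B_def
        using True K0 dist_triangle[of x v z] by (intro mult_left_mono) auto
      finally show ?thesis using True by (simp add: ennreal_leI)
    qed simp
  qed
  also have "\<dots> = ennreal B * ennreal (vol z r)" by (simp add: nn_integral_cmult_indicator emeasure_ball)
  finally have "ennreal (\<bar>u x - avg u z r\<bar> * vol z r) \<le> ennreal (B * vol z r)"
    using \<open>0 \<le> B\<close> by (simp add: ennreal_mult)
  then show ?thesis using \<open>0 \<le> B\<close> vol_pos[OF \<open>0 < r\<close>, of z] by (simp add: ennreal_le_iff B_def)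
qed

text \<open>
  Telescoping over concentric balls: for \<open>lip u \<le> 1\<close> each step is bounded by a multiple of the radius, and the radii form a
  geometric series.
\<close>
lemma quasiconvex_estimate:
  obtains C where "1 \<le> C" "\<And>(u::'a \<Rightarrow> real) K x y. K-lipschitz_on UNIV u \<Longrightarrow> (\<And>z. lip u z \<le> 1) \<Longrightarrow> \<bar>u x - u y\<bar> \<le> C * dist x y"
proof -
  obtain Q where Q: "1 \<le> Q" "\<And>u K a r z R. K-lipschitz_on UNIV u \<Longrightarrow> 0 < r \<Longrightarrow> dist a z + r \<le> R \<Longrightarrow> R \<le> 2 * r \<Longrightarrow>
    ennreal \<bar>avg u a r - avg u z R\<bar>
      \<le> ennreal (Q * (R / vol z (\<Lambda> * R))) * (\<integral>\<^sup>+w\<in>ball z (\<Lambda> * R). lip u w \<partial>M)"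
    using average_compare[of 2] by blast
  show thesis
  proof (rule that[of "8 * Q"])
    show "1 \<le> 8 * Q" using Q(1) by simp
    fix u :: "'a \<Rightarrow> real" and K :: real and x y :: 'a
    assume u: "K-lipschitz_on UNIV u" and lip1: "\<And>z. lip u z \<le> 1"
    have comp: "\<bar>avg u a r - avg u z R\<bar> \<le> Q * R"
      if r: "0 < r" "dist a z + r \<le> R" "R \<le> 2 * r" for a z r R
    proof -
      have "0 < R" using r zero_le_dist[of a z] by linarith
      then have v: "0 < vol z (\<Lambda> * R)" using \<Lambda>1 by (intro vol_pos) simp
      have "(\<integral>\<^sup>+w\<in>ball z (\<Lambda> * R). lip u w \<partial>M) \<le> (\<integral>\<^sup>+w. indicator (ball z (\<Lambda> * R)) w \<partial>M)"
        using lip1 by (intro nn_integral_mono) (auto split: split_indicator)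
      also have "\<dots> = ennreal (vol z (\<Lambda> * R))" by (simp add: emeasure_ball)
      finally have "ennreal \<bar>avg u a r - avg u z R\<bar>
         \<le> ennreal (Q * (R / vol z (\<Lambda> * R))) * ennreal (vol z (\<Lambda> * R))"
        using Q(2)[OF u r] by (meson mult_left_mono order_trans zero_le)
      also have "\<dots> = ennreal (Q * R)" using Q(1) \<open>0 < R\<close> v by (simp add: ennreal_mult[symmetric])
      finally show ?thesis using Q(1) \<open>0 < R\<close> by (simp add: ennreal_le_iff)
    qed
    have tele: "\<bar>u x - avg u x \<rho>\<bar> \<le> 2 * Q * \<rho>" if "0 < \<rho>" for x \<rho>
    proof -
      define a where "a i = avg u x (\<rho> / 2 ^ i)" for i :: nat
      have "\<bar>a N - a 0\<bar> \<le> 2 * Q * \<rho> * (1 - 1 / 2 ^ N)" for N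
      proof (induction N)
        case (Suc N)
        have "\<bar>a (Suc N) - a N\<bar> \<le> Q * (\<rho> / 2 ^ N)"
          unfolding a_def using \<open>0 < \<rho>\<close> by (intro comp) (auto simp: field_simps)
        then have "\<bar>a (Suc N) - a 0\<bar> \<le> 2 * Q * \<rho> * (1 - 1 / 2 ^ N) + Q * (\<rho> / 2 ^ N)" using Suc by linarith
        also have "\<dots> = 2 * Q * \<rho> * (1 - 1 / 2 ^ Suc N)" by (simp add: field_simps)
        finally show ?case .
      qed simp
      moreover have "2 * Q * \<rho> * (1 - 1 / 2 ^ N) \<le> 2 * Q * \<rho>" for N :: nat
        using Q(1) \<open>0 < \<rho>\<close> by (simp add: mult_left_le)
      ultimately have aN: "\<bar>a N - a 0\<bar> \<le> 2 * Q * \<rho>" for N by (meson order_trans)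
      have "\<bar>u x - a N\<bar> \<le> K * (\<rho> / 2 ^ N)" for N
        using average_near[OF u, of "\<rho> / 2 ^ N" x x] \<open>0 < \<rho>\<close> by (simp add: a_def)
      then have near: "\<bar>u x - a N\<bar> \<le> K * (\<rho> * (1 / 2) ^ N)" for N by (simp add: power_one_over)
      have "\<bar>u x - a 0\<bar> \<le> K * (\<rho> * (1 / 2) ^ N) + 2 * Q * \<rho>" for N
        using aN[of N] near[of N] by linarith
      moreover have "(\<lambda>N. K * (\<rho> * (1 / 2) ^ N) + 2 * Q * \<rho>) \<longlonglongrightarrow> K * (\<rho> * 0) + 2 * Q * \<rho>"
        by (intro tendsto_intros) auto
      ultimately have "\<bar>u x - a 0\<bar> \<le> K * (\<rho> * 0) + 2 * Q * \<rho>"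
        by (intro LIMSEQ_le_const) auto
      then show ?thesis by (simp add: a_def)
    qed
    show "\<bar>u x - u y\<bar> \<le> 8 * Q * dist x y"
    proof (cases "x = y")
      case False
      define d where "d = dist x y"
      have "0 < d" using False by (simp add: d_def)
      have "\<bar>u x - avg u x (2 * d)\<bar> \<le> 2 * Q * (2 * d)" using \<open>0 < d\<close> by (intro tele) simp
      moreover have "\<bar>u y - avg u y d\<bar> \<le> 2 * Q * d" using \<open>0 < d\<close> by (rule tele)
      moreover have "\<bar>avg u y d - avg u x (2 * d)\<bar> \<le> Q * (2 * d)"
        using \<open>0 < d\<close> by (intro comp) (auto simp: d_def dist_commute)
      ultimately have "\<bar>u x - u y\<bar> \<le> 2 * Q * (2 * d) + 2 * Q * d + Q * (2 * d)" by linarith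
      then show ?thesis by (simp add: d_def)
    qed simp
  qed
qed

end

section \<open>From the Poincare inequality to the Riesz estimate\<close>

context poincare_space
begin

text \<open>
  The previous estimate applied to the least length of a chain from \<open>x\<close>, which is \<open>1\<close>-Lipschitz at scales below \<open>\<delta>\<close>.
\<close>
lemma short_chain_exists:
  obtains C where "1 \<le> C"
    "\<And>x y \<delta> \<eta>. 0 < \<delta> \<Longrightarrow> 0 < \<eta> \<Longrightarrow> \<exists>c. c < C * dist x y + \<eta> \<and> chain_cost \<delta> (\<lambda>_. 1) x (y::'a) c"
proof -
  obtain C where C: "1 \<le> C" "\<And>(u::'a \<Rightarrow> real) K x y. K-lipschitz_on UNIV u \<Longrightarrow> (\<And>z. lip u z \<le> 1) \<Longrightarrow> \<bar>u x - u y\<bar> \<le> C * dist x y"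
    using quasiconvex_estimate by blast
  show thesis
  proof (rule that[OF C(1)])
    fix x y :: 'a and \<delta> \<eta> :: real assume "0 < \<delta>" "0 < \<eta>"
    define N where "N = C * dist x y + \<eta>"
    have N: "0 \<le> N" using C(1) \<open>0 < \<eta>\<close> by (simp add: N_def)
    have w: "\<And>a::'a. 0 \<le> (\<lambda>_. 1::real) a" by simp
    define u where "u = truncated_cost \<delta> (\<lambda>_. 1) N x"
    have "(max 1 (N / \<delta>))-lipschitz_on UNIV u"
      unfolding u_def using \<open>0 < \<delta>\<close> by (intro truncated_cost_Lipschitz[OF w N]) auto
    moreover have "lip u z \<le> 1" for z
    proof -
      have "lip u z \<le> ennreal 1"
      proof (rule lip_le_local[OF \<open>0 < \<delta>\<close>])
        fix v assume "dist v z < \<delta>"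
        then show "\<bar>u v - u z\<bar> \<le> 1 * dist v z"
          using truncated_cost_local_Lipschitz[OF w N] unfolding u_def by fastforce
      qed
      then show ?thesis by simp
    qed
    ultimately have "\<bar>u x - u y\<bar> \<le> C * dist x y" by (rule C(2))
    moreover have "u x = 0" unfolding u_def by (rule truncated_cost_self[OF w N])
    ultimately have "u y < C * dist x y + \<eta>" using \<open>0 < \<eta>\<close> by linarith
    then obtain c where "c < C * dist x y + \<eta>" "chain_cost \<delta> (\<lambda>_. 1) x y c"
      using truncated_cost_chain[OF w N, of \<delta> x y "C * dist x y + \<eta>"] unfolding u_def N_def by auto
    then show "\<exists>c. c < C * dist x y + \<eta> \<and> chain_cost \<delta> (\<lambda>_. 1) x y c" by blast
  qed
qed

text \<open>
  A path of length about \<open>S\<close> with jumps below \<open>\<delta>\<close>.  The last condition is the essential one: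
  the path runs away from \<open>x\<close> at a linear rate, up to \<open>2 * \<eta>\<close>.
\<close>
definition quasigeodesic :: "real \<Rightarrow> real \<Rightarrow> real \<Rightarrow> 'a \<Rightarrow> 'a \<Rightarrow> (real \<Rightarrow> 'a) \<Rightarrow> real \<Rightarrow> bool" where
  "quasigeodesic C \<delta> \<eta> x y \<sigma> S \<longleftrightarrow>
     \<sigma> 0 = x \<and> \<sigma> S = y \<and> dist x y \<le> S \<and> S \<le> C * dist x y + \<eta> \<and>
     (\<forall>s t. 0 \<le> s \<longrightarrow> s \<le> t \<longrightarrow> dist (\<sigma> s) (\<sigma> t) \<le> t - s + \<delta>) \<and>
     (\<forall>s. 0 \<le> s \<longrightarrow> s \<le> S \<longrightarrow> s \<le> C * dist x (\<sigma> s) + 2 * \<eta>)"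

text \<open>
  Take a chain whose length \<open>S\<close> is within \<open>\<eta>\<close> of the infimum \<open>I\<close>.  If the point at time \<open>s\<close> could be reached by a
  chain much shorter than \<open>s\<close>, then continuing along the rest of the given chain would give a chain to \<open>y\<close>
  shorter than \<open>I\<close>; but a chain of length about \<open>C * dist x (\<sigma> s)\<close> to that point always exists.
\<close>
lemma quasigeodesic_exists:
  obtains C where "1 \<le> C"
    "\<And>x y \<delta> \<eta>. 0 < \<delta> \<Longrightarrow> 0 < \<eta> \<Longrightarrow> \<exists>\<sigma> S. quasigeodesic C \<delta> \<eta> x (y::'a) \<sigma> S"
proof -
  obtain C where C: "1 \<le> C"
    "\<And>x y \<delta> \<eta>. 0 < \<delta> \<Longrightarrow> 0 < \<eta> \<Longrightarrow> \<exists>c. c < C * dist x y + \<eta> \<and> chain_cost \<delta> (\<lambda>_. 1) x (y::'a) c"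
    using short_chain_exists by blast
  show thesis
  proof (rule that[OF C(1)])
    fix x y :: 'a and \<delta> \<eta> :: real assume "0 < \<delta>" "0 < \<eta>"
    define I where "I = Inf {c. chain_cost \<delta> (\<lambda>_. 1) x y c}"
    have nonneg: "0 \<le> c" if "chain_cost \<delta> (\<lambda>_. 1) x z c" for z c using chain_cost_nonneg[OF that] by simp
    have bdd: "bdd_below {c. chain_cost \<delta> (\<lambda>_. 1) x y c}" using nonneg by (intro bdd_belowI[of _ 0]) auto
    have ne: "{c. chain_cost \<delta> (\<lambda>_. 1) x y c} \<noteq> {}" using C(2)[OF \<open>0 < \<delta>\<close> \<open>0 < \<eta>\<close>, of x y] by blast
    have I_le: "I \<le> c" if "chain_cost \<delta> (\<lambda>_. 1) x y c" for c
      unfolding I_def using bdd that by (intro cInf_lower) auto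
    have "I \<le> C * dist x y"
    proof (rule field_le_epsilon)
      fix e :: real assume "e > 0"
      then show "I \<le> C * dist x y + e" using C(2)[OF \<open>0 < \<delta>\<close> \<open>e > 0\<close>, of x y] I_le by force
    qed
    obtain S where S: "S < I + \<eta>" "chain_cost \<delta> (\<lambda>_. 1) x y S"
      using cInf_lessD[OF ne, of "I + \<eta>"] \<open>0 < \<eta>\<close> unfolding I_def by auto
    have "0 \<le> S" using nonneg S(2) .
    from chain_parametrisation[OF S(2) _ \<open>0 < \<delta>\<close>] obtain \<sigma> where \<sigma>: "\<sigma> 0 = x" "\<And>t. t \<ge> S \<Longrightarrow> \<sigma> t = y"
      "\<And>s t \<kappa>. 0 \<le> s \<Longrightarrow> s \<le> t \<Longrightarrow> 0 < \<kappa> \<Longrightarrow> (\<forall>r\<in>{s..t}. \<kappa> \<le> 1) \<Longrightarrow> dist (\<sigma> s) (\<sigma> t) \<le> (t - s) / \<kappa> + \<delta>"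
      "\<And>s \<kappa>. 0 \<le> s \<Longrightarrow> s \<le> S \<Longrightarrow> 0 < \<kappa> \<Longrightarrow> (\<forall>r\<in>{s..S}. \<kappa> \<le> 1) \<Longrightarrow> dist (\<sigma> s) y \<le> (S - s) / \<kappa>"
      "\<And>s p. 0 \<le> s \<Longrightarrow> s \<le> S \<Longrightarrow> chain_cost \<delta> (\<lambda>_. 1) x (\<sigma> s) p \<Longrightarrow> \<exists>p'\<le>p + (S - s). chain_cost \<delta> (\<lambda>_. 1) x y p'"
      by auto
    show "\<exists>\<sigma> S. quasigeodesic C \<delta> \<eta> x y \<sigma> S"
      unfolding quasigeodesic_def
    proof (intro exI[of _ \<sigma>] exI[of _ S] conjI allI impI)
      show "dist x y \<le> S" using \<sigma>(4)[of 0 1] \<sigma>(1) \<open>0 \<le> S\<close> by simp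
      show "S \<le> C * dist x y + \<eta>" using S(1) \<open>I \<le> C * dist x y\<close> by linarith
      show "dist (\<sigma> s) (\<sigma> t) \<le> t - s + \<delta>" if "0 \<le> s" "s \<le> t" for s t using \<sigma>(3)[OF that, of 1] by simp
      show "s \<le> C * dist x (\<sigma> s) + 2 * \<eta>" if s: "0 \<le> s" "s \<le> S" for s
      proof -
        obtain p where p: "p < C * dist x (\<sigma> s) + \<eta>" "chain_cost \<delta> (\<lambda>_. 1) x (\<sigma> s) p"
          using C(2)[OF \<open>0 < \<delta>\<close> \<open>0 < \<eta>\<close>] by blast
        obtain p' where "p' \<le> p + (S - s)" "chain_cost \<delta> (\<lambda>_. 1) x y p'" using \<sigma>(5)[OF s p(2)] by blast
        then have "I \<le> p + (S - s)" using I_le by force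
        then show ?thesis using p(1) S(1) by linarith
      qed
    qed (use \<sigma> in auto)
  qed
qed

text \<open>
  The balls have centres \<open>w i = \<sigma> (s i)\<close> with \<open>s i = S * q ^ i\<close> and radii \<open>r i = c * s i\<close>.  The factor \<open>c\<close> is so small that
  the dilated balls stay away from \<open>x\<close>: they lie in annuli with radii comparable to \<open>s i\<close>.  The ratio \<open>q\<close> is so close to
  \<open>1\<close> that the ball of index \<open>i + 1\<close> is inside the ball with centre \<open>w i\<close> and radius \<open>2 * r i\<close>.  Each point is in at most \<open>m\<close> of the
  annuli, so the sum of the differences of averages is bounded by a multiple of the potential.  The path
  depends on the number \<open>N\<close> of steps, as \<open>\<delta>\<close> and \<open>\<eta>\<close> have to be small compared with the
  last radius; the constants do not, so that \<open>N\<close> can tend to infinity.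
\<close>
lemma half_riesz_estimate:
  obtains C L where "1 \<le> C" "1 \<le> L" "\<And>u K x y. K-lipschitz_on UNIV u \<Longrightarrow> x \<noteq> y \<Longrightarrow>
    ennreal \<bar>u x - avg u x (2 * dist x y)\<bar>
      \<le> ennreal C * potential u x y (ball x (L * dist x y))"
proof -
  obtain C1 where C1: "1 \<le> C1"
    "\<And>x y \<delta> \<eta>. 0 < \<delta> \<Longrightarrow> 0 < \<eta> \<Longrightarrow> \<exists>\<sigma> S. quasigeodesic C1 \<delta> \<eta> x (y::'a) \<sigma> S"
    using quasigeodesic_exists by blast
  \<comment> \<open>the dilated ball has radius \<open>2 * \<Lambda> * c * s i = s i / (4 * C1)\<close>, half of the lower bound for \<open>dist x (w i)\<close>\<close>
  define c where "c = 1 / (8 * \<Lambda> * C1)"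
  have LC: "1 \<le> \<Lambda> * C1" using \<Lambda>1 C1(1) mult_mono[of 1 \<Lambda> 1 C1] by simp
  have c: "0 < c" "c \<le> 1 / 8" using LC by (auto simp: c_def field_simps)
  have cL: "2 * \<Lambda> * c = 1 / (4 * C1)" "c * C1 \<le> 1 / 8" using \<Lambda>1 C1(1) by (auto simp: c_def field_simps)
  define q where "q = 1 - c / 2"
  have q: "1 / 2 \<le> q" "0 < q" "q < 1" using c by (auto simp: q_def)
  \<comment> \<open>large enough for all comparisons of radii and distances below\<close>
  define F where "F = 2 / c"
  have F: "16 \<le> F" "F * c = 2" "1 \<le> F" using c by (auto simp: F_def field_simps)
  obtain Q where Q: "1 \<le> Q" "\<And>u K x y a r z R. K-lipschitz_on UNIV u \<Longrightarrow> 0 < r \<Longrightarrow> dist a z + r \<le> R \<Longrightarrow> R \<le> F * r \<Longrightarrow>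
    (\<And>w. w \<in> ball z (\<Lambda> * R) \<Longrightarrow>
       (R \<le> F * dist x w \<and> dist x z \<le> F * R) \<or> (R \<le> F * dist y w \<and> dist y z \<le> F * R)) \<Longrightarrow>
    ennreal \<bar>avg u a r - avg u z R\<bar>
      \<le> ennreal Q * potential u x y (ball z (\<Lambda> * R))"
    using average_compare_riesz[OF F(3)] by blast
  have "\<exists>m. q ^ m < 1 / (12 * C1)" using real_arch_pow_inv[of "1 / (12 * C1)" q] q C1(1) by auto
  then obtain m where m0: "q ^ m < 1 / (12 * C1)" by blast
  then have m: "3 * q ^ m < 1 / (4 * C1)" by (simp add: field_simps)
  define L where "L = 7 * \<Lambda> * C1"
  show thesis
  proof (rule that[of "2 * Q * (1 + real m)" L])
    show "1 \<le> L" using LC by (simp add: L_def)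
    show "1 \<le> 2 * Q * (1 + real m)" using Q(1) mult_mono[of 1 "2 * Q" 1 "1 + real m"] by simp
    fix u :: "'a \<Rightarrow> real" and K :: real and x y :: 'a
    assume u: "K-lipschitz_on UNIV u" and "x \<noteq> y"
    have K0: "0 \<le> K" by (rule lipschitz_on_nonneg[OF u])
    have [measurable]: "lip u \<in> borel_measurable borel" by (rule borel_measurable_lip[OF u])
    define d where "d = dist x y"
    have d: "0 < d" using \<open>x \<noteq> y\<close> by (simp add: d_def)
    define k where "k w = lip u w * (riesz x w + riesz y w)" for w
    have [measurable]: "k \<in> borel_measurable borel" unfolding k_def by measurable
    define J where "J = (\<integral>\<^sup>+w\<in>ball x (L * d). k w \<partial>M)"
    have est: "ennreal \<bar>u x - avg u x (2 * d)\<bar>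
       \<le> ennreal (6 * K * C1 * d * q ^ N) + ennreal (2 * Q * (1 + real m)) * J" for N
    proof -
      have qN: "0 < q ^ N" "q ^ N \<le> 1" using q by (auto simp: power_le_one)
      \<comment> \<open>small compared with \<open>s N = S * q ^ N \<ge> d * q ^ N\<close>\<close>
      define \<delta> \<eta> where "\<delta> = c / 2 * (d * q ^ N)" and "\<eta> = d * q ^ N / 4"
      have \<delta>\<eta>: "0 < \<delta>" "0 < \<eta>" using c d qN by (auto simp: \<delta>_def \<eta>_def)
      obtain \<sigma> S where \<sigma>: "\<sigma> 0 = x" "\<sigma> S = y" and S: "d \<le> S" "S \<le> C1 * d + \<eta>"
        and step: "\<And>s t. 0 \<le> s \<Longrightarrow> s \<le> t \<Longrightarrow> dist (\<sigma> s) (\<sigma> t) \<le> t - s + \<delta>"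
        and far: "\<And>s. 0 \<le> s \<Longrightarrow> s \<le> S \<Longrightarrow> s \<le> C1 * dist x (\<sigma> s) + 2 * \<eta>"
        using C1(2)[OF \<delta>\<eta>, of x y] unfolding d_def quasigeodesic_def by blast
      have "0 < S" using S d by linarith
      have "d * q ^ N \<le> d" using qN d by simp
      then have "\<eta> \<le> d" using d unfolding \<eta>_def by linarith
      have "d \<le> C1 * d" using C1(1) d by simp
      have S2: "S \<le> 2 * (C1 * d)" using S(2) \<open>\<eta> \<le> d\<close> \<open>d \<le> C1 * d\<close> by linarith
      define s where "s i = S * q ^ i" for i
      have s_pos: "0 < s i" "s i \<le> S" for i using \<open>0 < S\<close> q by (auto simp: s_def power_le_one mult_left_le)
      have s_Suc: "s (Suc i) = s i - c / 2 * s i" for i by (simp add: s_def q_def algebra_simps)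
      have s_half: "s i / 2 \<le> s (Suc i)" for i
        using s_pos[of i] c mult_right_mono[of "c / 2" "1 / 2" "s i"] unfolding s_Suc by linarith
      have sN: "d * q ^ N \<le> s i" if "i \<le> N" for i
      proof -
        have "q ^ N \<le> q ^ i" using q that by (intro power_decreasing) auto
        then show ?thesis unfolding s_def using S(1) d qN by (intro mult_mono) auto
      qed
      define w where "w i = \<sigma> (s i)" for i
      define r where "r i = c * s i" for i
      have r_pos: "0 < r i" for i using c s_pos by (simp add: r_def)
      have far_i: "s i \<le> 2 * (C1 * dist x (w i))" if "i \<le> N" for i
        using far[of "s i"] s_pos[of i] sN[OF that] by (simp add: w_def \<eta>_def)
      have near_i: "dist x (w i) \<le> 2 * s i" if "i \<le> N" for i
      proof -
        have "c / 2 * (d * q ^ N) \<le> 1 * s i" using sN[OF that] c d qN by (intro mult_mono) auto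
        then have "\<delta> \<le> s i" by (simp add: \<delta>_def)
        then show ?thesis using step[of 0 "s i"] s_pos[of i] \<sigma>(1) by (simp add: w_def)
      qed
      have Ri: "\<Lambda> * (2 * r i) = s i / (4 * C1)" for i
      proof -
        have "\<Lambda> * (2 * r i) = (2 * \<Lambda> * c) * s i" by (simp add: r_def)
        then show ?thesis by (simp add: cL(1))
      qed
      have annulus: "1 / (4 * C1) * s i \<le> dist x v \<and> dist x v \<le> 3 * s i"
        if "i \<le> N" and v: "v \<in> ball (w i) (\<Lambda> * (2 * r i))" for i v
      proof -
        have 1: "dist (w i) v < s i / (4 * C1)" using v by (simp add: Ri)
        have 2: "s i / (2 * C1) \<le> dist x (w i)" using far_i[OF that(1)] C1(1) by (simp add: field_simps)
        have "s i / (4 * C1) \<le> s i" using C1(1) s_pos[of i] by (simp add: field_simps mult_le_cancel_left1)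
        then have "dist x v \<le> 3 * s i" using 1 near_i[OF that(1)] dist_triangle[of x v "w i"] by linarith
        moreover have "s i / (2 * C1) = s i / (4 * C1) + s i / (4 * C1)" using C1(1) by (simp add: field_simps)
        then have "s i / (4 * C1) \<le> dist x v" using 1 2 dist_triangle[of x "w i" v] by (simp add: dist_commute)
        ultimately show ?thesis by simp
      qed
      define T where "T i = (\<integral>\<^sup>+v\<in>ball (w i) (\<Lambda> * (2 * r i)). k v \<partial>M)" for i
      have cmp: "ennreal \<bar>avg u a \<rho> - avg u (w i) (2 * r i)\<bar> \<le> ennreal Q * T i"
        if "i \<le> N" and \<rho>: "0 < \<rho>" "dist a (w i) + \<rho> \<le> 2 * r i" "2 * r i \<le> F * \<rho>" for a \<rho> i
        unfolding T_def k_def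
      proof (rule Q(2)[OF u \<rho>], intro disjI1 conjI)
        fix v assume v: "v \<in> ball (w i) (\<Lambda> * (2 * r i))"
        have "2 * r i \<le> \<Lambda> * (2 * r i)" using \<Lambda>1 r_pos[of i] by simp
        also have "\<dots> \<le> dist x v" using annulus[OF that(1) v] by (simp add: Ri)
        also have "\<dots> \<le> F * dist x v" using F mult_right_mono[of 1 F "dist x v"] by simp
        finally show "2 * r i \<le> F * dist x v" .
        have "F * (2 * r i) = 2 * (F * c) * s i" by (simp add: r_def)
        then have "F * (2 * r i) = 4 * s i" by (simp add: F(2))
        then show "dist x (w i) \<le> F * (2 * r i)" using near_i[OF that(1)] s_pos[of i] by linarith
      qed
      define a where "a i = avg u (w i) (r i)" for i
      have stepA: "ennreal \<bar>a (Suc i) - a i\<bar> \<le> ennreal (2 * Q) * T i" if i: "i < N" for i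
      proof -
        define z where "z = avg u (w i) (2 * r i)"
        have "ennreal \<bar>a i - z\<bar> \<le> ennreal Q * T i"
          unfolding a_def z_def using i r_pos[of i] F(1) mult_right_mono[of 16 F "r i"] by (intro cmp) auto
        moreover have "ennreal \<bar>a (Suc i) - z\<bar> \<le> ennreal Q * T i"
          unfolding a_def z_def
        proof (rule cmp)
          have "dist (w (Suc i)) (w i) \<le> s i - s (Suc i) + \<delta>"
          proof -
            have "s (Suc i) \<le> s i" using s_Suc[of i] s_pos(1)[of i] c by simp
            then show ?thesis unfolding w_def by (intro step less_imp_le[OF s_pos(1)])
          qed
          moreover have "\<delta> \<le> c / 2 * s i" using sN[of i] i c by (simp add: \<delta>_def)
          moreover have "r (Suc i) \<le> r i" using c s_Suc[of i] s_pos[of i] by (simp add: r_def)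
          moreover have "s i - s (Suc i) = c / 2 * s i" by (simp add: s_Suc)
          moreover have "r i = c / 2 * s i + c / 2 * s i" by (simp add: r_def)
          ultimately show "dist (w (Suc i)) (w i) + r (Suc i) \<le> 2 * r i" by linarith
          have "r i \<le> 2 * r (Suc i)" using s_half[of i] c by (simp add: r_def)
          moreover have "16 * r (Suc i) \<le> F * r (Suc i)" using F(1) r_pos[of "Suc i"] by simp
          ultimately show "2 * r i \<le> F * r (Suc i)" using r_pos[of "Suc i"] by linarith
        qed (use i r_pos in auto)
        ultimately have "ennreal \<bar>a (Suc i) - z\<bar> + ennreal \<bar>z - a i\<bar> \<le> ennreal Q * T i + ennreal Q * T i"
          unfolding abs_minus_commute[of z] by (intro add_mono)
        then have "ennreal \<bar>a (Suc i) - a i\<bar> \<le> ennreal Q * T i + ennreal Q * T i"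
          by (rule order_trans[OF ennreal_abs_diff_triangle])
        also have "\<dots> = ennreal (2 * Q) * T i"
          using Q(1) by (simp add: ennreal_mult mult_2[symmetric] mult.assoc)
        finally show ?thesis .
      qed
      have sumT: "(\<Sum>i<N. T i) \<le> ennreal (real m) * J"
      proof -
        have "(\<Sum>i<N. T i) = (\<integral>\<^sup>+v. (\<Sum>i<N. k v * indicator (ball (w i) (\<Lambda> * (2 * r i))) v) \<partial>M)"
          unfolding T_def by (rule nn_integral_sum[symmetric]) measurable
        also have "\<dots> \<le> (\<integral>\<^sup>+v. ennreal (real m) * (k v * indicator (ball x (L * d)) v) \<partial>M)"
        proof (intro nn_integral_mono)
          fix v
          define X where "X = {i\<in>{..<N}. 1 / (4 * C1) * (S * q ^ i) \<le> dist x v \<and> dist x v \<le> 3 * (S * q ^ i)}"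
          have cX: "card X \<le> m" unfolding X_def using q \<open>0 < S\<close> m by (intro geometric_annuli_overlap) auto
          have "(\<Sum>i<N. k v * indicator (ball (w i) (\<Lambda> * (2 * r i))) v) \<le> (\<Sum>i<N. (k v * indicator (ball x (L * d)) v) * indicator X i)"
          proof (intro sum_mono)
            fix i assume i: "i \<in> {..<N}"
            show "k v * indicator (ball (w i) (\<Lambda> * (2 * r i))) v \<le> (k v * indicator (ball x (L * d)) v) * indicator X i"
            proof (cases "v \<in> ball (w i) (\<Lambda> * (2 * r i))")
              case True
              then have an: "1 / (4 * C1) * s i \<le> dist x v" "dist x v \<le> 3 * s i" using annulus[of i v] i by auto
              then have "i \<in> X" using i by (simp add: X_def s_def)
              have "dist x v \<le> 6 * (C1 * d)" using an(2) s_pos(2)[of i] S2 by linarith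
              also have "\<dots> < L * d"
              proof -
                have "C1 * d \<le> \<Lambda> * (C1 * d)" using \<Lambda>1 C1(1) d by simp
                moreover have "0 < C1 * d" using C1(1) d by simp
                moreover have "L * d = 7 * (\<Lambda> * (C1 * d))" by (simp add: L_def)
                ultimately show ?thesis by linarith
              qed
              finally show ?thesis using \<open>i \<in> X\<close> by (simp add: indicator_def)
            qed simp
          qed
          also have "\<dots> = (k v * indicator (ball x (L * d)) v) * (\<Sum>i<N. indicator X i)"
            by (simp only: sum_distrib_left)
          also have "(\<Sum>i<N. indicator X i) = (of_nat (card X) :: ennreal)"
          proof -
            have "X \<subseteq> {..<N}" by (auto simp: X_def)
            then show ?thesis by (simp add: indicator_def sum.If_cases Int_absorb1)
          qed
          also have "(k v * indicator (ball x (L * d)) v) * of_nat (card X) \<le> ennreal (real m) * (k v * indicator (ball x (L * d)) v)"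
          proof -
            have "(of_nat (card X) :: ennreal) \<le> ennreal (real m)"
              using cX by (simp add: ennreal_of_nat_eq_real_of_nat ennreal_leI)
            then show ?thesis by (subst mult.commute) (intro mult_right_mono, auto)
          qed
          finally show "(\<Sum>i<N. k v * indicator (ball (w i) (\<Lambda> * (2 * r i))) v) \<le> ennreal (real m) * (k v * indicator (ball x (L * d)) v)" .
        qed
        also have "\<dots> = ennreal (real m) * J" unfolding J_def by (rule nn_integral_cmult) measurable
        finally show ?thesis .
      qed
      have tele: "ennreal \<bar>a N - a 0\<bar> \<le> ennreal (2 * Q) * (ennreal (real m) * J)"
      proof -
        have "ennreal \<bar>a N - a 0\<bar> \<le> (\<Sum>i<N. ennreal \<bar>a (Suc i) - a i\<bar>)" by (rule ennreal_telescope)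
        also have "\<dots> \<le> (\<Sum>i<N. ennreal (2 * Q) * T i)" using stepA by (intro sum_mono) auto
        also have "\<dots> = ennreal (2 * Q) * (\<Sum>i<N. T i)" by (simp add: sum_distrib_left)
        also have "\<dots> \<le> ennreal (2 * Q) * (ennreal (real m) * J)" using sumT by (intro mult_left_mono) auto
        finally show ?thesis .
      qed
      have base: "ennreal \<bar>a 0 - avg u x (2 * d)\<bar> \<le> ennreal Q * J"
      proof -
        have w0: "w 0 = y" "r 0 = c * S" using \<sigma> by (auto simp: w_def r_def s_def)
        have cS: "c * S \<le> d" 
        proof -
          have "c * S \<le> c * (2 * (C1 * d))" using S2 c by (intro mult_left_mono) auto
          also have "\<dots> = 2 * (c * C1) * d" by simp
          also have "\<dots> \<le> 2 * (1 / 8) * d" using cL(2) d by (intro mult_right_mono) auto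
          finally show ?thesis using d by linarith
        qed
        have "ennreal \<bar>a 0 - avg u x (2 * d)\<bar>
          \<le> ennreal Q * potential u x y (ball x (\<Lambda> * (2 * d)))"
          unfolding a_def w0
        proof (rule Q(2)[OF u])
          show "0 < c * S" using c \<open>0 < S\<close> by simp
          show "dist y x + c * S \<le> 2 * d" using cS by (simp add: d_def dist_commute)
          have "F * (c * S) = 2 * S" using F(2) by (metis mult.assoc)
          then show "2 * d \<le> F * (c * S)" using S(1) by linarith
          fix v assume "v \<in> ball x (\<Lambda> * (2 * d))"
          have "d \<le> dist x v + dist y v" unfolding d_def using dist_triangle[of x y v] by (simp add: dist_commute)
          then have "2 * d \<le> 4 * dist x v \<or> 2 * d \<le> 4 * dist y v" by linarith
          moreover have "4 * dist x v \<le> F * dist x v" "4 * dist y v \<le> F * dist y v"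
            using F(1) by (auto intro!: mult_right_mono)
          moreover have "2 * d \<le> F * (2 * d)" using F(3) d by simp
          ultimately show "2 * d \<le> F * dist x v \<and> dist x x \<le> F * (2 * d) \<or> 2 * d \<le> F * dist y v \<and> dist y x \<le> F * (2 * d)"
            using d by (auto simp: d_def dist_commute)
        qed
        also have "\<dots> \<le> ennreal Q * J"
        proof (intro mult_left_mono)
          have "\<Lambda> * (2 * d) \<le> L * d"
          proof -
            have "\<Lambda> * d \<le> (\<Lambda> * d) * C1" using \<Lambda>1 C1(1) d by simp
            moreover have "0 < \<Lambda> * d" using \<Lambda>1 d by simp
            moreover have "L * d = 7 * ((\<Lambda> * d) * C1)" by (simp add: L_def)
            ultimately show ?thesis by linarith
          qed
          then show "potential u x y (ball x (\<Lambda> * (2 * d))) \<le> J"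
            unfolding J_def k_def by (intro nn_integral_mono) (auto split: split_indicator)
        qed simp
        finally show ?thesis .
      qed
      have "\<bar>u x - a N\<bar> \<le> K * (dist x (w N) + r N)" unfolding a_def by (rule average_near[OF u r_pos])
      also have "\<dots> \<le> K * (3 * s N)"
      proof (intro mult_left_mono K0)
        have "r N \<le> s N" using c s_pos[of N] by (simp add: r_def)
        then show "dist x (w N) + r N \<le> 3 * s N" using near_i[of N] by linarith
      qed
      also have "\<dots> = 3 * K * S * q ^ N" by (simp add: s_def)
      also have "\<dots> \<le> 3 * K * (2 * (C1 * d)) * q ^ N" using S2 K0 qN by (intro mult_right_mono mult_left_mono) auto
      finally have tip: "\<bar>u x - a N\<bar> \<le> 6 * K * C1 * d * q ^ N" by (simp add: mult_ac)
      have "ennreal \<bar>u x - avg u x (2 * d)\<bar>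
         \<le> ennreal \<bar>u x - a N\<bar> + (ennreal \<bar>a N - a 0\<bar> + ennreal \<bar>a 0 - avg u x (2 * d)\<bar>)"
        by (meson add_left_mono ennreal_abs_diff_triangle order_trans)
      also have "\<dots> \<le> ennreal (6 * K * C1 * d * q ^ N) + (ennreal (2 * Q) * (ennreal (real m) * J) + ennreal Q * J)"
        using tip tele base by (intro add_mono ennreal_leI)
      also have "ennreal (2 * Q) * (ennreal (real m) * J) + ennreal Q * J \<le> ennreal (2 * Q * (1 + real m)) * J"
      proof -
        have "ennreal (2 * Q) * (ennreal (real m) * J) + ennreal Q * J = ennreal (2 * Q * real m + Q) * J"
          using Q(1) by (simp add: ennreal_mult ring_distribs mult_ac)
        also have "\<dots> \<le> ennreal (2 * Q * (1 + real m)) * J"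
          using Q(1) by (intro mult_right_mono ennreal_leI) (auto simp: ring_distribs)
        finally show ?thesis .
      qed
      finally show ?thesis by (simp add: add_left_mono)
    qed
    have "(\<lambda>N. ennreal (6 * K * C1 * d * q ^ N) + ennreal (2 * Q * (1 + real m)) * J)
      \<longlonglongrightarrow> ennreal (6 * K * C1 * d * 0) + ennreal (2 * Q * (1 + real m)) * J"
      using q by (intro tendsto_intros LIMSEQ_realpow_zero) auto
    then have "ennreal \<bar>u x - avg u x (2 * d)\<bar> \<le> ennreal (6 * K * C1 * d * 0) + ennreal (2 * Q * (1 + real m)) * J"
      by (rule LIMSEQ_le_const) (use est in blast)
    then show "ennreal \<bar>u x - avg u x (2 * dist x y)\<bar>
      \<le> ennreal (2 * Q * (1 + real m)) * potential u x y (ball x (L * dist x y))"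
      by (simp add: J_def k_def d_def)
  qed
qed


text \<open>
  Both halves end in balls of radius \<open>2 * d\<close>, around \<open>x\<close> and around \<open>y\<close>, where \<open>d = dist x y\<close>.  These are compared inside the ball
  of radius \<open>3 * d\<close> around \<open>x\<close>: it contains both poles, but no point of it is close to both.
\<close>
lemma riesz_estimate:
  obtains C L where "1 \<le> C" "1 \<le> L" "\<And>u K x y. K-lipschitz_on UNIV u \<Longrightarrow>
    ennreal \<bar>u x - u y\<bar> \<le> ennreal C * (\<integral>\<^sup>+z. lip u z \<partial>riesz_measure M L x y)"
proof -
  obtain C1 L1 where C1: "1 \<le> C1" "1 \<le> L1" "\<And>u K x y. K-lipschitz_on UNIV u \<Longrightarrow> x \<noteq> y \<Longrightarrow>
    ennreal \<bar>u x - avg u x (2 * dist x y)\<bar>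
      \<le> ennreal C1 * potential u x y (ball x (L1 * dist x y))"
    using half_riesz_estimate by blast
  obtain Q where Q: "1 \<le> Q" "\<And>u K x y a r z R. K-lipschitz_on UNIV u \<Longrightarrow> 0 < r \<Longrightarrow> dist a z + r \<le> R \<Longrightarrow> R \<le> 6 * r \<Longrightarrow>
    (\<And>w. w \<in> ball z (\<Lambda> * R) \<Longrightarrow>
       (R \<le> 6 * dist x w \<and> dist x z \<le> 6 * R) \<or> (R \<le> 6 * dist y w \<and> dist y z \<le> 6 * R)) \<Longrightarrow>
    ennreal \<bar>avg u a r - avg u z R\<bar>
      \<le> ennreal Q * potential u x y (ball z (\<Lambda> * R))"
    using average_compare_riesz[of 6] by auto
  define L where "L = L1 + 3 * \<Lambda>"
  show thesis
  proof (rule that[of "2 * C1 + 2 * Q" L])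
    show "1 \<le> 2 * C1 + 2 * Q" using C1(1) Q(1) by simp
    show "1 \<le> L" using C1(2) \<Lambda>1 by (simp add: L_def)
    fix u :: "'a \<Rightarrow> real" and K :: real and x y :: 'a
    assume u: "K-lipschitz_on UNIV u"
    show "ennreal \<bar>u x - u y\<bar> \<le> ennreal (2 * C1 + 2 * Q) * (\<integral>\<^sup>+z. lip u z \<partial>riesz_measure M L x y)"
    proof (cases "x = y")
      case False
      define d where "d = dist x y"
      have d: "0 < d" using False by (simp add: d_def)
      define J where "J = (\<integral>\<^sup>+z. lip u z \<partial>riesz_measure M L x y)"
      have J: "J = potential u x y (riesz_ball L x y)"
        unfolding J_def by (rule nn_integral_lip_riesz_measure[OF u])
      have LJ: "potential u x y (ball z (l * d)) \<le> J"
        if z: "z = x \<or> z = y" and l: "l \<le> 2 * L" for z l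
      proof -
        have "l * d \<le> 2 * L * d" using l d by (intro mult_right_mono) auto
        then have "ball z (l * d) \<subseteq> riesz_ball L x y" using z by (auto simp: riesz_ball_def d_def)
        then show ?thesis unfolding J by (intro nn_integral_mono) (auto split: split_indicator)
      qed
      define b where "b z = avg u z (2 * d)" for z
      define e where "e = avg u x (3 * d)"
      have tip: "ennreal \<bar>u z - b z\<bar> \<le> ennreal C1 * J" if z: "z = x \<and> z' = y \<or> z = y \<and> z' = x" for z z'
      proof -
        have "z \<noteq> z'" using z False by auto
        have dz: "dist z z' = d" using z by (auto simp: d_def dist_commute)
        have rz: "riesz z w + riesz z' w = riesz x w + riesz y w" for w using z by (auto simp: add.commute)
        have "ennreal \<bar>u z - b z\<bar> \<le> ennreal C1 * potential u x y (ball z (L1 * d))"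
          using C1(3)[OF u \<open>z \<noteq> z'\<close>] unfolding dz rz b_def .
        also have "\<dots> \<le> ennreal C1 * J"
          using z C1(2) \<Lambda>1 by (intro mult_left_mono LJ) (auto simp: L_def)
        finally show ?thesis .
      qed
      have 1: "ennreal \<bar>u x - b x\<bar> \<le> ennreal C1 * J" by (rule tip[of x y]) simp
      have 2: "ennreal \<bar>u y - b y\<bar> \<le> ennreal C1 * J" by (rule tip[of y x]) simp
      have mid: "ennreal \<bar>b z - e\<bar> \<le> ennreal Q * J" if z: "z = x \<or> z = y" for z
      proof -
        have "ennreal \<bar>b z - e\<bar> \<le> ennreal Q * potential u x y (ball x (\<Lambda> * (3 * d)))"
          unfolding b_def e_def
        proof (rule Q(2)[OF u])
          show "dist z x + 2 * d \<le> 3 * d" using z d by (auto simp: d_def dist_commute)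
          fix w
          have "d \<le> dist x w + dist y w" unfolding d_def using dist_triangle[of x y w] by (simp add: dist_commute)
          then have "3 * d \<le> 6 * dist x w \<or> 3 * d \<le> 6 * dist y w" by linarith
          then show "3 * d \<le> 6 * dist x w \<and> dist x x \<le> 6 * (3 * d) \<or> 3 * d \<le> 6 * dist y w \<and> dist y x \<le> 6 * (3 * d)"
            using d by (auto simp: d_def dist_commute)
        qed (use d in auto)
        also have "\<dots> \<le> ennreal Q * J"
          using LJ[of x "3 * \<Lambda>"] C1(2) \<Lambda>1 by (intro mult_left_mono) (auto simp: L_def mult_ac)
        finally show ?thesis .
      qed
      have "ennreal \<bar>u x - u y\<bar> \<le> ennreal \<bar>u x - b x\<bar> + (ennreal \<bar>b x - e\<bar> + (ennreal \<bar>b y - e\<bar> + ennreal \<bar>u y - b y\<bar>))"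
        by (simp add: ennreal_plus[symmetric] ennreal_leI del: ennreal_plus)
      also have "\<dots> \<le> ennreal C1 * J + (ennreal Q * J + (ennreal Q * J + ennreal C1 * J))"
        using 1 2 mid by (intro add_mono) auto
      also have "\<dots> = ennreal (2 * C1 + 2 * Q) * J"
      proof -
        have "ennreal (2 * C1 + 2 * Q) = ennreal C1 + (ennreal Q + (ennreal Q + ennreal C1))"
          using C1(1) Q(1) by (simp add: ennreal_plus[symmetric] del: ennreal_plus)
        then show ?thesis by (simp add: ring_distribs)
      qed
      finally show ?thesis by (simp add: J_def)
    qed simp
  qed
qed

section \<open>From the Riesz estimate to the width bound\<close>

text \<open>
  The Riesz estimate applied to the cost of chains from \<open>x\<close>.  At a point \<open>z\<close> outside \<open>U\<close> all points \<open>v\<close> at distance less than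
  \<open>\<delta>\<close> have the small weight \<open>\<epsilon>\<close>, because the ball of radius \<open>\<delta>\<close> around \<open>v\<close> contains \<open>z\<close>; this is why
  the weight is defined by balls contained in \<open>U\<close>.
\<close>
lemma open_width_le:
  fixes x y :: 'a
  assumes est: "\<And>u K. K-lipschitz_on UNIV u \<Longrightarrow>
      ennreal \<bar>u x - u y\<bar> \<le> ennreal C * (\<integral>\<^sup>+z. lip u z \<partial>N)"
    and N: "sets N = sets borel" and C: "0 \<le> C" and T0: "ennreal C * (emeasure N U + ennreal \<epsilon> * emeasure N UNIV) \<le> ennreal T" "0 \<le> T"
    and U: "open U" and "x \<noteq> y" "0 < \<epsilon>" "0 < \<eta>"
  shows "width x y U \<le> ennreal (T + \<eta>)"
proof -
  note [measurable_cong] = N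
  have [measurable]: "U \<in> sets borel" using U by simp
  have "\<exists>c\<le>T + \<eta>. chain_cost (1 / Suc n) (\<lambda>a. \<epsilon> + (if ball a (1 / Suc n) \<subseteq> U then 1 else 0)) x y c" for n
  proof -
    define \<delta> where "\<delta> = 1 / real (Suc n)"
    have "0 < \<delta>" by (simp add: \<delta>_def)
    define w where "w a = \<epsilon> + (if ball a \<delta> \<subseteq> U then 1 else 0)" for a
    have w: "\<And>a. 0 \<le> w a" "\<And>a. w a \<le> \<epsilon> + 1" using \<open>0 < \<epsilon>\<close> by (auto simp: w_def)
    have N0: "0 \<le> T + \<eta>" using T0(2) \<open>0 < \<eta>\<close> by simp
    define u where "u = truncated_cost \<delta> w (T + \<eta>) x"
    have u: "(max (\<epsilon> + 1) ((T + \<eta>) / \<delta>))-lipschitz_on UNIV u"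
      unfolding u_def using w(2) by (intro truncated_cost_Lipschitz[OF w(1) N0 \<open>0 < \<delta>\<close>])
    have lipu: "lip u z \<le> indicator U z + ennreal \<epsilon>" for z
    proof -
      have "lip u z \<le> ennreal (\<epsilon> + (if z \<in> U then 1 else 0))"
      proof (rule lip_le_local[OF \<open>0 < \<delta>\<close>])
        fix v assume v: "dist v z < \<delta>"
        have "\<bar>u v - u z\<bar> \<le> max (w v) (w z) * dist v z"
          unfolding u_def by (rule truncated_cost_local_Lipschitz[OF w(1) N0 v])
        also have "\<dots> \<le> (\<epsilon> + (if z \<in> U then 1 else 0)) * dist v z"
        proof (intro mult_right_mono)
          have "z \<in> ball v \<delta>" "z \<in> ball z \<delta>" using v \<open>0 < \<delta>\<close> by auto
          then show "max (w v) (w z) \<le> \<epsilon> + (if z \<in> U then 1 else 0)" unfolding w_def by auto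
        qed simp
        finally show "\<bar>u v - u z\<bar> \<le> (\<epsilon> + (if z \<in> U then 1 else 0)) * dist v z" .
      qed
      also have "\<dots> = indicator U z + ennreal \<epsilon>"
        using \<open>0 < \<epsilon>\<close> by (auto simp: indicator_def add.commute)
      finally show ?thesis .
    qed
    have "ennreal \<bar>u x - u y\<bar> \<le> ennreal C * (\<integral>\<^sup>+z. lip u z \<partial>N)" by (rule est[OF u])
    also have "\<dots> \<le> ennreal C * (\<integral>\<^sup>+z. indicator U z + ennreal \<epsilon> \<partial>N)"
      using lipu by (intro mult_left_mono nn_integral_mono) auto
    also have "\<dots> = ennreal C * (emeasure N U + ennreal \<epsilon> * emeasure N UNIV)"
      using sets_eq_imp_space_eq[OF N] by (subst nn_integral_add) auto
    also have "\<dots> \<le> ennreal T" by (rule T0)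
    finally have "\<bar>u x - u y\<bar> \<le> T" using T0(2) by (simp add: ennreal_le_iff)
    moreover have "u x = 0" unfolding u_def by (rule truncated_cost_self[OF w(1) N0])
    ultimately have "u y < T + \<eta>" using \<open>0 < \<eta>\<close> by linarith
    then obtain c where "c < T + \<eta>" "chain_cost \<delta> w x y c"
      using truncated_cost_chain[where w=w and \<delta>=\<delta> and x=x and z=y and B="T + \<eta>", OF w(1) N0] unfolding u_def by auto
    then show ?thesis unfolding w_def \<delta>_def by (intro exI[of _ c]) auto
  qed
  from curve_of_chains[OF compact_cball U \<open>x \<noteq> y\<close> \<open>0 < \<epsilon>\<close> this]
  obtain \<gamma> where "\<gamma> \<in> lipschitz_curves x y" "curve_length_in \<gamma> U \<le> ennreal (T + \<eta>)" by blast
  then show ?thesis unfolding width_def by (intro INF_lower2)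
qed

text \<open>
  Approximation of \<open>A\<close> from outside by open sets, with an error that absorbs the term \<open>\<epsilon>\<close> of the weight.
\<close>
lemma width_le_of_riesz_estimate:
  fixes x y :: 'a
  assumes est: "\<And>u K. K-lipschitz_on UNIV u \<Longrightarrow>
      ennreal \<bar>u x - u y\<bar> \<le> ennreal C * (\<integral>\<^sup>+z. lip u z \<partial>riesz_measure M L x y)"
    and C: "0 \<le> C" and A: "A \<in> sets borel" and "x \<noteq> y"
  shows "width x y A \<le> ennreal C * emeasure (riesz_measure M L x y) A"
proof -
  define N where "N = riesz_measure M L x y"
  have N: "sets N = sets borel" "emeasure N UNIV < \<infinity>" "space N = UNIV"
    using finite_riesz_measure sets_eq_imp_space_eq[of N borel] by (auto simp: N_def)
  interpret N: finite_measure N using N by (intro finite_measureI) auto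
  define n where "n X = measure N X" for X
  have n: "emeasure N X = ennreal (n X)" "0 \<le> n X" for X by (auto simp: n_def N.emeasure_eq_measure)
  have "width x y A \<le> ennreal C * emeasure N A"
  proof (rule ennreal_le_epsilon)
    fix e :: real assume "0 < e"
    \<comment> \<open>half of the error \<open>e\<close> pays for \<open>U - A\<close> and for the weight \<open>e'\<close>, the other half for the slack in the choice of chains\<close>
    define e' where "e' = e / (2 * (C + 1) * (1 + n UNIV))"
    have pos: "0 < 2 * (C + 1) * (1 + n UNIV)" using C n(2)[of UNIV] by simp
    have "0 < e'" unfolding e'_def using \<open>0 < e\<close> pos by simp
    have "emeasure N A = (INF U\<in>{U. A \<subseteq> U \<and> open U}. emeasure N U)"
      using N A by (intro outer_regular) auto
    moreover have "emeasure N A < emeasure N A + ennreal e'"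
      using \<open>0 < e'\<close> by (simp add: n ennreal_plus[symmetric] ennreal_less_iff del: ennreal_plus)
    ultimately obtain U where U: "A \<subseteq> U" "open U" "emeasure N U < emeasure N A + ennreal e'"
      by (auto simp: INF_less_iff)
    have nU: "n U \<le> n A + e'"
      using U(3) \<open>0 < e'\<close> n(2)[of A] by (simp add: n ennreal_plus[symmetric] ennreal_less_iff del: ennreal_plus)
    define T where "T = C * (n U + e' * n UNIV)"
    have T: "0 \<le> T" using C n(2) \<open>0 < e'\<close> by (simp add: T_def)
    have "ennreal C * (emeasure N U + ennreal e' * emeasure N UNIV) \<le> ennreal T"
      using C n(2) \<open>0 < e'\<close> by (simp add: n T_def ennreal_mult)
    then have "width x y U \<le> ennreal (T + e / 2)"
      using est \<open>0 < e\<close> \<open>0 < e'\<close> \<open>x \<noteq> y\<close> U(2) C N(1) T unfolding N_def[symmetric]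
      by (intro open_width_le[where C=C and N=N and \<epsilon>=e']) auto
    also have "\<dots> \<le> ennreal (C * n A + e)"
    proof (rule ennreal_leI)
      have "T \<le> C * (n A + e' + e' * n UNIV)" unfolding T_def using nU C by (intro mult_left_mono) auto
      also have "\<dots> = C * n A + C * (1 + n UNIV) * e'" by (simp add: algebra_simps)
      also have "C * (1 + n UNIV) * e' \<le> (C + 1) * (1 + n UNIV) * e'"
        using n(2)[of UNIV] \<open>0 < e'\<close> by (intro mult_right_mono) auto
      also have "(C + 1) * (1 + n UNIV) * e' = e / 2"
        unfolding e'_def using pos by (simp add: field_simps)
      finally show "T + e / 2 \<le> C * n A + e" by simp
    qed
    also have "\<dots> = ennreal C * emeasure N A + ennreal e"
      using C n(2)[of A] \<open>0 < e\<close> by (simp add: n ennreal_mult)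
    finally show "width x y A \<le> ennreal C * emeasure N A + ennreal e"
      using width_mono[OF U(1), of x y] by (rule order_trans[rotated])
  qed
  then show ?thesis unfolding N_def .
qed

end

section \<open>The characterisation\<close>

lemma doubling_spaceI:
  assumes "metric_measure_space M" "doubling M"
  obtains D where "doubling_space M D"
proof -
  obtain C where C: "0 < C" "\<And>z r. 0 < r \<Longrightarrow> emeasure M (ball z (2 * r)) \<le> ennreal C * emeasure M (ball z r)"
    using assms(2) unfolding doubling_def by blast
  have "doubling_space M (max 1 C)"
  proof
    fix z :: 'a and r :: real assume "0 < r"
    have "ennreal C * emeasure M (ball z r) \<le> ennreal (max 1 C) * emeasure M (ball z r)"
      by (intro mult_right_mono ennreal_leI) auto
    with C(2)[OF \<open>0 < r\<close>] show "emeasure M (ball z (2 * r)) \<le> ennreal (max 1 C) * emeasure M (ball z r)"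
      by (rule order_trans)
  qed (use assms(1) in \<open>auto simp: metric_measure_space_def\<close>)
  then show thesis by (rule that)
qed

theorem corollary1p5:
  fixes M :: "'a::polish_space measure"
  assumes "metric_measure_space M" and "doubling M"
  shows "poincare_1 M \<longleftrightarrow>
    (\<exists>C L::real. C > 0 \<and> L \<ge> 1 \<and>
      (\<forall>x y. \<forall>A\<in>sets borel. width x y A \<le> ennreal C * emeasure (riesz_measure M L x y) A))"
proof -
  obtain D where "doubling_space M D" using doubling_spaceI[OF assms] .
  then interpret doubling_space M D .
  show ?thesis
  proof
    assume "poincare_1 M"
    then obtain P \<Lambda> where "1 \<le> P" "1 \<le> \<Lambda>" and PI: "\<And>u K z r. K-lipschitz_on UNIV u \<Longrightarrow> 0 < r \<Longrightarrow>
      (\<integral>\<^sup>+w\<in>ball z r. ennreal \<bar>u w - average M (ball z r) u\<bar> \<partial>M) / emeasure M (ball z r)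
      \<le> ennreal (P * r) * ((\<integral>\<^sup>+w\<in>ball z (\<Lambda> * r). lip u w \<partial>M) / emeasure M (ball z (\<Lambda> * r)))"
      unfolding poincare_1_def by blast
    then interpret poincare_space M D P \<Lambda> by unfold_locales
    obtain C L where C: "1 \<le> C" "1 \<le> L" "\<And>u K x y. K-lipschitz_on UNIV u \<Longrightarrow>
      ennreal \<bar>u x - u y\<bar> \<le> ennreal C * (\<integral>\<^sup>+z. lip u z \<partial>riesz_measure M L x y)"
      using riesz_estimate by blast
    have "width x y A \<le> ennreal C * emeasure (riesz_measure M L x y) A" if "A \<in> sets borel" for x y A
      using width_le_of_riesz_estimate[OF C(3) _ that, where x=x and y=y] C(1) by (cases "x = y") auto
    then show "\<exists>C L::real. C > 0 \<and> L \<ge> 1 \<and>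
      (\<forall>x y. \<forall>A\<in>sets borel. width x y A \<le> ennreal C * emeasure (riesz_measure M L x y) A)"
      using C(1,2) by (intro exI[of _ C] exI[of _ L]) auto
  next
    assume "\<exists>C L::real. C > 0 \<and> L \<ge> 1 \<and>
      (\<forall>x y. \<forall>A\<in>sets borel. width x y A \<le> ennreal C * emeasure (riesz_measure M L x y) A)"
    then obtain C L where C: "0 < C" "1 \<le> L"
      and width: "\<And>x y A. A \<in> sets borel \<Longrightarrow> width x y A \<le> ennreal C * emeasure (riesz_measure M L x y) A" by blast
    show "poincare_1 M"
      using C by (intro riesz_estimate_imp_poincare[of C L] width_imp_riesz_estimate width) auto
  qed
qed

end
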